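(* Let $k\geq 2$, let $\chi_1,\chi_2$ be primitive quadratic Dirichlet characters with conductors $q_1,q_2$ such that $\chi_1\chi_2(-1)=(-1)^k$, and let $m$ be a real number. Let $G$ be a finite generating set of $\Gamma_1(q_1q_2)$. If for every $\gamma\in G$ the function $h_{\gamma,\chi_1,\chi_2,k}$ coincides on its domain with a polynomial belonging to $\mathcal P(k;m,q_1)$, then $\widetilde S_{\chi_1,\chi_2,k}(\Gamma_1(q_1q_2))\subseteq m\mathbb Z/q_1$, i.e. $\widetilde S_{\chi_1,\chi_2,k}(\gamma)\in\{mn/q_1:n\in\mathbb Z\}$ for every $\gamma\in\Gamma_1(q_1q_2)$ with nonzero lower-left entry.
   Context: Notation: $e(z)=\exp(2\pi iz)$; $\tau(\chi)$ is the Gauss sum; $j(\gamma,z)=cz+d$ for $\gamma=\begin{pmatrix}a&b\\c&d\end{pmatrix}$. $E_{\chi_1,\chi_2,k}(z)=2\sum_{N\ge1}\sum_{A\mid N}\chi_1(A)\overline{\chi_2}(N/A)(N/A)^{k-1}e(Nz)$ on the upper half plane; $P_{k-2}(z;X,Y)=(Xz+Y)^{k-2}$. For $\gamma\in\Gamma_0(q_1q_2)$ with $c\neq0$, $S_{\chi_1,\chi_2,k}(\gamma)=(-1)^k\tau(\overline{\chi_1})(k-1)\int_\infty^{\gamma\infty}E_{\chi_1,\chi_2,k}(z)P_{k-2}(z;1,-a/c)\,dz$, and (for quadratic $\chi_1,\chi_2$) $\widetilde S_{\chi_1,\chi_2,k}(\gamma)=c^{k-2}S_{\chi_1,\chi_2,k}(\gamma)$.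 On the set $(\Gamma_0(q_1q_2))(\infty)$ of cusps $\gamma\infty$, $\gamma\in\Gamma_0(q_1q_2)$, define $\widehat S_{\chi_1,\chi_2,k}(\infty)=0$ and $\widehat S_{\chi_1,\chi_2,k}(\mathfrak a)=(-1)^k\tau(\overline{\chi_1})(k-1)\int_\infty^{\mathfrak a}E_{\chi_1,\chi_2,k}(z)P_{k-2}(z;1,-\mathfrak a)dz$ for $\mathfrak a\ne\infty$ (so $\widehat S(\gamma\infty)=S(\gamma)$). For $\gamma\in\Gamma_0(q_1q_2)$ let $h_{\gamma,\chi_1,\chi_2,k}(\mathfrak a)=\widehat S_{\chi_1,\chi_2,k}(\mathfrak a)-j(\gamma,\mathfrak a)^{k-2}\widehat S_{\chi_1,\chi_2,k}(\gamma\mathfrak a)$ for $\mathfrak a\in(\Gamma_0(q_1q_2))(\infty)\setminus\{\infty\}$. Finally $$\mathcal P(k;m,q)=\Big\{\sum_{n=0}^{k-2}a_nx^{k-n-2}\in\mathbb Q[x]:\ q^{n+1}a_n\in m\mathbb Z\ \text{for all }n\Big\}.$$ *)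

theory Defs
  imports "HOL-Analysis.Analysis" "HOL-Computational_Algebra.Polynomial"
    "HOL-Number_Theory.Cong"
begin

definition ee :: "complex \<Rightarrow> complex" where
  "ee z = exp (2 * of_real pi * \<i> * z)"

definition dirichlet_char :: "nat \<Rightarrow> (int \<Rightarrow> complex) \<Rightarrow> bool" where
  "dirichlet_char q chi \<longleftrightarrow> q > 0 \<and> (\<forall>n. chi (n + int q) = chi n) \<and>
     (\<forall>m n. chi (m * n) = chi m * chi n) \<and> chi 1 = 1 \<and>
     (\<forall>n. chi n = 0 \<longleftrightarrow> \<not> coprime n (int q))"

definition primitive_char :: "nat \<Rightarrow> (int \<Rightarrow> complex) \<Rightarrow> bool" where
  "primitive_char q chi \<longleftrightarrow> dirichlet_char q chi \<and>
     (\<forall>d::nat. d dvd q \<and> d < q \<longrightarrow>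
        (\<exists>n. coprime n (int q) \<and> [n = 1] (mod int d) \<and> chi n \<noteq> 1))"

definition quadratic_char :: "(int \<Rightarrow> complex) \<Rightarrow> bool" where
  "quadratic_char chi \<longleftrightarrow> (\<forall>n. chi n \<in> {-1, 0, 1}) \<and> (\<exists>n. chi n = -1)"

definition gauss_sum :: "nat \<Rightarrow> (int \<Rightarrow> complex) \<Rightarrow> complex" where
  "gauss_sum q chi = (\<Sum>a<q. chi (int a) * ee (of_nat a / of_nat q))"

definition eisen :: "(int \<Rightarrow> complex) \<Rightarrow> (int \<Rightarrow> complex) \<Rightarrow> nat \<Rightarrow> complex \<Rightarrow> complex" where
  "eisen chi1 chi2 k z = 2 * (\<Sum>n. let N = Suc n in
      (\<Sum>A\<in>{A. A dvd N}. chi1 (int A) * cnj (chi2 (int (N div A))) * of_nat (N div A) ^ (k - 1))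
      * ee (of_nat N * z))"

definition int_inf_to :: "(complex \<Rightarrow> complex) \<Rightarrow> real \<Rightarrow> complex" where
  "int_inf_to f a = - integral {0<..} (\<lambda>t::real. f (of_real a + \<i> * of_real t) * \<i>)"

definition Shat :: "(int \<Rightarrow> complex) \<Rightarrow> (int \<Rightarrow> complex) \<Rightarrow> nat \<Rightarrow> nat \<Rightarrow> real \<Rightarrow> complex" where
  "Shat chi1 chi2 q1 k a = (-1) ^ k * gauss_sum q1 (\<lambda>n. cnj (chi1 n)) * of_nat (k - 1) *
     int_inf_to (\<lambda>z. eisen chi1 chi2 k z * (z - of_real a) ^ (k - 2)) a"

type_synonym mat2 = "int \<times> int \<times> int \<times> int"

definition S_fun :: "(int \<Rightarrow> complex) \<Rightarrow> (int \<Rightarrow> complex) \<Rightarrow> nat \<Rightarrow> nat \<Rightarrow> mat2 \<Rightarrow> complex" where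
  "S_fun chi1 chi2 q1 k \<gamma> = (case \<gamma> of (a, b, c, d) \<Rightarrow> Shat chi1 chi2 q1 k (of_int a / of_int c))"

definition Stilde :: "(int \<Rightarrow> complex) \<Rightarrow> (int \<Rightarrow> complex) \<Rightarrow> nat \<Rightarrow> nat \<Rightarrow> mat2 \<Rightarrow> complex" where
  "Stilde chi1 chi2 q1 k \<gamma> = (case \<gamma> of (a, b, c, d) \<Rightarrow> of_int c ^ (k - 2) * S_fun chi1 chi2 q1 k \<gamma>)"

text \<open>h_gamma(a) = Shat(a) - j(gamma,a)^(k-2) Shat(gamma a), with Shat(infinity) = 0.\<close>
definition h_fun :: "(int \<Rightarrow> complex) \<Rightarrow> (int \<Rightarrow> complex) \<Rightarrow> nat \<Rightarrow> nat \<Rightarrow> mat2 \<Rightarrow> real \<Rightarrow> complex" where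
  "h_fun chi1 chi2 q1 k \<gamma> x = (case \<gamma> of (a, b, c, d) \<Rightarrow>
     (let j = of_int c * x + of_int d in
      Shat chi1 chi2 q1 k x - of_real j ^ (k - 2) *
        (if j = 0 then 0 else Shat chi1 chi2 q1 k ((of_int a * x + of_int b) / j))))"

definition Gamma0 :: "int \<Rightarrow> mat2 set" where
  "Gamma0 N = {(a, b, c, d). a * d - b * c = 1 \<and> N dvd c}"

definition Gamma1 :: "int \<Rightarrow> mat2 set" where
  "Gamma1 N = {(a, b, c, d). a * d - b * c = 1 \<and> N dvd c \<and> [a = 1] (mod N) \<and> [d = 1] (mod N)}"

text \<open>Finite cusps in the orbit of infinity under Gamma0(N).\<close>
definition finite_cusps0 :: "int \<Rightarrow> real set" where
  "finite_cusps0 N = {of_int a / of_int c | a b c d. (a, b, c, d) \<in> Gamma0 N \<and> c \<noteq> 0}"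

definition mat_mult :: "mat2 \<Rightarrow> mat2 \<Rightarrow> mat2" where
  "mat_mult x y = (case x of (a, b, c, d) \<Rightarrow> case y of (a', b', c', d') \<Rightarrow>
      (a * a' + b * c', a * b' + b * d', c * a' + d * c', c * b' + d * d'))"

definition mat_inv :: "mat2 \<Rightarrow> mat2" where
  "mat_inv x = (case x of (a, b, c, d) \<Rightarrow> (d, -b, -c, a))"

inductive_set gen_group :: "mat2 set \<Rightarrow> mat2 set" for G where
  gen_one: "(1, 0, 0, 1) \<in> gen_group G"
| gen_base: "g \<in> G \<Longrightarrow> g \<in> gen_group G"
| gen_mult: "x \<in> gen_group G \<Longrightarrow> y \<in> gen_group G \<Longrightarrow> mat_mult x y \<in> gen_group G"
| gen_inv: "x \<in> gen_group G \<Longrightarrow> mat_inv x \<in> gen_group G"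

definition Pset :: "nat \<Rightarrow> real \<Rightarrow> nat \<Rightarrow> rat poly set" where
  "Pset k m q = {p. degree p \<le> k - 2 \<and>
     (\<forall>n \<le> k - 2. \<exists>z::int. real_of_rat (of_nat q ^ (n + 1) * coeff p (k - n - 2)) = m * of_int z)}"

end

theory Submission
  imports Defs "HOL-Complex_Analysis.Complex_Analysis" "HOL-Real_Asymp.Real_Asymp"
begin

text \<open>
  Write \<open>K = k - 2\<close> and \<open>E\<close> for the Eisenstein series. By the Lipschitz formula, \<open>E\<close> is up to a constant
  the lattice sum of \<open>\<chi>\<^sub>1(c) \<psi>(d) (c q\<^sub>2 z + d)\<^bsup>-k\<^esup>\<close>, with \<open>\<psi>\<close> the finite Fourier transform of \<open>\<chi>\<^sub>2\<close>. For \<open>k = 2\<close>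
  this converges only conditionally; inserting the factor \<open>1 / (1 + \<epsilon> |c q\<^sub>2 z + d|)\<close> makes it absolutely
  convergent, the action of \<open>\<Gamma>\<^sub>1\<close> merely rescales \<open>\<epsilon>\<close>, and summation by parts in \<open>d\<close> (\<open>\<psi>\<close> has mean zero)
  gives a majorant that allows \<open>\<epsilon> \<rightarrow> 0\<close>. Hence \<open>E\<close> is modular of weight \<open>k\<close> on \<open>\<Gamma>\<^sub>1\<close>.

  Let \<open>r\<^sub>\<gamma>(u, v)\<close> be the integral of \<open>E(w) (u w + v)\<^sup>K\<close> from \<open>\<infinity>\<close> to \<open>\<gamma>\<infinity>\<close>. It is a homogeneous polynomial in
  \<open>(u, v)\<close> and a cocycle: \<open>r\<^bsub>\<gamma>\<delta>\<^esub>(u, v) = r\<^sub>\<delta>((u, v) \<gamma>) + r\<^sub>\<gamma>(u, v)\<close>. For a constant \<open>C\<close>, one has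
  \<open>h\<^sub>\<gamma>(x) = C r\<^bsub>\<gamma>\<inverse>\<^esub>(1, -x)\<close> on cusps, and \<open>C r\<^sub>\<gamma>(c, -a)\<close> is \<open>Stilde \<gamma>\<close>. If \<open>h\<^sub>\<gamma>\<close> lies in \<open>P(k; m, q\<^sub>1)\<close>,
  then \<open>q\<^sub>1 C r\<^bsub>\<gamma>\<inverse>\<^esub>(u q\<^sub>1, v)\<close> is an integral multiple of \<open>m\<close> for all integers \<open>u, v\<close>. This property passes to
  products and inverses since \<open>q\<^sub>1\<close> divides \<open>c\<close>, so it holds on all of \<open>\<Gamma>\<^sub>1\<close>; take \<open>u = c / q\<^sub>1\<close>, \<open>v = -a\<close>.
\<close>

section \<open>The Lipschitz formula\<close>


lemma ee_add: "ee (x + y) = ee x * ee y"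
  by (simp add: ee_def exp_add ring_distribs)

lemma ee_of_nat_mult: "ee (of_nat n * z) = ee z ^ n"
  by (simp add: ee_def exp_of_nat_mult [symmetric] mult_ac)

lemma norm_ee: "norm (ee z) = exp (- 2 * pi * Im z)"
  by (simp add: ee_def)

lemma norm_ee_less_1: "Im z > 0 \<Longrightarrow> norm (ee z) < 1"
  by (simp add: norm_ee)

lemma ee_of_int: "ee (of_int n) = 1"
  using exp_integer_2pi[of "of_int n"] by (simp add: ee_def mult_ac)

lemma has_field_derivative_ee: "(ee has_field_derivative 2 * of_real pi * \<i> * ee z) (at z within A)"
  unfolding ee_def by (auto intro!: derivative_eq_intros)

text \<open>Termwise differentiation keeps the radius of convergence 1, and followed by
  multiplication by \<open>x\<close> it raises the exponent of \<open>n\<close> by one.\<close>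

lemma summable_power_times_power:
  fixes x :: "'a :: {real_normed_field, banach}"
  assumes "norm x < 1"
  shows "summable (\<lambda>n. of_nat n ^ k * x ^ n)"
  using assms
proof (induction k arbitrary: x)
  case 0
  then show ?case by (simp add: summable_geometric)
next
  case (Suc k)
  have "summable (\<lambda>n. diffs (\<lambda>n. of_nat n ^ k) n * x ^ n)"
    by (rule termdiff_converges[where K = 1]) (use Suc in auto)
  from summable_mult2[OF this, of x]
  have "summable (\<lambda>n. of_nat (Suc n) ^ Suc k * x ^ Suc n)"
    by (simp add: diffs_def mult_ac)
  then show ?case by (subst (asm) summable_Suc_iff)
qed

lemma summable_norm_poly_bound:
  fixes a :: "nat \<Rightarrow> complex"
  assumes a: "\<And>n. norm (a n) \<le> real n ^ k" and x: "norm x < 1"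
  shows "summable (\<lambda>n. norm (a n * x ^ n))"
proof (rule summable_comparison_test')
  show "summable (\<lambda>n. real n ^ k * norm x ^ n)"
    using summable_power_times_power[of "norm x" k] x by simp
  show "norm (norm (a n * x ^ n)) \<le> real n ^ k * norm x ^ n" for n
    using a[of n] by (simp add: norm_mult norm_power mult_right_mono)
qed

text \<open>Chain rule for a power series in \<open>ee z\<close>, whose derivative is a multiple of
  \<open>ee z\<close> itself; absorbing that factor undoes the index shift of
  \<open>diffs\<close>.\<close>

lemma has_field_derivative_q_series:
  fixes a :: "nat \<Rightarrow> complex"
  assumes a: "\<And>n. norm (a n) \<le> real n ^ k" and z: "Im z > 0"
  shows "((\<lambda>z. \<Sum>n. a n * ee z ^ n) has_field_derivative
           2 * of_real pi * \<i> * (\<Sum>n. of_nat n * a n * ee z ^ n)) (at z)"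
proof -
  have a': "norm (of_nat n * a n) \<le> real n ^ Suc k" for n
    using a[of n] by (simp add: norm_mult mult_left_mono)
  have "DERIV (\<lambda>x. \<Sum>n. a n * x ^ n) (ee z) :> (\<Sum>n. diffs a n * ee z ^ n)"
    by (rule termdiffs_strong'[where K = 1])
       (use summable_norm_cancel[OF summable_norm_poly_bound[OF a]] norm_ee_less_1[OF z] in auto)
  from DERIV_chain2[OF this has_field_derivative_ee]
  have "((\<lambda>z. \<Sum>n. a n * ee z ^ n) has_field_derivative
           (\<Sum>n. diffs a n * ee z ^ n) * (2 * of_real pi * \<i> * ee z)) (at z)" .
  moreover have "(\<Sum>n. of_nat n * a n * ee z ^ n) = (\<Sum>n. diffs a n * ee z ^ n) * ee z"
  proof -
    have s: "summable (\<lambda>n. of_nat n * a n * ee z ^ n)"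
      by (rule summable_norm_cancel[OF summable_norm_poly_bound[OF a' norm_ee_less_1[OF z]]])
    have s': "summable (\<lambda>n. diffs a n * ee z ^ n)"
      by (rule termdiff_converges[where K = 1])
       (use summable_norm_cancel[OF summable_norm_poly_bound[OF a]] norm_ee_less_1[OF z] in auto)
    show ?thesis
      using suminf_split_head[OF s] suminf_mult2[OF s', of "ee z"]
      by (simp add: diffs_def mult_ac)
  qed
  ultimately show ?thesis by (simp add: mult_ac)
qed

lemma Im_nonzero_not_nonpos_Int: "Im z \<noteq> 0 \<Longrightarrow> z \<notin> \<int>\<^sub>\<le>\<^sub>0"
  by (auto elim!: nonpos_Ints_cases)

lemma sin_nonzero_of_Im_nonzero: "Im z \<noteq> 0 \<Longrightarrow> sin (of_real pi * z) \<noteq> (0::complex)"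
  by (subst sin_eq_0) (auto simp: complex_eq_iff)

text \<open>Logarithmic derivative of Euler's reflection formula for \<open>Gamma\<close>; off the
  real axis neither \<open>z\<close> nor \<open>1 - z\<close> is a pole, and the sine does not
  vanish.\<close>

lemma Digamma_reflection_complex:
  fixes z :: complex
  assumes "Im z \<noteq> 0"
  shows "Digamma (1 - z) - Digamma z = of_real pi * cot (of_real pi * z)"
proof -
  have z1: "z \<notin> \<int>\<^sub>\<le>\<^sub>0" "1 - z \<notin> \<int>\<^sub>\<le>\<^sub>0"
    using assms Im_nonzero_not_nonpos_Int[of z] Im_nonzero_not_nonpos_Int[of "1 - z"] by auto
  note sn = sin_nonzero_of_Im_nonzero[OF assms]
  have G: "((\<lambda>z::complex. Gamma z * Gamma (1 - z)) has_field_derivative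
          Gamma z * Gamma (1 - z) * (Digamma z - Digamma (1 - z))) (at z)"
    using z1 by (auto intro!: derivative_eq_intros simp: algebra_simps)
  have "((\<lambda>z::complex. of_real pi / sin (of_real pi * z)) has_field_derivative
          - (of_real pi * (cos (of_real pi * z) * of_real pi)) / (sin (of_real pi * z))\<^sup>2) (at z)"
    using sn by (auto intro!: derivative_eq_intros simp: power2_eq_square)
  with G have "Gamma z * Gamma (1 - z) * (Digamma z - Digamma (1 - z)) =
     - (of_real pi * (cos (of_real pi * z) * of_real pi)) / (sin (of_real pi * z))\<^sup>2"
    unfolding Gamma_reflection_complex by (rule DERIV_unique)
  hence "of_real pi / sin (of_real pi * z) * (Digamma z - Digamma (1 - z)) =
     - (of_real pi * (cos (of_real pi * z) * of_real pi)) / (sin (of_real pi * z))\<^sup>2"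
    unfolding Gamma_reflection_complex .
  moreover have *: "y - x = P * (c / s)"
    if "P / s * (x - y) = - (P * (c * P)) / s\<^sup>2" "s \<noteq> 0" "P \<noteq> 0" for P s c x y :: complex
  proof -
    have "y - x = - (P / s * (x - y)) * (s / P)" using that(2,3) by simp
    also have "\<dots> = P * (c / s)" unfolding that(1) using that(2,3) by (simp add: power2_eq_square)
    finally show ?thesis .
  qed
  ultimately show ?thesis
    unfolding cot_def by (intro *) (use sn in auto)
qed

text \<open>The cotangent is a rational function of \<open>p * p = ee z\<close>, and
  \<open>norm (ee z) < 1\<close> permits the geometric series.\<close>

lemma pi_cot_q_expansion:
  assumes "Im z > 0"
  shows "of_real pi * cot (of_real pi * z) =
           - \<i> * of_real pi - 2 * of_real pi * \<i> * (\<Sum>n. (if n = 0 then 0 else 1) * ee z ^ n)"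
proof -
  define p where "p = exp (\<i> * (of_real pi * z))"
  have p0: "p \<noteq> 0" by (simp add: p_def)
  have q: "ee z = p * p" by (simp add: p_def ee_def exp_add [symmetric] mult_ac)
  have q1: "norm (ee z) < 1" using assms by (rule norm_ee_less_1)
  hence q2: "p * p \<noteq> 1" by (auto simp: q [symmetric])
  have pm: "exp (- (\<i> * (of_real pi * z))) = 1 / p" by (simp add: p_def exp_minus field_simps)
  have "(\<lambda>n. ee z ^ Suc n) sums (ee z * (1 / (1 - ee z)))"
    using sums_mult[OF geometric_sums[OF q1], of "ee z"] by simp
  hence "(\<lambda>n. (if Suc n = 0 then 0 else 1) * ee z ^ Suc n) sums (ee z * (1 / (1 - ee z)))" by simp
  hence "(\<Sum>n. (if n = 0 then 0 else 1) * ee z ^ n) = ee z / (1 - ee z)"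
    by (subst (asm) sums_Suc_iff) (simp add: sums_iff)
  moreover have "cot (of_real pi * z) = - \<i> - 2 * \<i> * (ee z / (1 - ee z))"
    unfolding cot_def sin_exp_eq cos_exp_eq p_def [symmetric] pm q
    using p0 q2 by (simp add: divide_simps) (simp add: algebra_simps)
  ultimately show ?thesis by (simp only:) (simp add: ring_distribs mult_ac)
qed


section \<open>Summability over the integers and lower bounds at lattice points\<close>

lemma summable_on_int_powr:
  assumes "p > 1"
  shows "(\<lambda>d::int. (1 + \<bar>real_of_int d\<bar>) powr - p) summable_on UNIV"
proof -
  have "summable (\<lambda>n. real n powr - p)" using assms by (simp add: summable_real_powr_iff)
  hence "summable (\<lambda>n. real (Suc n) powr - p)" by (subst summable_Suc_iff)
  hence s: "(\<lambda>n. (1 + real n) powr - p) summable_on UNIV"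
    by (intro summable_nonneg_imp_summable_on) auto
  have pos: "(\<lambda>d::int. (1 + \<bar>real_of_int d\<bar>) powr - p) summable_on range int"
    by (subst summable_on_reindex) (use s in \<open>auto simp: o_def\<close>)
  have neg: "(\<lambda>d::int. (1 + \<bar>real_of_int d\<bar>) powr - p) summable_on range (\<lambda>n. - int n)"
    by (subst summable_on_reindex) (use s in \<open>auto simp: o_def inj_on_def\<close>)
  have "d \<in> range int \<union> range (\<lambda>n. - int n)" for d
    by (cases d rule: int_cases2) auto
  hence "(UNIV :: int set) = range int \<union> range (\<lambda>n. - int n)" by blast
  with summable_on_union[OF pos neg] show ?thesis by simp
qed

text \<open>Positive definiteness of the quadratic form |c w + d|^2 for non-real \<open>w\<close>;
  \<open>1 / M\<close> is an explicit admissible constant.\<close>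

lemma norm_lattice_point_bound:
  assumes "Im w \<noteq> 0"
  obtains \<delta> where "\<delta> > 0"
    "\<And>c d::real. \<delta> * (c\<^sup>2 + d\<^sup>2) \<le> (norm (of_real c * w + of_real d))\<^sup>2"
proof -
  define x y M where "x = Re w" "y = Im w" "M = 2 + (1 + 2 * x\<^sup>2) / y\<^sup>2"
  have y: "y\<^sup>2 > 0" using assms by (simp add: x_y_M_def)
  have M: "M > 0" using y by (auto simp: x_y_M_def intro!: add_pos_nonneg)
  have "1 / M * (c\<^sup>2 + d\<^sup>2) \<le> (norm (of_real c * w + of_real d))\<^sup>2" for c d :: real
  proof -
    have n: "(norm (of_real c * w + of_real d))\<^sup>2 = (c * x + d)\<^sup>2 + c\<^sup>2 * y\<^sup>2"
      by (simp add: cmod_power2 x_y_M_def power_mult_distrib)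
    \<comment> \<open>This square is exactly the difference of the two sides of the next
      inequality.\<close>
    have "0 \<le> (2 * (c * x) + d)\<^sup>2" by simp
    hence "c\<^sup>2 + d\<^sup>2 \<le> 2 * (c * x + d)\<^sup>2 + c\<^sup>2 * (1 + 2 * x\<^sup>2)"
      by (simp add: power2_eq_square algebra_simps)
    also have "\<dots> = 2 * (c * x + d)\<^sup>2 + (1 + 2 * x\<^sup>2) / y\<^sup>2 * (c\<^sup>2 * y\<^sup>2)"
      using y by simp
    also have "\<dots> \<le> M * (c * x + d)\<^sup>2 + M * (c\<^sup>2 * y\<^sup>2)"
      by (intro add_mono mult_right_mono) (auto simp: x_y_M_def)
    finally show ?thesis using M unfolding n by (simp add: field_simps)
  qed
  thus ?thesis using M that[of "1 / M"] by simp
qed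

lemma norm_int_shift_bound:
  assumes "Im w \<noteq> 0"
  obtains C where "C > 0" "\<And>d::int. 1 + \<bar>real_of_int d\<bar> \<le> C * norm (w + of_int d)"
proof -
  obtain \<delta> where d: "\<delta> > 0"
    "\<And>c d::real. \<delta> * (c\<^sup>2 + d\<^sup>2) \<le> (norm (of_real c * w + of_real d))\<^sup>2"
    using norm_lattice_point_bound[OF assms] by blast
  have "1 + \<bar>real_of_int n\<bar> \<le> sqrt (2 / \<delta>) * norm (w + of_int n)" for n
  proof -
    have "0 \<le> (1 - \<bar>real_of_int n\<bar>)\<^sup>2" by simp
    hence "(1 + \<bar>real_of_int n\<bar>)\<^sup>2 \<le> 2 * (1\<^sup>2 + (real_of_int n)\<^sup>2)"
      by (simp add: power2_eq_square algebra_simps)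
    also have "\<dots> \<le> 2 * ((norm (w + of_int n))\<^sup>2 / \<delta>)"
      using d(2)[of 1 "of_int n"] d(1) by (simp add: field_simps)
    finally have "1 + \<bar>real_of_int n\<bar> \<le> sqrt (2 * ((norm (w + of_int n))\<^sup>2 / \<delta>))"
      by (rule real_le_rsqrt)
    also have "\<dots> = sqrt (2 / \<delta>) * norm (w + of_int n)"
      using d(1) by (simp add: real_sqrt_mult real_sqrt_divide)
    finally show ?thesis .
  qed
  thus ?thesis using d(1) that[of "sqrt (2 / \<delta>)"] by simp
qed

text \<open>Bounding by a product separates \<open>c\<close> from \<open>d\<close>, so that lattice
  sums reduce to one-dimensional ones; \<open>c \<noteq> 0\<close> excludes the origin.\<close>

lemma norm_int_lattice_bound:
  assumes "Im w \<noteq> 0"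
  obtains C where "C > 0"
    "\<And>c d::int. c \<noteq> 0 \<Longrightarrow> (1 + \<bar>real_of_int c\<bar>) * (1 + \<bar>real_of_int d\<bar>) \<le> C * (norm (of_int c * w + of_int d))\<^sup>2"
proof -
  obtain \<delta> where d: "\<delta> > 0"
    "\<And>c d::real. \<delta> * (c\<^sup>2 + d\<^sup>2) \<le> (norm (of_real c * w + of_real d))\<^sup>2"
    using norm_lattice_point_bound[OF assms] by blast
  have "(1 + \<bar>real_of_int c\<bar>) * (1 + \<bar>real_of_int d\<bar>) \<le> 4 / \<delta> * (norm (of_int c * w + of_int d))\<^sup>2"
    if "c \<noteq> 0" for c d
  proof -
    define u v where "u = \<bar>real_of_int c\<bar>" "v = \<bar>real_of_int d\<bar>"
    have u: "u \<ge> 1" "v \<ge> 0" using that by (auto simp: u_v_def)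
    have "u * 1 \<le> u * u" using u by (intro mult_left_mono) auto
    moreover have "0 \<le> (u - v)\<^sup>2" "0 \<le> (1 - v)\<^sup>2" "0 \<le> v * v" by auto
    ultimately have "(1 + u) * (1 + v) \<le> 4 * (u\<^sup>2 + v\<^sup>2)"
      using u(1) mult.commute[of v u] unfolding power2_eq_square ring_distribs by linarith
    also have "\<dots> = 4 * ((real_of_int c)\<^sup>2 + (real_of_int d)\<^sup>2)" by (simp add: u_v_def)
    also have "\<dots> \<le> 4 * ((norm (of_int c * w + of_int d))\<^sup>2 / \<delta>)"
      using d(2)[of "of_int c" "of_int d"] d(1) by (simp add: field_simps)
    finally show ?thesis by (simp add: u_v_def)
  qed
  thus ?thesis using d(1) that[of "4 / \<delta>"] by simp
qed

lemma summable_on_int_inverse_power: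
  assumes "Im w \<noteq> 0" "k \<ge> 2"
  shows "(\<lambda>d::int. norm (1 / (w + of_int d) ^ k)) summable_on UNIV"
proof -
  obtain C where C: "C > 0" "\<And>d::int. 1 + \<bar>real_of_int d\<bar> \<le> C * norm (w + of_int d)"
    using norm_int_shift_bound[OF assms(1)] by blast
  have "(\<lambda>d::int. C ^ k * (1 + \<bar>real_of_int d\<bar>) powr - 2) summable_on UNIV"
    by (intro summable_on_cmult_right summable_on_int_powr) auto
  thus ?thesis
  proof (rule Infinite_Sum.abs_summable_on_comparison_test')
    fix d :: int
    have p: "norm (w + of_int d) > 0" using assms(1) by (auto simp: complex_eq_iff)
    have "(1 + \<bar>real_of_int d\<bar>) powr 2 \<le> (1 + \<bar>real_of_int d\<bar>) powr real k"
      using assms(2) by (intro powr_mono) auto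
    also have "\<dots> = (1 + \<bar>real_of_int d\<bar>) ^ k" by (simp add: powr_realpow)
    also have "\<dots> \<le> (C * norm (w + of_int d)) ^ k"
      by (intro power_mono C(2)) auto
    finally show "norm (1 / (w + of_int d) ^ k) \<le> C ^ k * (1 + \<bar>real_of_int d\<bar>) powr - 2"
      using p C(1) by (simp add: norm_divide norm_power powr_minus power_mult_distrib divide_simps mult_ac)
  qed
qed

text \<open>Repeated differentiation of the digamma reflection formula: each derivative brings down
  \<open>2 * pi * \<i> * m\<close> from \<open>ee z ^ m\<close>, and the constant survives only for
  \<open>n = 0\<close>.\<close>

lemma Polygamma_reflection_q_expansion:
  assumes "Im z > 0"
  shows "(-1) ^ n * Polygamma n (1 - z) - Polygamma n z =
    (if n = 0 then - \<i> * of_real pi else 0)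
     - (2 * of_real pi * \<i>) ^ Suc n * (\<Sum>m. (if m = 0 then 0 else of_nat m ^ n) * ee z ^ m)"
  using assms
proof (induction n arbitrary: z)
  case 0
  then show ?case using Digamma_reflection_complex[of z] pi_cot_q_expansion[of z] by (simp cong: if_cong)
next
  case (Suc n)
  let ?L = "\<lambda>z::complex. (-1) ^ n * Polygamma n (1 - z) - Polygamma n z"
  let ?R = "\<lambda>z::complex. (if n = 0 then - \<i> * of_real pi else 0)
     - (2 * of_real pi * \<i>) ^ Suc n * (\<Sum>m. (if m = 0 then 0 else of_nat m ^ n) * ee z ^ m)"
  have z1: "z \<notin> \<int>\<^sub>\<le>\<^sub>0" "1 - z \<notin> \<int>\<^sub>\<le>\<^sub>0"
    using Suc.prems Im_nonzero_not_nonpos_Int[of z] Im_nonzero_not_nonpos_Int[of "1 - z"] by auto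
  have "(?L has_field_derivative ((-1) ^ Suc n * Polygamma (Suc n) (1 - z) - Polygamma (Suc n) z)) (at z)"
    using z1 by (auto intro!: derivative_eq_intros simp: algebra_simps)
  moreover have D: "((\<lambda>z. \<Sum>m. (if m = 0 then 0 else of_nat m ^ n) * ee z ^ m) has_field_derivative
      2 * of_real pi * \<i> * (\<Sum>m. of_nat m * (if m = 0 then 0 else of_nat m ^ n) * ee z ^ m)) (at z)"
    by (rule has_field_derivative_q_series[where k = n]) (use Suc.prems in \<open>auto simp: norm_power\<close>)
  have "(?R has_field_derivative
      - ((2 * of_real pi * \<i>) ^ Suc n * (2 * of_real pi * \<i> *
        (\<Sum>m. of_nat m * (if m = 0 then 0 else of_nat m ^ n) * ee z ^ m)))) (at z)"
    by (rule DERIV_cong[OF DERIV_diff[OF DERIV_const DERIV_cmult[OF D]]]) simp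
  \<comment> \<open>\<open>?L\<close> and \<open>?R\<close> agree on the open upper half-plane by
    the induction hypothesis, so they have the same derivative there.\<close>
  hence "(?L has_field_derivative
      - ((2 * of_real pi * \<i>) ^ Suc n * (2 * of_real pi * \<i> *
        (\<Sum>m. of_nat m * (if m = 0 then 0 else of_nat m ^ n) * ee z ^ m)))) (at z)"
    by (rule has_field_derivative_transform_within_open[where S = "{z. Im z > 0}"])
       (use Suc in \<open>auto simp: open_halfspace_Im_gt\<close>)
  ultimately have "(-1) ^ Suc n * Polygamma (Suc n) (1 - z) - Polygamma (Suc n) z =
      - ((2 * of_real pi * \<i>) ^ Suc n * (2 * of_real pi * \<i> *
        (\<Sum>m. of_nat m * (if m = 0 then 0 else of_nat m ^ n) * ee z ^ m)))"
    by (rule DERIV_unique)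
  moreover have "(\<lambda>m. of_nat m * (if m = 0 then 0 else of_nat m ^ n) * ee z ^ m) =
     (\<lambda>m. (if m = 0 then 0 else of_nat m ^ Suc n) * ee z ^ m)"
    by auto
  ultimately show ?case by (simp only:) (simp add: mult_ac)
qed

text \<open>The terms with \<open>n \<ge> 0\<close> form the polygamma series at \<open>z\<close>,
  those with \<open>n < 0\<close> the one at \<open>1 - z\<close>; the reflection expansion
  evaluates their combination.\<close>

theorem Lipschitz_formula:
  assumes z: "Im z > 0" and k: "k \<ge> 2"
  shows "((\<lambda>n::int. 1 / (z + of_int n) ^ k) has_sum
     ((- 2 * of_real pi * \<i>) ^ k / fact (k - 1) *
       (\<Sum>m. (if m = 0 then 0 else of_nat m ^ (k - 1)) * ee z ^ m))) UNIV"
proof -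
  let ?f = "\<lambda>n::int. 1 / (z + of_int n) ^ k"
  obtain n where n: "k = Suc n" "n > 0" using k by (cases k) auto
  have z0: "z \<noteq> 0" using z by auto
  have abs: "(\<lambda>n. norm (?f n)) summable_on UNIV"
    using summable_on_int_inverse_power[of z k] z k by auto
  hence sm: "?f summable_on A" for A
    by (rule summable_on_subset[OF abs_summable_summable]) auto
  have "(\<lambda>j. ?f (int j)) sums infsum ?f (range int)"
    using has_sum_infsum[OF sm[of "range int"]]
    by (subst (asm) has_sum_reindex) (auto simp: o_def intro: has_sum_imp_sums)
  moreover have "(\<lambda>j. ?f (int j)) sums ((-1) ^ Suc n * Polygamma n z / fact n)"
    using Polygamma_LIMSEQ[of z n] z0 n by (auto simp: inverse_eq_divide)
  ultimately have 1: "infsum ?f (range int) = (-1) ^ Suc n * Polygamma n z / fact n"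
    by (rule sums_unique2)
  \<comment> \<open>The negative integers start at \<open>- int (Suc 0)\<close>, so that 0 is
    counted only once, and \<open>z - (j + 1) = - (1 - z + j)\<close>.\<close>
  have "(\<lambda>j. ?f (- int (Suc j))) sums infsum ?f (range (\<lambda>j. - int (Suc j)))"
    using has_sum_infsum[OF sm[of "range (\<lambda>j. - int (Suc j))"]]
    by (subst (asm) has_sum_reindex) (auto simp: o_def inj_on_def intro: has_sum_imp_sums)
  moreover have "(\<lambda>j. (-1) ^ Suc n * inverse ((1 - z + of_nat j) ^ Suc n)) sums
       ((-1) ^ Suc n * ((-1) ^ Suc n * Polygamma n (1 - z) / fact n))"
    using z n by (intro sums_mult Polygamma_LIMSEQ) (auto simp: complex_eq_iff)
  moreover have "(-1) ^ Suc n * inverse ((1 - z + of_nat j) ^ Suc n) = ?f (- int (Suc j))" for j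
  proof -
    have "z + of_int (- int (Suc j)) = - (1 - z + of_nat j)" by simp
    thus ?thesis unfolding n by (simp only: power_minus[of "1 - z + of_nat j"])
       (simp add: inverse_eq_divide power_mult_distrib[symmetric] divide_simps)
  qed
  ultimately have 2: "infsum ?f (range (\<lambda>j. - int (Suc j))) = Polygamma n (1 - z) / fact n"
    by (auto simp: sums_iff)
  have "d \<in> range int \<union> range (\<lambda>j. - int (Suc j))" for d
    by (cases d rule: int_cases) auto
  hence U: "(UNIV :: int set) = range int \<union> range (\<lambda>j. - int (Suc j))" by blast
  have "infsum ?f UNIV = infsum ?f (range int) + infsum ?f (range (\<lambda>j. - int (Suc j)))"
    unfolding U by (rule infsum_Un_disjoint) (use sm in auto)
  also have "\<dots> = (-1) ^ n * ((-1) ^ n * Polygamma n (1 - z) - Polygamma n z) / fact n"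
    unfolding 1 2 by (simp add: field_simps)
  also have "\<dots> = (- 2 * of_real pi * \<i>) ^ k / fact (k - 1) *
       (\<Sum>m. (if m = 0 then 0 else of_nat m ^ (k - 1)) * ee z ^ m)"
    unfolding Polygamma_reflection_q_expansion[OF z] n
    using n(2) power_minus[of "2 * of_real pi * \<i>" "Suc n"] by (simp cong: if_cong)
  finally show ?thesis using has_sum_infsum[OF sm[of UNIV]] by simp
qed

section \<open>Finite Fourier transforms and the Eisenstein series as a lattice sum\<close>


lemma periodic_int_mult:
  fixes f :: "int \<Rightarrow> 'a"
  assumes "\<And>n. f (n + q) = f n"
  shows "f (n + q * m) = f n"
proof (induction m rule: int_induct[where k = 0])
  case (step1 i)
  then show ?case using assms[of "n + q * i"] by (simp add: algebra_simps)
next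
  case (step2 i)
  then show ?case using assms[of "n + q * (i - 1)"] by (simp add: algebra_simps)
qed simp

lemma periodic_cong:
  fixes f :: "int \<Rightarrow> 'a"
  assumes "\<And>n. f (n + q) = f n" "[m = n] (mod q)"
  shows "f m = f n"
proof -
  obtain t where "m = n + q * t" using assms(2) by (metis cong_iff_lin cong_sym)
  thus ?thesis using periodic_int_mult[of f q, OF assms(1)] by simp
qed

lemma ee_eq_1_iff: "ee x = 1 \<longleftrightarrow> x \<in> \<int>"
  using exp_eq_1[of "2 * of_real pi * \<i> * x"]
  by (auto simp: ee_def Ints_def complex_eq_iff exp_eq_1)

text \<open>Geometric sum whose ratio is a \<open>q\<close>-th root of unity, equal to 1 exactly
  when \<open>q\<close> divides \<open>m\<close>.\<close>

lemma sum_roots_of_unity: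
  assumes "q > 0"
  shows "(\<Sum>j<q. ee (of_int (m * int j) / of_nat q)) = (if int q dvd m then of_nat q else 0)"
proof -
  define x where "x = ee (of_int m / of_nat q)"
  have p: "ee (of_int (m * int j) / of_nat q) = x ^ j" for j
    using ee_of_nat_mult[of j "of_int m / of_nat q"] by (simp add: x_def mult_ac)
  have x1: "x = 1 \<longleftrightarrow> int q dvd m"
  proof
    assume "x = 1"
    then obtain n where "of_int m / of_nat q = (of_int n :: complex)"
      by (auto simp: x_def ee_eq_1_iff Ints_def)
    hence "(of_int m :: complex) = of_int (int q * n)" using assms by (simp add: field_simps)
    hence "m = int q * n" by (simp only: of_int_eq_iff)
    thus "int q dvd m" by simp
  next
    assume "int q dvd m"
    then obtain n where "m = int q * n" by auto
    thus "x = 1" using assms by (simp add: x_def ee_of_int)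
  qed
  have xq: "x ^ q = 1"
    using assms by (simp add: x_def ee_of_nat_mult [symmetric] ee_of_int)
  show ?thesis unfolding p x1 [symmetric] using xq by (simp add: sum_gp_strict)
qed

text \<open>The factor \<open>1 / q\<close> and the negative exponent are placed here so that
  inversion carries neither.\<close>

definition dft :: "nat \<Rightarrow> (int \<Rightarrow> complex) \<Rightarrow> int \<Rightarrow> complex" where
  "dft q f d = (\<Sum>l<q. f (int l) * ee (- of_int (d * int l) / of_nat q)) / of_nat q"

lemma dft_cong:
  assumes "q > 0" "[d = e] (mod int q)"
  shows "dft q f d = dft q f e"
proof (rule periodic_cong[OF _ assms(2)])
  fix n
  have "- of_int ((n + int q) * int l) / of_nat q =
      - of_int (n * int l) / of_nat q + (of_int (- int l) :: complex)" for l
    using assms(1) by (simp add: field_simps)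
  hence "ee (- of_int ((n + int q) * int l) / of_nat q) = ee (- of_int (n * int l) / of_nat q)" for l
    by (simp only: ee_add ee_of_int mult_1_right)
  thus "dft q f (n + int q) = dft q f n" by (simp only: dft_def)
qed

lemma norm_ee_real: "Im x = 0 \<Longrightarrow> norm (ee x) = 1"
  by (simp add: norm_ee)

text \<open>Interchanging the two finite sums leaves a sum of roots of unity that singles out the
  index \<open>l\<close> congruent to \<open>m\<close>.\<close>

lemma dft_inverse:
  assumes q: "q > 0" and f: "\<And>n. f (n + int q) = f n"
  shows "(\<Sum>j<q. dft q f (int j) * ee (of_int (m * int j) / of_nat q)) = f m"
proof -
  have "dft q f (int j) * ee (of_int (m * int j) / of_nat q) =
      (\<Sum>l<q. f (int l) / of_nat q * ee (of_int ((m - int l) * int j) / of_nat q))" for j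
  proof -
    have "(of_int ((m - int l) * int j) / of_nat q :: complex) =
       - of_int (int j * int l) / of_nat q + of_int (m * int j) / of_nat q" for l
      using q by (simp add: field_simps)
    hence "ee (of_int ((m - int l) * int j) / of_nat q) =
       ee (- of_int (int j * int l) / of_nat q) * ee (of_int (m * int j) / of_nat q)" for l
      by (simp only: ee_add)
    thus ?thesis by (simp add: dft_def sum_divide_distrib sum_distrib_right sum_distrib_left mult_ac)
  qed
  hence "(\<Sum>j<q. dft q f (int j) * ee (of_int (m * int j) / of_nat q)) =
      (\<Sum>j<q. \<Sum>l<q. f (int l) / of_nat q * ee (of_int ((m - int l) * int j) / of_nat q))"
    by (simp only:)
  also have "\<dots> = (\<Sum>l<q. f (int l) / of_nat q * (\<Sum>j<q. ee (of_int ((m - int l) * int j) / of_nat q)))"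
    by (subst sum.swap) (simp only: sum_distrib_left)
  also have "\<dots> = (\<Sum>l<q. if l = nat (m mod int q) then f (int l) else 0)"
  proof (rule sum.cong)
    fix l assume l: "l \<in> {..<q}"
    have "int q dvd m - int l \<longleftrightarrow> l = nat (m mod int q)"
    proof -
      have "int q dvd m - int l \<longleftrightarrow> m mod int q = int l mod int q"
        by (simp add: mod_eq_dvd_iff)
      also have "int l mod int q = int l" using l by simp
      finally show ?thesis using q by auto
    qed
    thus "f (int l) / of_nat q * (\<Sum>j<q. ee (of_int ((m - int l) * int j) / of_nat q)) =
        (if l = nat (m mod int q) then f (int l) else 0)"
      using q by (simp only: sum_roots_of_unity[OF q]) auto
  qed simp
  also have "\<dots> = f (m mod int q)"
    using q by (simp add: nat_less_iff)
  also have "\<dots> = f m" by (rule periodic_cong[of f "int q"]) (use f in \<open>auto simp: cong_def\<close>)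
  finally show ?thesis .
qed

text \<open>As \<open>f 0 = 0\<close>, the transform has mean zero over a period and is therefore a discrete derivative.\<close>
lemma dft_discrete_primitive:
  assumes "f 0 = 0"
  obtains \<theta> M where "\<And>d. dft q f d = \<theta> d - \<theta> (d - 1)" "\<And>d. norm (\<theta> d) \<le> M"
proof
  \<comment> \<open>The backward difference in \<open>d\<close> multiplies the mode
    \<open>ee (- d * l / q)\<close> by \<open>1 - ee (l / q)\<close>, so dividing by this number
    inverts it. The mode \<open>l = 0\<close>, where it vanishes, is absent because
    \<open>f 0 = 0\<close>.\<close>
  define \<theta> where "\<theta> = (\<lambda>d. \<Sum>l<q. f (int l) / of_nat q / (1 - ee (of_nat l / of_nat q)) *
     ee (- of_int (d * int l) / of_nat q))"
  show "norm (\<theta> d) \<le> (\<Sum>l<q. norm (f (int l) / of_nat q / (1 - ee (of_nat l / of_nat q))))" for d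
    unfolding \<theta>_def by (rule sum_norm_le) (simp add: norm_mult norm_ee_real norm_divide)
  fix d
  have "f (int l) / of_nat q / (1 - ee (of_nat l / of_nat q)) * ee (- of_int (d * int l) / of_nat q) -
      f (int l) / of_nat q / (1 - ee (of_nat l / of_nat q)) * ee (- of_int ((d - 1) * int l) / of_nat q) =
      f (int l) * ee (- of_int (d * int l) / of_nat q) / of_nat q" if l: "l < q" for l
  proof (cases "l = 0")
    case False
    have e: "ee (- of_int ((d - 1) * int l) / of_nat q) =
       ee (- of_int (d * int l) / of_nat q) * ee (of_nat l / of_nat q)"
      unfolding ee_add [symmetric] using l by (simp add: field_simps)
    have "ee (of_nat l / of_nat q) \<noteq> 1"
    proof
      assume "ee (of_nat l / of_nat q) = 1"
      then obtain n where "of_nat l / of_nat q = (of_int n :: complex)"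
        by (auto simp: ee_eq_1_iff Ints_def)
      hence "(of_int (int l) :: complex) = of_int (int q * n)" using l by (simp add: field_simps)
      hence "int l = int q * n" by (simp only: of_int_eq_iff)
      hence "q dvd l" by (metis dvd_triv_left int_dvd_int_iff)
      thus False using l False by (auto dest: dvd_imp_le)
    qed
    thus ?thesis unfolding e using l by (simp add: divide_simps) (simp add: algebra_simps)
  qed (use assms in simp)
  thus "dft q f d = \<theta> d - \<theta> (d - 1)"
    by (simp add: \<theta>_def dft_def sum_subtractf [symmetric] sum_divide_distrib)
qed

text \<open>Substitution of \<open>q - l\<close> for \<open>l\<close>; the index 0, which has no
  partner below \<open>q\<close>, drops out since \<open>f 0 = 0\<close>.\<close>

lemma dft_uminus:
  assumes q: "q > 0" and f: "\<And>n. f (n + int q) = f n" and s: "\<And>n. f (- n) = s * f n"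
    and f0: "f 0 = 0"
  shows "dft q f (- d) = s * dft q f d"
proof -
  have *: "(\<Sum>l<q. f (int l) * ee (- of_int (d * int l) / of_nat q)) =
     (\<Sum>l\<in>{0<..<q}. f (int l) * ee (- of_int (d * int l) / of_nat q))" for d
    by (rule sum.mono_neutral_right) (use f0 in \<open>auto intro: gr0I\<close>)
  have "(\<Sum>l\<in>{0<..<q}. f (int l) * ee (- of_int (- d * int l) / of_nat q)) =
    (\<Sum>l\<in>{0<..<q}. s * (f (int l) * ee (- of_int (d * int l) / of_nat q)))"
  proof (rule sum.reindex_bij_witness[of _ "\<lambda>l. q - l" "\<lambda>l. q - l"])
    fix l assume l: "l \<in> {0<..<q}"
    have "f (int (q - l)) = f (- int l)" using l f[of "- int l"] by (simp add: of_nat_diff)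
    moreover have "- of_int (d * int (q - l)) / of_nat q =
       - of_int (- d * int l) / of_nat q + (of_int (- d) :: complex)"
      using l by (simp add: of_nat_diff field_simps)
    hence "ee (- of_int (d * int (q - l)) / of_nat q) = ee (- of_int (- d * int l) / of_nat q)"
      by (simp only: ee_add ee_of_int mult_1_right)
    \<comment> \<open>Parity applied twice: \<open>s\<close> acts as its own inverse on the values
      of \<open>f\<close>.\<close>
    moreover have "s * (s * f (int l)) = f (int l)" using s[of "int l"] s[of "- int l"] by simp
    ultimately show "s * (f (int (q - l)) * ee (- of_int (d * int (q - l)) / of_nat q)) =
        f (int l) * ee (- of_int (- d * int l) / of_nat q)"
      using s[of "int l"] by (simp add: mult.assoc[symmetric])
  qed auto
  thus ?thesis unfolding dft_def * by (simp add: sum_distrib_left)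
qed

text \<open>On the residue class of \<open>j\<close> modulo \<open>q\<close> the transform is
  constant, so the Lipschitz formula at \<open>(w + j) / q\<close> applies; Fourier inversion over
  \<open>j\<close> then recovers \<open>f m\<close> in the \<open>m\<close>-th coefficient.\<close>

theorem twisted_Lipschitz_formula:
  assumes w: "Im w > 0" and k: "k \<ge> 2" and q: "q > 0" and f: "\<And>n. f (n + int q) = f n"
  shows "((\<lambda>d. dft q f d / (w + of_int d) ^ k) has_sum
     ((- 2 * of_real pi * \<i>) ^ k / (fact (k - 1) * of_nat q ^ k) *
       (\<Sum>m. (if m = 0 then 0 else of_nat m ^ (k - 1)) * f (int m) * ee (w / of_nat q) ^ m))) UNIV"
proof -
  define L where "L = (- 2 * of_real pi * \<i>) ^ k / fact (k - 1)"
  define c where "c = (\<lambda>m::nat. (if m = 0 then 0 else of_nat m ^ (k - 1) :: complex))"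
  define A where "A = (\<lambda>j. range (\<lambda>n::int. int j + int q * n))"
  have U: "(UNIV :: int set) = (\<Union>j\<in>{..<q}. A j)"
  proof -
    have "d \<in> A (nat (d mod int q))" "nat (d mod int q) < q" for d
      using q by (auto simp: A_def nat_less_iff intro!: image_eqI[of _ _ "d div int q"])
    thus ?thesis by blast
  qed
  have disj: "A i \<inter> A j = {}" if "i < q" "j < q" "i \<noteq> j" for i j
  proof -
    have "d mod int q = int i" if "d \<in> A i" "i < q" for d i
      using that by (auto simp: A_def)
    from this[of _ i] this[of _ j] that show ?thesis by fastforce
  qed
  have sm: "summable (\<lambda>m. c m * ee ((w + of_nat j) / of_nat q) ^ m)" for j
    by (rule summable_norm_cancel[OF summable_norm_poly_bound[where k = "k - 1"]])
       (use w q in \<open>auto simp: c_def norm_power intro!: norm_ee_less_1\<close>)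
  have part: "((\<lambda>d. dft q f d / (w + of_int d) ^ k) has_sum
      (dft q f (int j) / of_nat q ^ k * (L * (\<Sum>m. c m * ee ((w + of_nat j) / of_nat q) ^ m)))) (A j)" for j
  proof -
    have "((\<lambda>n::int. 1 / ((w + of_nat j) / of_nat q + of_int n) ^ k) has_sum
      (L * (\<Sum>m. c m * ee ((w + of_nat j) / of_nat q) ^ m))) UNIV"
      unfolding L_def c_def by (rule Lipschitz_formula) (use w k q in auto)
    hence "((\<lambda>n::int. dft q f (int j) / of_nat q ^ k * (1 / ((w + of_nat j) / of_nat q + of_int n) ^ k)) has_sum
      (dft q f (int j) / of_nat q ^ k * (L * (\<Sum>m. c m * ee ((w + of_nat j) / of_nat q) ^ m)))) UNIV"
      by (rule has_sum_cmult_right)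
    moreover have "dft q f (int j) / of_nat q ^ k * (1 / ((w + of_nat j) / of_nat q + of_int n) ^ k) =
       dft q f (int j + int q * n) / (w + of_int (int j + int q * n)) ^ k" for n
    proof -
      have "dft q f (int j + int q * n) = dft q f (int j)"
        by (rule dft_cong) (use q in \<open>auto simp: cong_def\<close>)
      moreover have "of_nat q * ((w + of_nat j) / of_nat q + of_int n) = w + of_int (int j + int q * n)"
        using q by (simp add: field_simps)
      ultimately show ?thesis by (simp flip: power_mult_distrib)
    qed
    ultimately show ?thesis unfolding A_def
      by (subst has_sum_reindex) (use q in \<open>auto simp: inj_on_def o_def\<close>)
  qed
  have "((\<lambda>d. dft q f d / (w + of_int d) ^ k) has_sum
     (\<Sum>j<q. dft q f (int j) / of_nat q ^ k * (L * (\<Sum>m. c m * ee ((w + of_nat j) / of_nat q) ^ m)))) UNIV"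
    unfolding U by (rule sum_has_sum) (use part disj in auto)
  also have "(\<Sum>j<q. dft q f (int j) / of_nat q ^ k * (L * (\<Sum>m. c m * ee ((w + of_nat j) / of_nat q) ^ m))) =
     L / of_nat q ^ k * (\<Sum>j<q. \<Sum>m. dft q f (int j) * (c m * ee ((w + of_nat j) / of_nat q) ^ m))"
  proof -
    have "(\<Sum>m. dft q f (int j) * (c m * ee ((w + of_nat j) / of_nat q) ^ m)) =
       dft q f (int j) * (\<Sum>m. c m * ee ((w + of_nat j) / of_nat q) ^ m)" for j
      by (rule suminf_mult[OF sm])
    thus ?thesis by (simp add: sum_distrib_left mult_ac)
  qed
  also have "(\<Sum>j<q. \<Sum>m. dft q f (int j) * (c m * ee ((w + of_nat j) / of_nat q) ^ m)) =
     (\<Sum>m. \<Sum>j<q. dft q f (int j) * (c m * ee ((w + of_nat j) / of_nat q) ^ m))"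
    by (rule suminf_sum[symmetric]) (intro summable_mult sm)
  \<comment> \<open>The shift by \<open>j\<close> contributes the phase
    \<open>ee (m * j / q)\<close>, which is the kernel of the inversion formula.\<close>
  also have "(\<lambda>m. \<Sum>j<q. dft q f (int j) * (c m * ee ((w + of_nat j) / of_nat q) ^ m)) =
      (\<lambda>m. c m * f (int m) * ee (w / of_nat q) ^ m)"
  proof
    fix m
    have "ee ((w + of_nat j) / of_nat q) ^ m = ee (w / of_nat q) ^ m * ee (of_int (int m * int j) / of_nat q)" for j
    proof -
      have "of_nat m * ((w + of_nat j) / of_nat q) = of_nat m * (w / of_nat q) + of_int (int m * int j) / of_nat q"
        by (simp add: add_divide_distrib ring_distribs)
      thus ?thesis by (simp only: ee_of_nat_mult [symmetric] ee_add)
    qed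
    thus "(\<Sum>j<q. dft q f (int j) * (c m * ee ((w + of_nat j) / of_nat q) ^ m)) =
       c m * f (int m) * ee (w / of_nat q) ^ m"
      unfolding dft_inverse[where f = f and m = "int m", OF q f, symmetric]
      by (simp add: sum_distrib_left sum_distrib_right mult_ac)
  qed
  finally show ?thesis unfolding L_def c_def by simp
qed


section \<open>The Eisenstein series as a lattice sum\<close>

lemma summable_on_product_nonneg:
  fixes u v :: "_ \<Rightarrow> real"
  assumes "u summable_on A" "v summable_on B" "\<And>x. x \<in> A \<Longrightarrow> u x \<ge> 0" "\<And>y. y \<in> B \<Longrightarrow> v y \<ge> 0"
  shows "(\<lambda>(x, y). u x * v y) summable_on (A \<times> B)"
proof (rule summable_on_SigmaI)
  show "((\<lambda>y. case (x, y) of (x, y) \<Rightarrow> u x * v y) has_sum u x * infsum v B) B" if "x \<in> A" for x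
    using assms(2) by (auto intro!: has_sum_cmult_right)
  show "(\<lambda>x. u x * infsum v B) summable_on A"
    using assms(1) by (rule summable_on_cmult_left)
qed (use assms in auto)

text \<open>Rearrangement of an absolutely convergent series over pairs \<open>(A, m)\<close>: by
  rows it is the sum over \<open>A\<close>, grouped by \<open>N = A * m\<close> it is the divisor
  sum in \<open>eisen\<close>.\<close>

lemma eisen_has_sum:
  assumes c1: "\<And>n. norm (chi1 n) \<le> 1" and c2: "\<And>n. norm (chi2 n) \<le> 1" and z: "Im z > 0"
  shows "((\<lambda>A. chi1 (int A) * (\<Sum>m. (if m = 0 then 0 else of_nat m ^ (k - 1)) * cnj (chi2 (int m)) * ee (of_nat A * z) ^ m))
     has_sum (eisen chi1 chi2 k z / 2)) {1..}"
proof -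
  define b where "b = (\<lambda>m::nat. (if m = 0 then 0 else of_nat m ^ (k - 1)) * cnj (chi2 (int m)))"
  define t where "t = (\<lambda>(A::nat, m::nat). chi1 (int A) * (b m * ee z ^ (A * m)))"
  \<comment> \<open>Because \<open>A + m \<le> 2 * (A * m)\<close>, the norm of
    \<open>ee z ^ (A * m)\<close> is at most \<open>s ^ A * s ^ m\<close>, which separates the
    variables.\<close>
  define s where "s = sqrt (norm (ee z))"
  have r: "norm (ee z) = s ^ 2" by (simp add: s_def)
  have s: "0 \<le> s" "s < 1" using norm_ee_less_1[OF z] by (auto simp: s_def)
  have b: "norm (b m) \<le> real m ^ (k - 1)" for m
    using c2[of "int m"] by (auto simp: b_def norm_mult norm_power mult_left_le)
  have "(\<lambda>(A, m). s ^ A * (real m ^ (k - 1) * s ^ m)) summable_on ({1..} \<times> {1..})"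
  proof (rule summable_on_product_nonneg)
    have "summable (\<lambda>n. s ^ n)" using s by (simp add: summable_geometric)
    hence "(\<lambda>n. s ^ n) summable_on UNIV" using s by (intro summable_nonneg_imp_summable_on) auto
    thus "(\<lambda>n. s ^ n) summable_on {1..}" by (rule summable_on_subset) auto
    have "summable (\<lambda>n. real n ^ (k - 1) * s ^ n)"
      using summable_power_times_power[of s "k - 1"] s by simp
    hence "(\<lambda>n. real n ^ (k - 1) * s ^ n) summable_on UNIV"
      using s by (intro summable_nonneg_imp_summable_on) auto
    thus "(\<lambda>n. real n ^ (k - 1) * s ^ n) summable_on {1..}" by (rule summable_on_subset) auto
  qed (use s in auto)
  hence "(\<lambda>x. norm (t x)) summable_on ({1..} \<times> {1..})"
  proof (rule Infinite_Sum.abs_summable_on_comparison_test')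
    fix x :: "nat \<times> nat" assume "x \<in> {1..} \<times> {1..}"
    then obtain A m where x: "x = (A, m)" "A \<ge> 1" "m \<ge> 1" by auto
    have "A * 1 \<le> A * m" "1 * m \<le> A * m" using x by (intro mult_le_mono; simp)+
    hence "A + m \<le> 2 * (A * m)" by linarith
    hence "norm (ee z ^ (A * m)) \<le> s ^ (A + m)"
      using s by (simp add: norm_power r flip: power_mult) (rule power_decreasing, auto)
    hence "norm (chi1 (int A)) * (norm (b m) * norm (ee z ^ (A * m))) \<le> 1 * (real m ^ (k - 1) * s ^ (A + m))"
      by (intro mult_mono b c1) auto
    thus "norm (t x) \<le> (case x of (A, m) \<Rightarrow> s ^ A * (real m ^ (k - 1) * s ^ m))"
      by (simp add: t_def x norm_mult power_add mult_ac)
  qed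
  hence "t summable_on ({1..} \<times> {1..})" by (rule abs_summable_summable)
  then obtain X where X: "(t has_sum X) ({1..} \<times> {1..})" by (auto simp: summable_on_def)
  have S: "((\<lambda>m. t (A, m)) has_sum (chi1 (int A) * (\<Sum>m. b m * ee (of_nat A * z) ^ m))) {1..}"
    if A: "A \<in> {1..}" for A
  proof -
    have sm: "summable (\<lambda>m. norm (b m * ee (of_nat A * z) ^ m))"
      by (rule summable_norm_poly_bound[OF b norm_ee_less_1]) (use A z in auto)
    have "((\<lambda>m. b m * ee (of_nat A * z) ^ m) has_sum (\<Sum>m. b m * ee (of_nat A * z) ^ m)) UNIV"
      by (rule norm_summable_imp_has_sum[OF sm summable_sums[OF summable_norm_cancel[OF sm]]])
    also have "?this \<longleftrightarrow> ((\<lambda>m. b m * ee (of_nat A * z) ^ m) has_sum (\<Sum>m. b m * ee (of_nat A * z) ^ m)) {1..}"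
      by (rule has_sum_cong_neutral) (auto simp: b_def not_le)
    finally have "((\<lambda>m. chi1 (int A) * (b m * ee (of_nat A * z) ^ m)) has_sum
      (chi1 (int A) * (\<Sum>m. b m * ee (of_nat A * z) ^ m))) {1..}"
      by (rule has_sum_cmult_right)
    thus ?thesis by (simp add: t_def ee_of_nat_mult power_mult)
  qed
  have 1: "((\<lambda>A. chi1 (int A) * (\<Sum>m. b m * ee (of_nat A * z) ^ m)) has_sum X) {1..}"
    by (rule has_sum_Sigma'[OF X S])
  have "((\<lambda>(N, A). t (A, N div A)) has_sum X) (Sigma {1..} (\<lambda>N. {A. A dvd N}))"
    using X by (subst has_sum_reindex_bij_witness[of _ 
       "\<lambda>(A, m). (A * m, A)" "\<lambda>(N, A). (A, N div A)" "{1..} \<times> {1..}" t])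
     (auto simp: Suc_le_eq dvd_div_eq_0_iff intro: gr0I)
  hence "((\<lambda>N. \<Sum>A | A dvd N. t (A, N div A)) has_sum X) {1..}"
    by (rule has_sum_Sigma') auto
  hence "((\<lambda>n. \<Sum>A | A dvd Suc n. t (A, Suc n div A)) has_sum X) UNIV"
    by (subst (asm) has_sum_reindex_bij_witness[of "{1..}" Suc "\<lambda>n. n - 1" UNIV
       "\<lambda>n. \<Sum>A | A dvd Suc n. t (A, Suc n div A)" _ X X]) auto
  hence "(\<lambda>n. \<Sum>A | A dvd Suc n. t (A, Suc n div A)) sums X" by (rule has_sum_imp_sums)
  moreover have "(\<Sum>A | A dvd Suc n. t (A, Suc n div A)) =
     (\<Sum>A\<in>{A. A dvd Suc n}. chi1 (int A) * cnj (chi2 (int (Suc n div A))) * of_nat (Suc n div A) ^ (k - 1)) * ee (of_nat (Suc n) * z)" for n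
    unfolding sum_distrib_right ee_of_nat_mult
    by (intro sum.cong) (auto simp: t_def b_def dvd_div_eq_0_iff simp del: power_Suc)
  ultimately have "eisen chi1 chi2 k z = 2 * X"
    by (simp add: eisen_def Let_def sums_iff)
  with 1 show ?thesis by (simp add: b_def)
qed

text \<open>Row \<open>c > 0\<close> is the twisted Lipschitz formula at \<open>c * q * z\<close>;
  parity makes row \<open>- c\<close> equal to row \<open>c\<close>, and row 0 vanishes with
  \<open>chi1 0\<close>. The sum over \<open>d\<close> stays inside because for \<open>k = 2\<close>
  the double series is not absolutely convergent.\<close>

theorem eisen_lattice_sum:
  assumes k: "k \<ge> 2" and q: "q > 0" and z: "Im z > 0"
    and c1: "\<And>n. norm (chi1 n) \<le> 1" and c10: "chi1 0 = 0" and s1: "\<And>n. chi1 (- n) = s1 * chi1 n"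
    and c2: "\<And>n. norm (chi2 n) \<le> 1" and c20: "chi2 0 = 0" and s2: "\<And>n. cnj (chi2 (- n)) = s2 * cnj (chi2 n)"
    and per: "\<And>n. chi2 (n + int q) = chi2 n" and s: "s1 * s2 = (-1) ^ k"
  shows "((\<lambda>c. chi1 c * (\<Sum>\<^sub>\<infinity>d. dft q (\<lambda>n. cnj (chi2 n)) d / (of_int c * (of_nat q * z) + of_int d) ^ k)) has_sum
     ((- 2 * of_real pi * \<i>) ^ k / (fact (k - 1) * of_nat q ^ k) * eisen chi1 chi2 k z)) UNIV"
proof -
  define f where "f = (\<lambda>n. cnj (chi2 n))"
  define L where "L = (- 2 * of_real pi * \<i>) ^ k / (fact (k - 1) * of_nat q ^ k)"
  define t where "t = (\<lambda>c::int. chi1 c * (\<Sum>\<^sub>\<infinity>d. dft q f d / (of_int c * (of_nat q * z) + of_int d) ^ k))"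
  have f: "f (n + int q) = f n" "f 0 = 0" "f (- n) = s2 * f n" for n
    using per c20 s2 by (auto simp: f_def)
  have "((\<lambda>A. L * (chi1 (int A) * (\<Sum>m. (if m = 0 then 0 else of_nat m ^ (k - 1)) * cnj (chi2 (int m)) * ee (of_nat A * z) ^ m)))
     has_sum (L * (eisen chi1 chi2 k z / 2))) {1..}"
    by (intro has_sum_cmult_right eisen_has_sum c1 c2 z)
  also have "?this \<longleftrightarrow> ((\<lambda>A. t (int A)) has_sum (L * (eisen chi1 chi2 k z / 2))) {1..}"
  proof (rule has_sum_cong)
    fix A :: nat assume A: "A \<in> {1..}"
    have "(\<Sum>\<^sub>\<infinity>d. dft q f d / (of_int (int A) * (of_nat q * z) + of_int d) ^ k) =
      L * (\<Sum>m. (if m = 0 then 0 else of_nat m ^ (k - 1)) * f (int m) * ee (of_int (int A) * (of_nat q * z) / of_nat q) ^ m)"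
      unfolding L_def by (intro infsumI twisted_Lipschitz_formula) (use A q z k f in auto)
    thus "L * (chi1 (int A) * (\<Sum>m. (if m = 0 then 0 else of_nat m ^ (k - 1)) * cnj (chi2 (int m)) * ee (of_nat A * z) ^ m)) = t (int A)"
      using q by (simp add: t_def f_def)
  qed
  finally have pos: "((\<lambda>A. t (int A)) has_sum (L * (eisen chi1 chi2 k z / 2))) {1..}" .
  \<comment> \<open>Negating \<open>c\<close> and \<open>d\<close> together produces the signs
    \<open>s1\<close>, \<open>s2\<close> and \<open>(-1) ^ k\<close>, whose product is 1.\<close>
  have t_minus: "t (- c) = t c" for c
  proof -
    have "(\<Sum>\<^sub>\<infinity>d. dft q f d / (of_int (- c) * (of_nat q * z) + of_int d) ^ k) =
       (\<Sum>\<^sub>\<infinity>d. dft q f (- d) / (of_int (- c) * (of_nat q * z) + of_int (- d)) ^ k)"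
      by (rule infsum_reindex_bij_witness[of _ uminus uminus]) auto
    also have "\<dots> = (\<Sum>\<^sub>\<infinity>d. s2 * (-1) ^ k * (dft q f d / (of_int c * (of_nat q * z) + of_int d) ^ k))"
    proof (rule infsum_cong)
      fix d
      have "of_int (- c) * (of_nat q * z) + of_int (- d) = - (of_int c * (of_nat q * z) + of_int d)"
        by (simp add: algebra_simps)
      moreover have "dft q f (- d) = s2 * dft q f d" by (rule dft_uminus) (use q f in auto)
      ultimately show "dft q f (- d) / (of_int (- c) * (of_nat q * z) + of_int (- d)) ^ k =
         s2 * (-1) ^ k * (dft q f d / (of_int c * (of_nat q * z) + of_int d) ^ k)"
        by (simp only: power_minus[of "of_int c * (of_nat q * z) + of_int d"]) (simp add: minus_one_power_iff)
    qed
    also have "\<dots> = s2 * (-1) ^ k * (\<Sum>\<^sub>\<infinity>d. dft q f d / (of_int c * (of_nat q * z) + of_int d) ^ k)"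
      by (rule infsum_cmult_right')
    finally have "t (- c) = (s1 * s2) * (-1) ^ k * t c" by (simp add: t_def s1)
    thus ?thesis by (simp add: s flip: power_mult_distrib)
  qed
  have P: "(t has_sum (L * (eisen chi1 chi2 k z / 2))) {0<..}"
    using pos by (subst has_sum_reindex_bij_witness[of _ int nat "{1..}" "\<lambda>A. t (int A)"]) auto
  hence Ng: "(t has_sum (L * (eisen chi1 chi2 k z / 2))) {..<0}"
    by (subst has_sum_reindex_bij_witness[of _ uminus uminus "{0<..}" t]) (auto simp: t_minus)
  have "(t has_sum (L * (eisen chi1 chi2 k z / 2) + L * (eisen chi1 chi2 k z / 2))) ({0<..} \<union> {..<0})"
    by (rule has_sum_Un_disjoint[OF P Ng]) auto
  also have "?this \<longleftrightarrow> (t has_sum (L * (eisen chi1 chi2 k z / 2) + L * (eisen chi1 chi2 k z / 2))) UNIV"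
  proof (rule has_sum_cong_neutral)
    fix x assume "x \<in> UNIV - ({0<..} \<union> {..<0::int})"
    hence "x = 0" by auto
    thus "t x = 0" by (simp add: t_def c10)
  qed auto
  finally have "(t has_sum (L * (eisen chi1 chi2 k z / 2) + L * (eisen chi1 chi2 k z / 2))) UNIV" .
  moreover have "L * (eisen chi1 chi2 k z / 2) + L * (eisen chi1 chi2 k z / 2) = L * eisen chi1 chi2 k z"
    by simp
  ultimately show ?thesis unfolding t_def L_def f_def by (simp only:)
qed

section \<open>Regularised lattice sums and modularity\<close>


text \<open>An enumeration of the countable index set reduces this to Tannery's theorem for
  series.\<close>

lemma infsum_dominated_tendsto:
  fixes a :: "'i :: countable \<Rightarrow> 'b \<Rightarrow> 'a :: {real_normed_algebra, banach}"
  assumes inf: "infinite (UNIV :: 'i set)" and lim: "\<And>i. (a i \<longlongrightarrow> b i) F"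
    and bound: "eventually (\<lambda>x. \<forall>i. norm (a i x) \<le> B i) F"
    and B: "B summable_on UNIV" and F: "F \<noteq> bot"
  shows "((\<lambda>x. infsum (\<lambda>i. a i x) UNIV) \<longlongrightarrow> infsum b UNIV) F"
proof -
  define h :: "nat \<Rightarrow> 'i" where "h = from_nat_into UNIV"
  have h: "bij_betw h UNIV UNIV"
    unfolding h_def using inf by (intro bij_betw_from_nat_into) auto
  have sB: "summable (\<lambda>n. B (h n))"
    using B summable_on_reindex_bij_betw[OF h, of B] by (intro summable_on_imp_summable) auto
  have eq: "infsum g UNIV = (\<Sum>n. g (h n))" if "\<And>i. norm (g i) \<le> B i" for g :: "'i \<Rightarrow> 'a"
  proof -
    have "(\<lambda>i. norm (g i)) summable_on UNIV"
      by (rule Infinite_Sum.abs_summable_on_comparison_test'[OF B]) (use that in auto)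
    hence "(g has_sum infsum g UNIV) UNIV"
      by (rule has_sum_infsum[OF abs_summable_summable])
    hence "((\<lambda>n. g (h n)) has_sum infsum g UNIV) UNIV"
      by (simp add: has_sum_reindex_bij_betw[OF h])
    thus ?thesis by (auto dest: has_sum_imp_sums simp: sums_iff)
  qed
  have nb: "norm (b i) \<le> B i" for i
    by (rule tendsto_upperbound[OF tendsto_norm[OF lim]])
       (use bound F in \<open>auto elim: eventually_mono\<close>)
  have "((\<lambda>x. \<Sum>n. a (h n) x) \<longlongrightarrow> (\<Sum>n. b (h n))) F"
  proof -
    have "eventually (\<lambda>(n, x). norm (a (h n) x) \<le> B (h n)) (at_top \<times>\<^sub>F F)"
    proof -
      have "eventually (\<lambda>(n::nat, x). \<forall>i. norm (a i x) \<le> B i) (at_top \<times>\<^sub>F F)"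
        using bound by (subst eventually_prod2) auto
      thus ?thesis by (rule eventually_mono) auto
    qed
    from tannerys_theorem[OF lim this sB F] show ?thesis by simp
  qed
  also have "?this \<longleftrightarrow> ((\<lambda>x. infsum (\<lambda>i. a i x) UNIV) \<longlongrightarrow> infsum b UNIV) F"
    unfolding eq[of b, OF nb]
    by (rule tendsto_cong) (use bound in \<open>auto elim!: eventually_mono simp: eq\<close>)
  finally show ?thesis .
qed

lemma norm_power_diff_le:
  fixes x y :: "'a :: {real_normed_field}"
  assumes "norm x \<le> \<mu>" "norm y \<le> \<mu>"
  shows "norm (x ^ k - y ^ k) \<le> real k * \<mu> ^ (k - 1) * norm (x - y)"
proof -
  have \<mu>: "0 \<le> \<mu>" using assms(1) norm_ge_zero[of x] by linarith
  have "norm (\<Sum>i<k. y ^ (k - Suc i) * x ^ i) \<le> (\<Sum>i<k. \<mu> ^ (k - 1))"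
  proof (rule sum_norm_le)
    fix i assume "i \<in> {..<k}"
    hence k: "k - 1 = (k - Suc i) + i" by auto
    have "norm (y ^ (k - Suc i) * x ^ i) \<le> \<mu> ^ (k - Suc i) * \<mu> ^ i"
      unfolding norm_mult norm_power using assms \<mu> by (intro mult_mono power_mono) auto
    thus "norm (y ^ (k - Suc i) * x ^ i) \<le> \<mu> ^ (k - 1)" by (simp only: k power_add)
  qed
  hence "norm (x - y) * norm (\<Sum>i<k. y ^ (k - Suc i) * x ^ i) \<le> norm (x - y) * (real k * \<mu> ^ (k - 1))"
    by (intro mult_left_mono) auto
  thus ?thesis by (simp add: power_diff_sumr2 norm_mult mult_ac)
qed

text \<open>The 3/2-th power of \<open>norm_int_lattice_bound\<close>; as 3/2 exceeds 1, the right
  side is summable over the lattice.\<close>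

lemma inverse_cube_lattice_bound:
  assumes "Im w \<noteq> 0"
  obtains C where "C > 0"
    "\<And>c d::int. c \<noteq> 0 \<Longrightarrow> 1 / norm (of_int c * w + of_int d) ^ 3 \<le>
       C * ((1 + \<bar>real_of_int c\<bar>) powr - (3/2) * (1 + \<bar>real_of_int d\<bar>) powr - (3/2))"
proof -
  obtain C where C: "C > 0"
    "\<And>c d::int. c \<noteq> 0 \<Longrightarrow> (1 + \<bar>real_of_int c\<bar>) * (1 + \<bar>real_of_int d\<bar>) \<le> C * (norm (of_int c * w + of_int d))\<^sup>2"
    using norm_int_lattice_bound[OF assms] by blast
  have "1 / norm (of_int c * w + of_int d) ^ 3 \<le>
       C powr (3/2) * ((1 + \<bar>real_of_int c\<bar>) powr - (3/2) * (1 + \<bar>real_of_int d\<bar>) powr - (3/2))"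
    if c: "c \<noteq> 0" for c d
  proof -
    define r where "r = norm (of_int c * w + of_int d)"
    have "r > 0" using assms c by (auto simp: r_def complex_eq_iff)
    have "r ^ 3 = (r ^ 2) powr (3/2)"
      using \<open>r > 0\<close> by (simp add: powr_powr flip: powr_numeral)
    have "((1 + \<bar>real_of_int c\<bar>) * (1 + \<bar>real_of_int d\<bar>)) powr (3/2) \<le> (C * r ^ 2) powr (3/2)"
      using C(2)[OF c, of d] by (intro powr_mono2) (auto simp: r_def)
    also have "\<dots> = C powr (3/2) * r ^ 3"
      using C(1) \<open>r > 0\<close> by (simp add: powr_mult \<open>r ^ 3 = _\<close>)
    finally have "(1 + \<bar>real_of_int c\<bar>) powr (3/2) * (1 + \<bar>real_of_int d\<bar>) powr (3/2) \<le> C powr (3/2) * r ^ 3"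
      by (simp add: powr_mult)
    thus ?thesis using \<open>r > 0\<close> unfolding r_def [symmetric]
      by (simp add: powr_minus field_simps)
  qed
  thus ?thesis using C(1) that[of "C powr (3/2)"] by simp
qed

text \<open>The damping factor adds one power of decay, enough for absolute convergence at
  \<open>k = 2\<close>. It depends only on \<open>norm v\<close>, so scaling \<open>v\<close>
  amounts to rescaling \<open>\<epsilon>\<close>.\<close>

definition reg_kernel :: "nat \<Rightarrow> real \<Rightarrow> complex \<Rightarrow> complex" where
  "reg_kernel k \<epsilon> v = 1 / (v ^ k * of_real (1 + \<epsilon> * norm v))"

lemma reg_kernel_0: "reg_kernel k 0 v = 1 / v ^ k"
  by (simp add: reg_kernel_def)

lemma norm_reg_kernel_le:
  assumes "\<epsilon> \<ge> 0"
  shows "norm (reg_kernel k \<epsilon> v) \<le> norm (1 / v ^ k)"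
proof (cases "v = 0")
  case False
  have "1 / (norm v ^ k * (1 + \<epsilon> * norm v)) \<le> 1 / (norm v ^ k * 1)"
    using assms False by (intro divide_left_mono mult_left_mono mult_pos_pos add_pos_nonneg) auto
  thus ?thesis using assms
    by (simp add: reg_kernel_def norm_divide norm_mult norm_power abs_of_nonneg flip: of_real_add of_real_mult)
qed (use assms in \<open>cases "k = 0"; simp add: reg_kernel_def\<close>)

lemma tendsto_reg_kernel: "((\<lambda>\<epsilon>. reg_kernel k \<epsilon> v) \<longlongrightarrow> reg_kernel k 0 v) (at_right 0)"
proof (cases "v = 0 \<and> k \<noteq> 0")
  case False
  have "((\<lambda>\<epsilon>. 1 / (v ^ k * of_real (1 + \<epsilon> * norm v))) \<longlongrightarrow> 1 / (v ^ k * of_real (1 + 0 * norm v))) (at_right 0)"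
    by (intro tendsto_intros) (use False in auto)
  thus ?thesis by (simp add: reg_kernel_def)
qed (simp add: reg_kernel_def)

text \<open>A unit shift gains one power of \<open>norm v\<close>, uniformly in
  \<open>\<epsilon>\<close>: the difference of the powers factors, and the damping factor changes by
  at most \<open>\<epsilon> / (1 + \<epsilon> * r) \<le> 1 / r\<close>. Powers beyond the third are
  absorbed through \<open>norm v \<ge> \<eta>\<close>.\<close>

lemma reg_kernel_diff_bound:
  assumes \<epsilon>: "\<epsilon> \<ge> 0" and \<eta>: "\<eta> > 0" "\<eta> \<le> \<bar>Im v\<bar>" and k: "k \<ge> 2"
  shows "norm (reg_kernel k \<epsilon> v - reg_kernel k \<epsilon> (v + 1)) \<le>
           real (k + 1) * ((1 + 1 / \<eta>) / \<eta>) ^ (k - 2) * (1 + 1 / \<eta>) ^ 3 * (1 / norm v ^ 3)"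
proof -
  define r s \<kappa> where "r = norm v" "s = norm (v + 1)" "\<kappa> = 1 + 1 / \<eta>"
  define \<mu> where "\<mu> = \<kappa> / r"
  have r: "r \<ge> \<eta>" "s \<ge> \<eta>"
    using \<eta> abs_Im_le_cmod[of v] abs_Im_le_cmod[of "v + 1"] by (auto simp: r_s_\<kappa>_def)
  have pos: "r > 0" "s > 0" using r \<eta> by auto
  have v0: "v \<noteq> 0" "v + 1 \<noteq> 0" using pos by (auto simp: r_s_\<kappa>_def)
  have \<kappa>: "\<kappa> \<ge> 1" using \<eta> by (simp add: r_s_\<kappa>_def)
  have rs: "\<bar>r - s\<bar> \<le> 1"
    using norm_triangle_ineq3[of v "v + 1"] by (simp add: r_s_\<kappa>_def)
  \<comment> \<open>Since \<open>r \<le> s + 1 \<le> \<kappa> * s\<close>, the number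
    \<open>\<mu> = \<kappa> / r\<close> bounds both \<open>1 / r\<close> and
    \<open>1 / s\<close>.\<close>
  have "1 \<le> s / \<eta>" using r \<eta> by simp
  hence "r \<le> s + s / \<eta>" using rs by linarith
  hence "r \<le> \<kappa> * s" by (simp add: r_s_\<kappa>_def field_simps)
  hence x1: "1 / s \<le> \<mu>" using pos by (simp add: \<mu>_def field_simps)
  have x2: "1 / r \<le> \<mu>" using pos \<kappa> by (simp add: \<mu>_def divide_right_mono)
  have \<mu>0: "\<mu> \<ge> 0" using pos \<kappa> by (simp add: \<mu>_def)
  define x y where "x = 1 / v" "y = 1 / (v + 1)"
  define A B where "A = 1 / (1 + \<epsilon> * r)" "B = 1 / (1 + \<epsilon> * s)"
  have er: "1 + \<epsilon> * r \<ge> 1" "1 + \<epsilon> * s \<ge> 1" using \<epsilon> pos by auto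
  have AB: "0 \<le> B" "B \<le> 1" using er by (auto simp: A_B_def)
  have nx: "norm x = 1 / r" "norm y = 1 / s" by (auto simp: x_y_def r_s_\<kappa>_def norm_divide)
  have xy: "x - y = x * y" using v0 by (simp add: x_y_def field_simps)
  have nxy: "norm (x - y) \<le> \<mu> * \<mu>"
    unfolding xy norm_mult nx using x1 x2 \<mu>0 pos by (intro mult_mono) auto
  have "norm (x ^ k - y ^ k) \<le> real k * \<mu> ^ (k - 1) * norm (x - y)"
    by (rule norm_power_diff_le) (use x1 x2 nx in auto)
  also have "\<dots> \<le> real k * \<mu> ^ (k - 1) * (\<mu> * \<mu>)"
    using \<mu>0 nxy by (intro mult_left_mono) auto
  also have "\<dots> = real k * \<mu> ^ (k + 1)"
    using k by (cases k) (auto simp: mult_ac)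
  finally have 1: "norm (x ^ k - y ^ k) \<le> real k * \<mu> ^ (k + 1)" .
  have "A - B = \<epsilon> * (s - r) / ((1 + \<epsilon> * r) * (1 + \<epsilon> * s))"
    using er by (simp add: A_B_def diff_divide_eq_iff divide_diff_eq_iff) (simp add: field_simps)
  hence "\<bar>A - B\<bar> = \<epsilon> * \<bar>r - s\<bar> / ((1 + \<epsilon> * r) * (1 + \<epsilon> * s))"
    using er \<epsilon> by (simp add: abs_mult abs_minus_commute)
  also have "\<dots> \<le> \<epsilon> * 1 / ((1 + \<epsilon> * r) * 1)"
    using er \<epsilon> rs by (intro frac_le mult_left_mono mult_mono) auto
  also have "\<dots> \<le> 1 / r" using pos er by (simp add: pos_divide_le_eq pos_le_divide_eq)
  finally have 2: "\<bar>A - B\<bar> \<le> \<mu>" using x2 by linarith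
  have "norm x ^ k \<le> \<mu> ^ k" using x2 nx pos by (intro power_mono) auto
  hence "norm x ^ k * \<bar>A - B\<bar> \<le> \<mu> ^ k * \<mu>"
    using 2 \<mu>0 by (intro mult_mono) auto
  moreover have "norm (x ^ k - y ^ k) * B \<le> real k * \<mu> ^ (k + 1) * 1"
    using 1 AB \<mu>0 by (intro mult_mono) auto
  moreover have eq: "reg_kernel k \<epsilon> v - reg_kernel k \<epsilon> (v + 1) = (x ^ k - y ^ k) * of_real B + x ^ k * of_real (A - B)"
    by (simp add: reg_kernel_def x_y_def A_B_def r_s_\<kappa>_def power_divide algebra_simps)
  moreover have "norm ((x ^ k - y ^ k) * of_real B + x ^ k * of_real (A - B)) \<le>
      norm (x ^ k - y ^ k) * B + norm x ^ k * \<bar>A - B\<bar>"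
    by (rule norm_triangle_le) (use AB in \<open>simp add: norm_mult norm_power flip: of_real_diff\<close>)
  ultimately have "norm (reg_kernel k \<epsilon> v - reg_kernel k \<epsilon> (v + 1)) \<le> real (k + 1) * \<mu> ^ (k + 1)"
    unfolding eq by (simp add: ring_distribs mult.commute)
  also have "\<mu> ^ (k + 1) = \<mu> ^ (k - 2) * (\<kappa> ^ 3 * (1 / r ^ 3))"
  proof -
    have "k + 1 = (k - 2) + 3" using k by simp
    thus ?thesis by (simp only: power_add) (simp add: \<mu>_def power_divide)
  qed
  also have "real (k + 1) * (\<mu> ^ (k - 2) * (\<kappa> ^ 3 * (1 / r ^ 3))) \<le>
       real (k + 1) * ((\<kappa> / \<eta>) ^ (k - 2) * (\<kappa> ^ 3 * (1 / r ^ 3)))"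
  proof -
    have "\<mu> \<le> \<kappa> / \<eta>" unfolding \<mu>_def using r \<eta> \<kappa> by (intro divide_left_mono) auto
    thus ?thesis using \<mu>0 \<kappa> pos by (intro mult_left_mono mult_right_mono power_mono) auto
  qed
  finally show ?thesis by (simp add: r_s_\<kappa>_def mult_ac)
qed


text \<open>Iterated with \<open>d\<close> inside, so that \<open>\<epsilon> = 0\<close> gives the
  sum of \<open>eisen_lattice_sum\<close>.\<close>

definition reg_sum :: "(int \<Rightarrow> complex) \<Rightarrow> (int \<Rightarrow> complex) \<Rightarrow> nat \<Rightarrow> complex \<Rightarrow> real \<Rightarrow> complex" where
  "reg_sum \<phi> \<psi> k w \<epsilon> = (\<Sum>\<^sub>\<infinity>c. \<phi> c * (\<Sum>\<^sub>\<infinity>d. \<psi> d * reg_kernel k \<epsilon> (of_int c * w + of_int d)))"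

text \<open>Index shift in the part with \<open>\<theta> (d - 1)\<close>; boundedness of
  \<open>\<theta>\<close> makes both parts summable, so the sum may be split.\<close>

lemma infsum_summation_by_parts:
  fixes \<theta> f :: "int \<Rightarrow> complex"
  assumes f: "(\<lambda>d. norm (f d)) summable_on UNIV" and \<theta>: "\<And>d. norm (\<theta> d) \<le> M"
  shows "(\<Sum>\<^sub>\<infinity>d. (\<theta> d - \<theta> (d - 1)) * f d) = (\<Sum>\<^sub>\<infinity>d. \<theta> d * (f d - f (d + 1)))"
proof -
  have sm: "(\<lambda>d. \<phi> d * f d) summable_on UNIV" if "\<And>d. norm (\<phi> d) \<le> M" for \<phi>
  proof (rule abs_summable_summable, rule Infinite_Sum.abs_summable_on_comparison_test')
    show "(\<lambda>d. M * norm (f d)) summable_on UNIV" using f by (rule summable_on_cmult_right)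
    show "norm (\<phi> d * f d) \<le> M * norm (f d)" for d
      using that[of d] by (simp add: norm_mult mult_right_mono)
  qed
  have sm1: "(\<lambda>d. \<theta> d * f d) summable_on UNIV" "(\<lambda>d. \<theta> (d - 1) * f d) summable_on UNIV"
    using sm[of \<theta>] sm[of "\<lambda>d. \<theta> (d - 1)"] \<theta> by auto
  have sh: "(\<lambda>d. \<theta> d * f (d + 1)) summable_on UNIV \<longleftrightarrow> (\<lambda>d. \<theta> (d - 1) * f d) summable_on UNIV"
    by (rule summable_on_reindex_bij_witness[of _ "\<lambda>d. d - 1" "\<lambda>d. d + 1"]) auto
  have "(\<Sum>\<^sub>\<infinity>d. (\<theta> d - \<theta> (d - 1)) * f d) = (\<Sum>\<^sub>\<infinity>d. \<theta> d * f d + - (\<theta> (d - 1) * f d))"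
    by (simp add: algebra_simps)
  also have "\<dots> = (\<Sum>\<^sub>\<infinity>d. \<theta> d * f d) + (\<Sum>\<^sub>\<infinity>d. - (\<theta> (d - 1) * f d))"
    by (rule infsum_add) (use sm1 in \<open>simp_all add: summable_on_uminus\<close>)
  also have "(\<Sum>\<^sub>\<infinity>d. - (\<theta> (d - 1) * f d)) = (\<Sum>\<^sub>\<infinity>d. - (\<theta> d * f (d + 1)))"
    by (rule infsum_reindex_bij_witness[of _ "\<lambda>d. d + 1" "\<lambda>d. d - 1"]) auto
  also have "(\<Sum>\<^sub>\<infinity>d. \<theta> d * f d) + (\<Sum>\<^sub>\<infinity>d. - (\<theta> d * f (d + 1))) = (\<Sum>\<^sub>\<infinity>d. \<theta> d * f d + - (\<theta> d * f (d + 1)))"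
    by (rule infsum_add[symmetric]) (use sm1 sh in \<open>simp_all add: summable_on_uminus\<close>)
  finally show ?thesis by (simp add: algebra_simps)
qed

lemma summable_lattice_majorant:
  "(\<lambda>(c, d). (1 + \<bar>real_of_int c\<bar>) powr - (3/2) * (1 + \<bar>real_of_int d\<bar>) powr - (3/2)) summable_on UNIV"
  using summable_on_product_nonneg[OF summable_on_int_powr summable_on_int_powr, of "3/2" "3/2"]
  by (simp add: UNIV_Times_UNIV)

context
  fixes \<phi> \<psi> \<theta> :: "int \<Rightarrow> complex" and M :: real and k :: nat and w :: complex
  assumes \<phi>: "\<And>c. norm (\<phi> c) \<le> 1" "\<phi> 0 = 0"
    and \<psi>: "\<And>d. \<psi> d = \<theta> d - \<theta> (d - 1)" and \<theta>: "\<And>d. norm (\<theta> d) \<le> M"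
    and k: "k \<ge> 2" and w: "Im w \<noteq> 0"
begin

text \<open>The lattice term after summation by parts in \<open>d\<close>: kernel differences decay
  like the inverse cube even at \<open>\<epsilon> = 0\<close>.\<close>

private definition summand where
  "summand = (\<lambda>\<epsilon> (c, d). \<phi> c * (\<theta> d * (reg_kernel k \<epsilon> (of_int c * w + of_int d) -
             reg_kernel k \<epsilon> (of_int c * w + of_int (d + 1)))))"

private lemma M_nonneg: "M \<ge> 0"
  using \<theta>[of 0] norm_ge_zero[of "\<theta> 0"] by linarith

private lemma Im_ge: "c \<noteq> 0 \<Longrightarrow> \<bar>Im w\<bar> \<le> \<bar>Im (of_int c * w + of_int d)\<bar>"
  using mult_right_mono[of 1 "\<bar>real_of_int c\<bar>" "\<bar>Im w\<bar>"] by (simp add: abs_mult)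

text \<open>The shift bound for the kernel and the inverse cube bound combine with a constant
  independent of \<open>\<epsilon>\<close>; row 0, where neither applies, is killed by
  \<open>\<phi> 0 = 0\<close>.\<close>

private lemma term_majorant:
  obtains K where "\<And>\<epsilon> c d. \<epsilon> \<ge> 0 \<Longrightarrow> norm (summand \<epsilon> (c, d)) \<le>
    K * ((1 + \<bar>real_of_int c\<bar>) powr - (3/2) * (1 + \<bar>real_of_int d\<bar>) powr - (3/2))"
proof -
  obtain C where C: "C > 0" "\<And>c d::int. c \<noteq> 0 \<Longrightarrow> 1 / norm (of_int c * w + of_int d) ^ 3 \<le>
       C * ((1 + \<bar>real_of_int c\<bar>) powr - (3/2) * (1 + \<bar>real_of_int d\<bar>) powr - (3/2))"
    using inverse_cube_lattice_bound[OF w] by blast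
  define \<eta> B where "\<eta> = \<bar>Im w\<bar>" "B = real (k + 1) * ((1 + 1 / \<eta>) / \<eta>) ^ (k - 2) * (1 + 1 / \<eta>) ^ 3"
  have \<eta>: "\<eta> > 0" using w by (simp add: \<eta>_B_def)
  have B: "B \<ge> 0" unfolding \<eta>_B_def(2) using \<eta> by simp
  have "norm (summand \<epsilon> (c, d)) \<le>
    M * B * C * ((1 + \<bar>real_of_int c\<bar>) powr - (3/2) * (1 + \<bar>real_of_int d\<bar>) powr - (3/2))"
    if \<epsilon>: "\<epsilon> \<ge> 0" for \<epsilon> c d
  proof (cases "c = 0")
    case False
    define v where "v = of_int c * w + of_int d"
    have "norm (reg_kernel k \<epsilon> v - reg_kernel k \<epsilon> (v + 1)) \<le> B * (1 / norm v ^ 3)"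
      unfolding \<eta>_B_def(2) by (rule reg_kernel_diff_bound) (use \<epsilon> \<eta> k Im_ge[OF False, of d] in \<open>auto simp: v_def \<eta>_B_def\<close>)
    also have "\<dots> \<le> B * (C * ((1 + \<bar>real_of_int c\<bar>) powr - (3/2) * (1 + \<bar>real_of_int d\<bar>) powr - (3/2)))"
      unfolding v_def by (intro mult_left_mono C B False)
    finally have "norm (\<phi> c) * (norm (\<theta> d) * norm (reg_kernel k \<epsilon> v - reg_kernel k \<epsilon> (v + 1))) \<le>
      1 * (M * (B * (C * ((1 + \<bar>real_of_int c\<bar>) powr - (3/2) * (1 + \<bar>real_of_int d\<bar>) powr - (3/2)))))"
      using M_nonneg by (intro mult_mono \<phi> \<theta>) auto
    thus ?thesis by (simp add: summand_def v_def norm_mult mult_ac add_ac)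
  qed (use M_nonneg B C in \<open>simp add: summand_def \<phi>\<close>)
  thus ?thesis using that by blast
qed

private lemma summable_kernel_row:
  assumes "\<epsilon> \<ge> 0" "c \<noteq> 0"
  shows "(\<lambda>d. norm (reg_kernel k \<epsilon> (of_int c * w + of_int d))) summable_on UNIV"
proof (rule Infinite_Sum.abs_summable_on_comparison_test')
  show "(\<lambda>d::int. norm (1 / (of_int c * w + of_int d) ^ k)) summable_on UNIV"
    using w assms(2) k by (intro summable_on_int_inverse_power) auto
qed (use assms in \<open>auto intro: norm_reg_kernel_le\<close>)

text \<open>Summation by parts in every row with \<open>c \<noteq> 0\<close>, then Fubini for the
  absolutely summable \<open>summand\<close>.\<close>

private lemma reg_sum_eq_infsum_term:
  assumes \<epsilon>: "\<epsilon> \<ge> 0"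
  shows "reg_sum \<phi> \<psi> k w \<epsilon> = infsum (summand \<epsilon>) UNIV"
proof -
  obtain K where K: "\<And>\<epsilon> c d. \<epsilon> \<ge> 0 \<Longrightarrow> norm (summand \<epsilon> (c, d)) \<le>
    K * ((1 + \<bar>real_of_int c\<bar>) powr - (3/2) * (1 + \<bar>real_of_int d\<bar>) powr - (3/2))"
    using term_majorant by blast
  have "(\<lambda>x. norm (summand \<epsilon> x)) summable_on UNIV"
    by (rule Infinite_Sum.abs_summable_on_comparison_test'[OF summable_on_cmult_right[OF summable_lattice_majorant, of K]])
       (use K \<epsilon> in auto)
  hence sm: "(\<lambda>(c, d). summand \<epsilon> (c, d)) summable_on (UNIV \<times> UNIV)"
    using abs_summable_summable by (auto simp: UNIV_Times_UNIV)
  have "(\<Sum>\<^sub>\<infinity>d. summand \<epsilon> (c, d)) = \<phi> c * (\<Sum>\<^sub>\<infinity>d. \<psi> d * reg_kernel k \<epsilon> (of_int c * w + of_int d))" for c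
  proof (cases "c = 0")
    case False
    have "(\<Sum>\<^sub>\<infinity>d. \<psi> d * reg_kernel k \<epsilon> (of_int c * w + of_int d)) =
       (\<Sum>\<^sub>\<infinity>d. \<theta> d * (reg_kernel k \<epsilon> (of_int c * w + of_int d) - reg_kernel k \<epsilon> (of_int c * w + of_int (d + 1))))"
      unfolding \<psi> by (rule infsum_summation_by_parts[OF summable_kernel_row[OF \<epsilon> False] \<theta>])
    thus ?thesis by (simp add: summand_def infsum_cmult_right')
  qed (simp add: summand_def \<phi>)
  thus ?thesis
    using infsum_Sigma'_banach[OF sm] by (simp add: reg_sum_def UNIV_Times_UNIV)
qed

text \<open>Dominated convergence, with the majorant of \<open>summand\<close> that is uniform in
  \<open>\<epsilon>\<close>.\<close>

lemma reg_sum_tendsto: "(reg_sum \<phi> \<psi> k w \<longlongrightarrow> reg_sum \<phi> \<psi> k w 0) (at_right 0)"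
proof -
  obtain K where K: "\<And>\<epsilon> c d. \<epsilon> \<ge> 0 \<Longrightarrow> norm (summand \<epsilon> (c, d)) \<le>
    K * ((1 + \<bar>real_of_int c\<bar>) powr - (3/2) * (1 + \<bar>real_of_int d\<bar>) powr - (3/2))"
    using term_majorant by blast
  have "((\<lambda>\<epsilon>. infsum (\<lambda>x. summand \<epsilon> x) UNIV) \<longlongrightarrow> infsum (summand 0) UNIV) (at_right 0)"
  proof (rule infsum_dominated_tendsto[where a = "\<lambda>x \<epsilon>. summand \<epsilon> x"])
    show "infinite (UNIV :: (int \<times> int) set)"
      by (simp add: finite_prod)
    show "((\<lambda>\<epsilon>. summand \<epsilon> x) \<longlongrightarrow> summand 0 x) (at_right 0)" for x
      unfolding summand_def by (cases x) (auto intro!: tendsto_intros tendsto_reg_kernel)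
    show "\<forall>\<^sub>F \<epsilon> in at_right 0. \<forall>x. norm (summand \<epsilon> x) \<le>
      K * (case x of (c, d) \<Rightarrow> (1 + \<bar>real_of_int c\<bar>) powr - (3/2) * (1 + \<bar>real_of_int d\<bar>) powr - (3/2))"
      using K by (auto simp: eventually_at_filter)
    show "(\<lambda>x. K * (case x of (c, d) \<Rightarrow> (1 + \<bar>real_of_int c\<bar>) powr - (3/2) * (1 + \<bar>real_of_int d\<bar>) powr - (3/2))) summable_on UNIV"
      by (intro summable_on_cmult_right summable_lattice_majorant)
  qed auto
  also have "?this \<longleftrightarrow> ?thesis"
    unfolding reg_sum_eq_infsum_term[OF order.refl]
    by (rule tendsto_cong) (auto simp: eventually_at_filter reg_sum_eq_infsum_term)
  finally show ?thesis .
qed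

text \<open>For positive \<open>\<epsilon>\<close> the damping factor alone supplies the third power
  of decay, so Fubini applies directly. The unordered sum is the form that a matrix can
  reindex.\<close>

lemma reg_sum_eq_infsum_lattice:
  assumes \<epsilon>: "\<epsilon> > 0"
  shows "reg_sum \<phi> \<psi> k w \<epsilon> = (\<Sum>\<^sub>\<infinity>(c, d). \<phi> c * \<psi> d * reg_kernel k \<epsilon> (of_int c * w + of_int d))"
proof -
  obtain C where C: "C > 0" "\<And>c d::int. c \<noteq> 0 \<Longrightarrow> 1 / norm (of_int c * w + of_int d) ^ 3 \<le>
       C * ((1 + \<bar>real_of_int c\<bar>) powr - (3/2) * (1 + \<bar>real_of_int d\<bar>) powr - (3/2))"
    using inverse_cube_lattice_bound[OF w] by blast
  define \<eta> where "\<eta> = \<bar>Im w\<bar>"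
  have \<eta>: "\<eta> > 0" using w by (simp add: \<eta>_def)
  define B where "B = 2 * M * (1 / (\<epsilon> * \<eta> ^ (k - 2)) * C)"
  have "(\<lambda>x. norm (case x of (c, d) \<Rightarrow> \<phi> c * \<psi> d * reg_kernel k \<epsilon> (of_int c * w + of_int d))) summable_on UNIV"
  proof (rule Infinite_Sum.abs_summable_on_comparison_test'[OF summable_on_cmult_right[OF summable_lattice_majorant, of B]])
    fix x :: "int \<times> int"
    obtain c d where x: "x = (c, d)" by (cases x)
    show "norm (case x of (c, d) \<Rightarrow> \<phi> c * \<psi> d * reg_kernel k \<epsilon> (of_int c * w + of_int d)) \<le>
      B * (case x of (c, d) \<Rightarrow> (1 + \<bar>real_of_int c\<bar>) powr - (3/2) * (1 + \<bar>real_of_int d\<bar>) powr - (3/2))"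
    proof (cases "c = 0")
      case False
      define r where "r = norm (of_int c * w + of_int d)"
      have r: "r \<ge> \<eta>" using Im_ge[OF False, of d] abs_Im_le_cmod[of "of_int c * w + of_int d"]
        by (simp add: \<eta>_def r_def)
      hence r0: "r > 0" using \<eta> by simp
      have "norm (reg_kernel k \<epsilon> (of_int c * w + of_int d)) = 1 / (r ^ k * (1 + \<epsilon> * r))"
        using \<epsilon> r0 by (simp add: reg_kernel_def r_def norm_divide norm_mult norm_power abs_of_nonneg
           flip: of_real_add of_real_mult)
      also have "r ^ k = r ^ (k - 2) * r ^ 2" using k by (metis le_add_diff_inverse2 power_add)
      \<comment> \<open>\<open>1 + \<epsilon> * r\<close> is replaced by the smaller
        \<open>\<epsilon> * r\<close>, and \<open>r ^ (k - 2)\<close> by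
        \<open>\<eta> ^ (k - 2)\<close>, which leaves an inverse cube.\<close>
      also have "1 / (r ^ (k - 2) * r ^ 2 * (1 + \<epsilon> * r)) \<le> 1 / (\<eta> ^ (k - 2) * r ^ 2 * (\<epsilon> * r))"
        using \<eta> r r0 \<epsilon> by (intro divide_left_mono mult_mono power_mono mult_pos_pos add_pos_pos) auto
      also have "\<dots> = 1 / (\<epsilon> * \<eta> ^ (k - 2)) * (1 / r ^ 3)"
        by (simp add: power2_eq_square power3_eq_cube mult_ac)
      also have "\<dots> \<le> 1 / (\<epsilon> * \<eta> ^ (k - 2)) * (C * ((1 + \<bar>real_of_int c\<bar>) powr - (3/2) * (1 + \<bar>real_of_int d\<bar>) powr - (3/2)))"
        unfolding r_def using \<eta> \<epsilon> by (intro mult_left_mono C False) auto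
      finally have R: "norm (reg_kernel k \<epsilon> (of_int c * w + of_int d)) \<le>
         1 / (\<epsilon> * \<eta> ^ (k - 2)) * (C * ((1 + \<bar>real_of_int c\<bar>) powr - (3/2) * (1 + \<bar>real_of_int d\<bar>) powr - (3/2)))" .
      have "norm (\<psi> d) \<le> 2 * M"
        unfolding \<psi> using norm_triangle_ineq4[of "\<theta> d" "\<theta> (d - 1)"] \<theta>[of d] \<theta>[of "d - 1"] by linarith
      hence "norm (\<phi> c) * norm (\<psi> d) * norm (reg_kernel k \<epsilon> (of_int c * w + of_int d)) \<le>
         1 * (2 * M) * (1 / (\<epsilon> * \<eta> ^ (k - 2)) * (C * ((1 + \<bar>real_of_int c\<bar>) powr - (3/2) * (1 + \<bar>real_of_int d\<bar>) powr - (3/2))))"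
        using M_nonneg by (intro mult_mono R \<phi>) auto
      thus ?thesis by (simp add: x B_def norm_mult mult_ac)
    qed (use M_nonneg \<epsilon> \<eta> C in \<open>simp add: x \<phi> B_def\<close>)
  qed
  hence sm: "(\<lambda>(c, d). \<phi> c * \<psi> d * reg_kernel k \<epsilon> (of_int c * w + of_int d)) summable_on (UNIV \<times> UNIV)"
    using abs_summable_summable by (auto simp: UNIV_Times_UNIV)
  show ?thesis
    using infsum_Sigma'_banach[OF sm]
    by (simp add: reg_sum_def UNIV_Times_UNIV infsum_cmult_right' mult.assoc)
qed

end


section \<open>Modularity of the Eisenstein series under \<open>Gamma1\<close>\<close>

lemma Gamma1D:
  assumes "(a, b, c, d) \<in> Gamma1 N"
  shows "a * d - b * c = 1" "N dvd c" "[a = 1] (mod N)" "[d = 1] (mod N)"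
  using assms by (auto simp: Gamma1_def)

lemma moebius_denom_nonzero:
  fixes a b c d :: int
  assumes "a * d - b * c = 1" "Im z > 0"
  shows "of_int c * z + of_int d \<noteq> (0 :: complex)"
proof
  assume eq: "of_int c * z + of_int d = (0 :: complex)"
  hence "Im (of_int c * z + of_int d) = 0" by simp
  hence "c = 0" using assms(2) by simp
  with eq assms(1) show False by auto
qed

lemma Im_moebius:
  fixes a b c d :: int
  assumes "a * d - b * c = 1" "Im z > 0"
  shows "Im ((of_int a * z + of_int b) / (of_int c * z + of_int d)) = Im z / (norm (of_int c * z + of_int d))\<^sup>2"
proof -
  have "Im ((of_int a * z + of_int b) * cnj (of_int c * z + of_int d)) = real_of_int (a * d - b * c) * Im z"
    by (simp add: algebra_simps)
  thus ?thesis unfolding assms(1)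
    by (subst complex_div_cnj) (simp add: Im_divide_of_real flip: of_real_power)
qed

lemma Im_moebius_pos:
  fixes a b c d :: int
  assumes "a * d - b * c = 1" "Im z > 0"
  shows "Im ((of_int a * z + of_int b) / (of_int c * z + of_int d)) > 0"
  using moebius_denom_nonzero[OF assms] assms(2) unfolding Im_moebius[OF assms] by simp

text \<open>The matrix permutes the lattice. Homogeneity of the kernel produces the factor of
  automorphy and divides \<open>\<epsilon>\<close> by its norm; the twists are unchanged since
  \<open>a\<close> and \<open>d\<close> are 1 modulo \<open>q1\<close> and
  \<open>q2\<close>.\<close>

lemma reg_sum_moebius:
  fixes q1 q2 :: nat and \<phi> \<psi> \<theta> :: "int \<Rightarrow> complex"
  assumes \<gamma>: "(a, b, c, d) \<in> Gamma1 (int (q1 * q2))" and q: "q2 > 0"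
    and \<phi>: "\<And>c. norm (\<phi> c) \<le> 1" "\<phi> 0 = 0" "\<And>m n. [m = n] (mod int q1) \<Longrightarrow> \<phi> m = \<phi> n"
    and \<psi>: "\<And>d. \<psi> d = \<theta> d - \<theta> (d - 1)" "\<And>m n. [m = n] (mod int q2) \<Longrightarrow> \<psi> m = \<psi> n"
    and \<theta>: "\<And>d. norm (\<theta> d) \<le> M" and k: "k \<ge> 2" and z: "Im z > 0" and \<epsilon>: "\<epsilon> > 0"
  shows "reg_sum \<phi> \<psi> k (of_nat q2 * ((of_int a * z + of_int b) / (of_int c * z + of_int d))) \<epsilon> =
     (of_int c * z + of_int d) ^ k * reg_sum \<phi> \<psi> k (of_nat q2 * z) (\<epsilon> / norm (of_int c * z + of_int d))"
proof -
  note g = Gamma1D[OF \<gamma>]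
  obtain t where t: "c = int (q1 * q2) * t" using g(2) by auto
  define j where "j = of_int c * z + of_int d"
  define w where "w = (of_int a * z + of_int b) / j"
  have j: "j \<noteq> 0" using moebius_denom_nonzero[OF g(1) z] by (simp add: j_def)
  have w: "Im w > 0" using Im_moebius_pos[OF g(1) z] by (simp add: j_def w_def)
  \<comment> \<open>\<open>F\<close> multiplies the row \<open>(m * q2, n)\<close> by the matrix
    from the right and divides the first entry by \<open>q2\<close>, which is possible as
    \<open>q1 * q2\<close> divides \<open>c\<close>; \<open>F'\<close> does the same with the
    inverse matrix.\<close>
  define F where "F = (\<lambda>(m, n). (m * a + n * int q1 * t, m * int q2 * b + n * d))"
  define F' where "F' = (\<lambda>(m, n). (m * d - n * int q1 * t, n * a - m * int q2 * b))"
  have FF: "F (F' x) = x" "F' (F x) = x" for x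
  proof -
    obtain m n where x: "x = (m, n)" by (cases x)
    have "(m * d - n * int q1 * t) * a + (n * a - m * int q2 * b) * int q1 * t = m * (a * d - b * c)"
         "(m * d - n * int q1 * t) * int q2 * b + (n * a - m * int q2 * b) * d = n * (a * d - b * c)"
         "(m * a + n * int q1 * t) * d - (m * int q2 * b + n * d) * int q1 * t = m * (a * d - b * c)"
         "(m * int q2 * b + n * d) * a - (m * a + n * int q1 * t) * int q2 * b = n * (a * d - b * c)"
      by (simp_all add: t algebra_simps)
    thus "F (F' x) = x" "F' (F x) = x" by (simp_all add: F_def F'_def x g(1))
  qed
  have "reg_sum \<phi> \<psi> k (of_nat q2 * w) \<epsilon> =
      (\<Sum>\<^sub>\<infinity>(m, n). \<phi> m * \<psi> n * reg_kernel k \<epsilon> (of_int m * (of_nat q2 * w) + of_int n))"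
    by (rule reg_sum_eq_infsum_lattice[where \<theta> = \<theta> and M = M]) (use assms w q in auto)
  also have "\<dots> = (\<Sum>\<^sub>\<infinity>(m, n). j ^ k * (\<phi> m * \<psi> n *
      reg_kernel k (\<epsilon> / norm j) (of_int m * (of_nat q2 * z) + of_int n)))"
  proof (rule infsum_reindex_bij_witness[of _ F' F])
    fix x :: "int \<times> int"
    obtain m n where x: "x = (m, n)" by (cases x)
    have ad: "[a = 1] (mod int q1)" "[d = 1] (mod int q2)"
      using g(3,4) by (auto intro: cong_dvd_modulus)
    have "[m * a + n * int q1 * t = m * 1 + 0] (mod int q1)"
      by (rule cong_add[OF cong_mult[OF cong_refl ad(1)]]) (simp add: cong_0_iff)
    moreover have "[m * int q2 * b + n * d = 0 + n * 1] (mod int q2)"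
      by (rule cong_add[OF _ cong_mult[OF cong_refl ad(2)]]) (simp add: cong_0_iff)
    ultimately have c: "\<phi> (m * a + n * int q1 * t) = \<phi> m" "\<psi> (m * int q2 * b + n * d) = \<psi> n"
      by (auto intro: \<phi> \<psi>)
    define v where "v = of_int (m * a + n * int q1 * t) * (of_nat q2 * z) + of_int (m * int q2 * b + n * d)"
    have "of_int m * (of_nat q2 * w) + of_int n = v / j"
      using j by (simp add: w_def field_simps) (simp add: v_def j_def t algebra_simps)
    moreover have "reg_kernel k \<epsilon> (v / j) = j ^ k * reg_kernel k (\<epsilon> / norm j) v"
      using j by (simp add: reg_kernel_def norm_divide power_divide)
    ultimately show "(case F x of (m, n) \<Rightarrow> j ^ k * (\<phi> m * \<psi> n *
       reg_kernel k (\<epsilon> / norm j) (of_int m * (of_nat q2 * z) + of_int n))) =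
      (case x of (m, n) \<Rightarrow> \<phi> m * \<psi> n * reg_kernel k \<epsilon> (of_int m * (of_nat q2 * w) + of_int n))"
      by (simp add: x F_def c v_def)
  qed (auto simp: FF)
  also have "\<dots> = j ^ k * (\<Sum>\<^sub>\<infinity>(m, n). \<phi> m * \<psi> n *
      reg_kernel k (\<epsilon> / norm j) (of_int m * (of_nat q2 * z) + of_int n))"
    unfolding case_prod_unfold by (rule infsum_cmult_right')
  also have "(\<Sum>\<^sub>\<infinity>(m, n). \<phi> m * \<psi> n * reg_kernel k (\<epsilon> / norm j) (of_int m * (of_nat q2 * z) + of_int n)) =
      reg_sum \<phi> \<psi> k (of_nat q2 * z) (\<epsilon> / norm j)"
    by (rule reg_sum_eq_infsum_lattice[where \<theta> = \<theta> and M = M, symmetric]) (use assms j q in auto)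
  finally show ?thesis by (simp add: j_def w_def)
qed

text \<open>Limit of the regularised transformation law: \<open>\<epsilon> / norm j\<close> tends to
  0 from the right together with \<open>\<epsilon>\<close>, and the constant \<open>L\<close>
  relating lattice sum and series is nonzero.\<close>

theorem eisen_modular:
  fixes q1 q2 :: nat
  assumes \<gamma>: "(a, b, c, d) \<in> Gamma1 (int (q1 * q2))"
    and k: "k \<ge> 2" and q: "q2 > 0" and z: "Im z > 0"
    and c1: "\<And>n. norm (chi1 n) \<le> 1" "chi1 0 = 0" "\<And>n. chi1 (- n) = s1 * chi1 n"
      "\<And>n. chi1 (n + int q1) = chi1 n"
    and c2: "\<And>n. norm (chi2 n) \<le> 1" "chi2 0 = 0" "\<And>n. cnj (chi2 (- n)) = s2 * cnj (chi2 n)"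
      "\<And>n. chi2 (n + int q2) = chi2 n"
    and s: "s1 * s2 = (-1) ^ k"
  shows "eisen chi1 chi2 k ((of_int a * z + of_int b) / (of_int c * z + of_int d)) =
    (of_int c * z + of_int d) ^ k * eisen chi1 chi2 k z"
proof -
  note g = Gamma1D[OF \<gamma>]
  define j where "j = of_int c * z + of_int d"
  define w where "w = (of_int a * z + of_int b) / j"
  have j: "j \<noteq> 0" using moebius_denom_nonzero[OF g(1) z] by (simp add: j_def)
  have w: "Im w > 0" using Im_moebius_pos[OF g(1) z] by (simp add: j_def w_def)
  define f \<psi> L where "f = (\<lambda>n. cnj (chi2 n))" "\<psi> = dft q2 f"
    "L = (- 2 * of_real pi * \<i>) ^ k / (fact (k - 1) * of_nat q2 ^ k)"
  have "f 0 = 0" using c2 by (simp add: f_\<psi>_L_def)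
  then obtain \<theta> M where \<theta>: "\<And>d. \<psi> d = \<theta> d - \<theta> (d - 1)" "\<And>d. norm (\<theta> d) \<le> M"
    unfolding f_\<psi>_L_def(2) using dft_discrete_primitive[of f q2] by blast
  have per1: "chi1 m = chi1 n" if "[m = n] (mod int q1)" for m n
    by (rule periodic_cong[where f = chi1, OF c1(4) that])
  have per2: "\<psi> m = \<psi> n" if "[m = n] (mod int q2)" for m n
    unfolding f_\<psi>_L_def(2) by (rule dft_cong[OF q that])
  have E: "reg_sum chi1 \<psi> k (of_nat q2 * u) 0 = L * eisen chi1 chi2 k u" if "Im u > 0" for u
    using eisen_lattice_sum[OF k q that c1(1-3) c2(1-4) s, THEN infsumI]
    by (simp add: reg_sum_def reg_kernel_0 f_\<psi>_L_def)
  have T: "(reg_sum chi1 \<psi> k (of_nat q2 * u) \<longlongrightarrow> reg_sum chi1 \<psi> k (of_nat q2 * u) 0) (at_right 0)"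
    if "Im u > 0" for u
    by (rule reg_sum_tendsto[where \<theta> = \<theta> and M = M]) (use that q k c1 \<theta> in auto)
  have "((\<lambda>\<epsilon>. j ^ k * reg_sum chi1 \<psi> k (of_nat q2 * z) (\<epsilon> / norm j)) \<longlongrightarrow>
      j ^ k * reg_sum chi1 \<psi> k (of_nat q2 * z) 0) (at_right 0)"
  proof (rule tendsto_mult_left, rule filterlim_compose[OF T[OF z]])
    have "((\<lambda>\<epsilon>. \<epsilon> / norm j) \<longlongrightarrow> 0 / norm j) (at_right 0)"
      by (intro tendsto_intros) (use j in auto)
    thus "filterlim (\<lambda>\<epsilon>. \<epsilon> / norm j) (at_right 0) (at_right 0)"
      using j by (auto simp: filterlim_at eventually_at_filter)
  qed
  also have "?this \<longleftrightarrow> (reg_sum chi1 \<psi> k (of_nat q2 * w) \<longlongrightarrow>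
      j ^ k * reg_sum chi1 \<psi> k (of_nat q2 * z) 0) (at_right 0)"
  proof (rule tendsto_cong)
    have "reg_sum chi1 \<psi> k (of_nat q2 * w) \<epsilon> = j ^ k * reg_sum chi1 \<psi> k (of_nat q2 * z) (\<epsilon> / norm j)"
      if "\<epsilon> > 0" for \<epsilon>
      unfolding w_def j_def
      by (rule reg_sum_moebius[where \<phi> = chi1 and \<psi> = \<psi> and \<theta> = \<theta>, OF \<gamma> q c1(1,2) per1 \<theta>(1) per2 \<theta>(2) k z that])
    thus "\<forall>\<^sub>F \<epsilon> in at_right 0. j ^ k * reg_sum chi1 \<psi> k (of_nat q2 * z) (\<epsilon> / norm j) =
      reg_sum chi1 \<psi> k (of_nat q2 * w) \<epsilon>"
      by (auto simp: eventually_at_filter)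
  qed
  finally have "reg_sum chi1 \<psi> k (of_nat q2 * w) 0 = j ^ k * reg_sum chi1 \<psi> k (of_nat q2 * z) 0"
    using tendsto_unique[OF _ T[OF w]] by auto
  hence "L * eisen chi1 chi2 k w = L * (j ^ k * eisen chi1 chi2 k z)"
    by (simp add: E w z)
  moreover have "L \<noteq> 0" using q by (simp add: f_\<psi>_L_def)
  ultimately show ?thesis by (simp add: w_def j_def)
qed

text \<open>A positive \<open>n\<close> has at most \<open>n\<close> divisors, each contributing at
  most \<open>n ^ (k - 1)\<close>. At \<open>n = 0\<close> the bound forces a vanishing constant
  term, the source of the decay at infinity.\<close>

lemma eisen_q_series:
  assumes c1: "\<And>n. norm (chi1 n) \<le> 1" and c2: "\<And>n. norm (chi2 n) \<le> 1" and k: "k \<ge> 1"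
  obtains a where "\<And>n. norm (a n) \<le> real n ^ k" "\<And>z. Im z > 0 \<Longrightarrow> eisen chi1 chi2 k z = 2 * (\<Sum>n. a n * ee z ^ n)"
proof
  define a where "a = (\<lambda>N. if N = 0 then 0 else
    \<Sum>A\<in>{A. A dvd N}. chi1 (int A) * cnj (chi2 (int (N div A))) * of_nat (N div A) ^ (k - 1))"
  show bound: "norm (a n) \<le> real n ^ k" for n
  proof (cases "n = 0")
    case False
    have "norm (chi1 (int A) * cnj (chi2 (int (n div A))) * of_nat (n div A) ^ (k - 1)) \<le> real n ^ (k - 1)" for A
    proof -
      have "norm (chi1 (int A)) * norm (chi2 (int (n div A))) * real (n div A) ^ (k - 1) \<le> 1 * 1 * real n ^ (k - 1)"
        by (intro mult_mono c1 c2 power_mono) (auto simp: div_le_dividend)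
      thus ?thesis by (simp add: norm_mult norm_power)
    qed
    hence "norm (a n) \<le> (\<Sum>A\<in>{A. A dvd n}. real n ^ (k - 1))"
      using False unfolding a_def by (simp only: if_False) (rule sum_norm_le)
    also have "\<dots> = real (card {A. A dvd n}) * real n ^ (k - 1)" by simp
    also have "\<dots> \<le> real n * real n ^ (k - 1)"
    proof -
      have "{A. A dvd n} \<subseteq> {1..n}" using False by (auto simp: dvd_imp_le Suc_le_eq intro: gr0I)
      from card_mono[OF _ this] have "card {A. A dvd n} \<le> n" by simp
      thus ?thesis by (intro mult_right_mono) auto
    qed
    also have "\<dots> = real n ^ k" using k by (cases k) auto
    finally show ?thesis .
  qed (simp add: a_def)
  fix z assume z: "Im z > 0"
  have "summable (\<lambda>n. a n * ee z ^ n)"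
    by (rule summable_norm_cancel[OF summable_norm_poly_bound[OF bound norm_ee_less_1[OF z]]])
  hence "(\<Sum>n. a n * ee z ^ n) = (\<Sum>n. a (Suc n) * ee z ^ Suc n)"
    by (subst suminf_split_head) (auto simp: a_def)
  thus "eisen chi1 chi2 k z = 2 * (\<Sum>n. a n * ee z ^ n)"
    by (simp add: eisen_def Let_def a_def flip: ee_of_nat_mult del: power_Suc)
qed

section \<open>Primitives and periods of forms vanishing at the cusp\<close>


lemma power_le_exp:
  fixes x :: real
  assumes "x \<ge> 0"
  shows "x ^ n \<le> real n ^ n * exp x"
proof (cases "n = 0")
  case False
  have "x / real n \<le> exp (x / real n)" using exp_ge_add_one_self[of "x / real n"] by linarith
  hence "(x / real n) ^ n \<le> exp (x / real n) ^ n" using assms by (intro power_mono) auto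
  also have "\<dots> = exp x" using False by (simp flip: exp_of_nat_mult)
  finally show ?thesis using False by (simp add: power_divide field_simps)
qed (use assms in simp)

lemma norm_poly_le:
  fixes p :: "complex poly"
  shows "norm (poly p z) \<le> (\<Sum>i\<le>degree p. norm (coeff p i)) * (1 + norm z) ^ degree p"
proof -
  have "norm (poly p z) \<le> (\<Sum>i\<le>degree p. norm (coeff p i) * (1 + norm z) ^ degree p)"
    unfolding poly_altdef
  proof (rule sum_norm_le)
    fix i assume "i \<in> {..degree p}"
    have "norm z ^ i \<le> (1 + norm z) ^ i" by (intro power_mono) auto
    also have "\<dots> \<le> (1 + norm z) ^ degree p" using \<open>i \<in> _\<close> by (intro power_increasing) auto
    finally show "norm (coeff p i * z ^ i) \<le> norm (coeff p i) * (1 + norm z) ^ degree p"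
      by (simp add: norm_mult norm_power mult_left_mono)
  qed
  thus ?thesis by (simp add: sum_distrib_right)
qed

lemma convex_upper_half_plane: "convex {z. Im z > 0}"
  by (rule convex_halfspace_Im_gt)

text \<open>Decay is required only at infinity, so the Eisenstein series is covered although it need
  not vanish at other cusps.\<close>

locale cuspidal_form =
  fixes k :: nat and E :: "complex \<Rightarrow> complex"
  assumes k: "k \<ge> 2"
    and holo: "E holomorphic_on {z. Im z > 0}"
    and decay: "\<exists>M. \<forall>z. Im z \<ge> 1 \<longrightarrow> norm (E z) \<le> M * exp (- 2 * pi * Im z)"
begin

text \<open>On a vertical strip the polynomial is O(exp(Im z)), while \<open>E\<close> decays at
  least like exp(-2 Im z).\<close>

lemma integrand_decay:
  obtains K where "\<And>z. \<bar>Re z\<bar> \<le> B \<Longrightarrow> Im z \<ge> 1 \<Longrightarrow> norm (E z * poly p z) \<le> K * exp (- Im z)"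
proof -
  obtain M where M: "\<And>z. Im z \<ge> 1 \<Longrightarrow> norm (E z) \<le> M * exp (- 2 * pi * Im z)"
    using decay by blast
  define n C where "n = degree p" "C = (\<Sum>i\<le>degree p. norm (coeff p i))"
  have C: "C \<ge> 0" by (auto simp: n_C_def intro: sum_nonneg)
  have "norm (E z * poly p z) \<le> (\<bar>M\<bar> * C * (real n ^ n * exp (1 + B))) * exp (- Im z)"
    if z: "\<bar>Re z\<bar> \<le> B" "Im z \<ge> 1" for z
  proof -
    have "norm (poly p z) \<le> C * (1 + norm z) ^ n" unfolding n_C_def by (rule norm_poly_le)
    also have "\<dots> \<le> C * (1 + (B + Im z)) ^ n"
      using C z cmod_le[of z] by (intro mult_left_mono power_mono) auto
    also have "\<dots> \<le> C * (real n ^ n * exp (1 + (B + Im z)))"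
      using C z by (intro mult_left_mono power_le_exp) auto
    finally have P: "norm (poly p z) \<le> C * (real n ^ n * (exp (1 + B) * exp (Im z)))"
      by (simp add: exp_add mult_ac)
    have "norm (E z) \<le> M * exp (- 2 * pi * Im z)" by (rule M[OF z(2)])
    also have "\<dots> \<le> \<bar>M\<bar> * exp (- 2 * Im z)"
      using z pi_gt3 by (intro mult_mono) auto
    finally have "norm (E z * poly p z) \<le> (\<bar>M\<bar> * exp (- 2 * Im z)) * (C * (real n ^ n * (exp (1 + B) * exp (Im z))))"
      unfolding norm_mult by (intro mult_mono P) auto
    also have "\<dots> = (\<bar>M\<bar> * C * (real n ^ n * exp (1 + B))) * (exp (- 2 * Im z) * exp (Im z))"
      by (simp add: mult_ac)
    also have "exp (- 2 * Im z) * exp (Im z) = exp (- Im z)" by (simp flip: exp_add)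
    finally show ?thesis .
  qed
  thus ?thesis using that by blast
qed

text \<open>The condition at infinity fixes the constant of integration: \<open>F z\<close> is the
  integral of \<open>E * p\<close> from infinity to \<open>z\<close>, whichever vertical line is
  used.\<close>

definition is_prim :: "complex poly \<Rightarrow> (complex \<Rightarrow> complex) \<Rightarrow> bool" where
  "is_prim p F \<longleftrightarrow> (\<forall>z. Im z > 0 \<longrightarrow> (F has_field_derivative E z * poly p z) (at z)) \<and>
     (\<forall>b. ((\<lambda>t. F (Complex b t)) \<longlongrightarrow> 0) at_top)"

lemma is_primD:
  assumes "is_prim p F"
  shows "Im z > 0 \<Longrightarrow> (F has_field_derivative E z * poly p z) (at z)"
    and "((\<lambda>t. F (Complex b t)) \<longlongrightarrow> 0) at_top"
  using assms by (auto simp: is_prim_def)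

lemma has_vector_derivative_vertical:
  assumes "(F has_field_derivative D) (at (Complex b t))"
  shows "((\<lambda>t. F (Complex b t)) has_vector_derivative D * \<i>) (at t)"
proof -
  have "((\<lambda>t. Complex b t) has_vector_derivative \<i>) (at t)"
    unfolding Complex_eq by (auto intro!: derivative_eq_intros)
  from field_vector_diff_chain_at[OF this assms] show ?thesis
    by (simp add: o_def mult.commute)
qed

text \<open>A holomorphic primitive exists on the convex half-plane; exponential decay gives it a
  limit on each vertical line, the same on all of them, which is then subtracted.\<close>

lemma is_prim_exists: "\<exists>F. is_prim p F"
proof -
  have "(\<lambda>z. E z * poly p z) holomorphic_on {z. Im z > 0}"
    by (intro holomorphic_intros holo)
  then obtain Q where Q0: "(Q has_field_derivative E z * poly p z) (at z within {z. Im z > 0})"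
    if "z \<in> {z. Im z > 0}" for z
    by (rule holomorphic_convex_primitive'[OF convex_upper_half_plane open_halfspace_Im_gt]) blast
  have Q: "(Q has_field_derivative E z * poly p z) (at z)" if "Im z > 0" for z
    using Q0[of z] that by (simp add: at_within_open[OF _ open_halfspace_Im_gt])
  have vert: "\<exists>L. ((\<lambda>t. Q (Complex b t)) \<longlongrightarrow> L) at_top" for b
  proof -
    obtain K where K: "\<And>z. \<bar>Re z\<bar> \<le> \<bar>b\<bar> \<Longrightarrow> Im z \<ge> 1 \<Longrightarrow> norm (E z * poly p z) \<le> K * exp (- Im z)"
      using integrand_decay by blast
    have K0: "K \<ge> 0"
    proof -
      have "0 \<le> K * exp (- 1)" using order_trans[OF norm_ge_zero K[of "Complex b 1"]] by simp
      thus ?thesis by (simp add: zero_le_mult_iff)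
    qed
    define g where "g = (\<lambda>t. Q (Complex b t))"
    have g: "(g has_vector_derivative E (Complex b t) * poly p (Complex b t) * \<i>) (at t)" if "t > 0" for t
      unfolding g_def by (rule has_vector_derivative_vertical, rule Q) (use that in simp)
    \<comment> \<open>Mean value inequality against \<open>- K * exp (- t)\<close>, an
      antiderivative of the bound on the derivative.\<close>
    have diff: "norm (g s - g t) \<le> K * exp (- t)" if "t \<ge> 1" "t \<le> s" for s t
    proof (cases "t = s")
      case False
      have "norm (g s - g t) \<le> - K * exp (- s) - (- K * exp (- t))"
      proof (rule differentiable_bound_general)
        show "continuous_on {t..s} g"
          by (rule continuous_at_imp_continuous_on)
             (use that in \<open>auto intro!: has_vector_derivative_continuous g\<close>)
        show "(g has_vector_derivative E (Complex b x) * poly p (Complex b x) * \<i>) (at x)" if "t < x" "x < s" for x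
          using that \<open>t \<ge> 1\<close> by (intro g) auto
        show "((\<lambda>t. - K * exp (- t)) has_vector_derivative K * exp (- x)) (at x)" for x
          unfolding has_real_derivative_iff_has_vector_derivative [symmetric]
          by (auto intro!: derivative_eq_intros)
        show "norm (E (Complex b x) * poly p (Complex b x) * \<i>) \<le> K * exp (- x)" if "t < x" "x < s" for x
          using K[of "Complex b x"] that \<open>t \<ge> 1\<close> by (simp add: norm_mult)
      qed (use False that in \<open>auto intro!: continuous_intros\<close>)
      also have "\<dots> \<le> K * exp (- t)" using K0 by simp
      finally show ?thesis .
    qed (use K0 in simp)
    have lim0: "((\<lambda>t. K * exp (- t)) \<longlongrightarrow> 0) at_top" by real_asymp
    have "Cauchy (\<lambda>n. g (real n))"
    proof (rule metric_CauchyI)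
      fix e :: real assume "e > 0"
      have "(\<lambda>n. K * exp (- real n)) \<longlonglongrightarrow> 0" by real_asymp
      hence "eventually (\<lambda>n. n \<ge> 1 \<and> K * exp (- real n) < e / 2) sequentially"
        using \<open>e > 0\<close> by (intro eventually_conj eventually_ge_at_top order_tendstoD(2)) auto
      then obtain N where N: "N \<ge> 1" "K * exp (- real N) < e / 2"
        by (auto simp: eventually_at_top_linorder)
      have N': "dist (g (real m)) (g (real N)) < e / 2" if "m \<ge> N" for m
        using diff[of "real N" "real m"] N that by (simp add: dist_norm)
      hence "dist (g (real m)) (g (real n)) < e" if "m \<ge> N" "n \<ge> N" for m n
        using N'[OF that(1)] N'[OF that(2)] dist_triangle2[of "g (real m)" "g (real n)" "g (real N)"]
        by linarith
      thus "\<exists>M. \<forall>m\<ge>M. \<forall>n\<ge>M. dist (g (real m)) (g (real n)) < e" by blast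
    qed
    then obtain L where L: "(\<lambda>n. g (real n)) \<longlonglongrightarrow> L" using Cauchy_convergent convergent_def by blast
    have "norm (g t - L) \<le> K * exp (- t)" if "t \<ge> 1" for t
    proof (rule tendsto_upperbound)
      show "(\<lambda>n. norm (g t - g (real n))) \<longlonglongrightarrow> norm (g t - L)"
        by (intro tendsto_intros L)
      have "eventually (\<lambda>n. real n \<ge> t) sequentially"
        using filterlim_real_sequentially by (auto simp: filterlim_at_top)
      thus "eventually (\<lambda>n. norm (g t - g (real n)) \<le> K * exp (- t)) sequentially"
        by eventually_elim (use diff that in \<open>auto simp: norm_minus_commute\<close>)
    qed auto
    hence "eventually (\<lambda>t. norm (g t - L) \<le> K * exp (- t)) at_top"
      by (intro eventually_mono[OF eventually_ge_at_top[of 1]]) auto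
    hence "((\<lambda>t. g t - L) \<longlongrightarrow> 0) at_top" by (rule Lim_null_comparison[OF _ lim0])
    hence "(g \<longlongrightarrow> L) at_top" by (simp add: LIM_zero_iff)
    thus ?thesis unfolding g_def by blast
  qed
  then obtain L where L: "((\<lambda>t. Q (Complex 0 t)) \<longlongrightarrow> L) at_top" by blast
  \<comment> \<open>Moving horizontally at height \<open>t\<close> changes \<open>Q\<close> by
    O(exp(-t)), so the limit on the imaginary axis is shared by every vertical line.\<close>
  have "((\<lambda>t. Q (Complex b t)) \<longlongrightarrow> L) at_top" for b
  proof -
    obtain K where K: "\<And>z. \<bar>Re z\<bar> \<le> \<bar>b\<bar> \<Longrightarrow> Im z \<ge> 1 \<Longrightarrow> norm (E z * poly p z) \<le> K * exp (- Im z)"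
      using integrand_decay by blast
    have "norm (Q (Complex b t) - Q (Complex 0 t)) \<le> K * exp (- t) * \<bar>b\<bar>" if "t \<ge> 1" for t
    proof -
      define S where "S = cbox (Complex (- \<bar>b\<bar>) t) (Complex \<bar>b\<bar> t)"
      have S: "z \<in> S \<longleftrightarrow> \<bar>Re z\<bar> \<le> \<bar>b\<bar> \<and> Im z = t" for z
        by (auto simp: S_def in_cbox_complex_iff)
      have "convex S" unfolding S_def by (rule convex_box)
      have "norm (Q (Complex b t) - Q (Complex 0 t)) \<le> K * exp (- t) * norm (Complex b t - Complex 0 t)"
      proof (rule field_differentiable_bound[OF \<open>convex S\<close>])
        show "(Q has_field_derivative E z * poly p z) (at z within S)" if "z \<in> S" for z
          using that \<open>t \<ge> 1\<close> by (intro has_field_derivative_at_within[OF Q]) (auto simp: S)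
        show "norm (E z * poly p z) \<le> K * exp (- t)" if "z \<in> S" for z
          using that \<open>t \<ge> 1\<close> K[of z] by (auto simp: S)
      qed (auto simp: S)
      thus ?thesis by (simp add: cmod_def)
    qed
    hence "eventually (\<lambda>t. norm (Q (Complex b t) - Q (Complex 0 t)) \<le> K * exp (- t) * \<bar>b\<bar>) at_top"
      by (intro eventually_mono[OF eventually_ge_at_top[of 1]]) auto
    moreover have "((\<lambda>t. K * exp (- t) * \<bar>b\<bar>) \<longlongrightarrow> 0) at_top" by real_asymp
    ultimately have "((\<lambda>t. Q (Complex b t) - Q (Complex 0 t)) \<longlongrightarrow> 0) at_top"
      by (rule Lim_null_comparison)
    from tendsto_add[OF this L] show ?thesis by simp
  qed
  hence "((\<lambda>t. Q (Complex b t) - L) \<longlongrightarrow> 0) at_top" for b by (simp add: LIM_zero_iff)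
  hence "is_prim p (\<lambda>z. Q z - L)"
    unfolding is_prim_def using Q by (auto intro!: derivative_eq_intros)
  thus ?thesis by blast
qed

definition prim :: "complex poly \<Rightarrow> complex \<Rightarrow> complex" where
  "prim p = (SOME F. is_prim p F)"

lemma is_prim_prim: "is_prim p (prim p)"
  unfolding prim_def by (rule someI_ex[OF is_prim_exists])

lemma constant_on_upper_half_plane:
  assumes "\<And>z. Im z > 0 \<Longrightarrow> (F has_field_derivative 0) (at z)" "Im z > 0" "Im w > 0"
  shows "F z = F w"
proof -
  have "\<exists>c. \<forall>x\<in>{z. Im z > 0}. F x = c"
    by (rule has_field_derivative_zero_constant[OF convex_upper_half_plane])
       (use assms(1) in \<open>auto intro: has_field_derivative_at_within\<close>)
  thus ?thesis using assms(2,3) by auto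
qed

text \<open>Two candidates differ by a constant, which the limit along the imaginary axis shows to
  be 0.\<close>

lemma is_prim_unique:
  assumes "is_prim p F" "is_prim p G" "Im z > 0"
  shows "F z = G z"
proof -
  have c: "F w - G w = F z - G z" if "Im w > 0" for w
  proof (rule constant_on_upper_half_plane[where F = "\<lambda>z. F z - G z", OF _ that assms(3)])
    fix z :: complex assume "Im z > 0"
    from DERIV_diff[OF is_primD(1)[OF assms(1) this] is_primD(1)[OF assms(2) this]]
    show "((\<lambda>z. F z - G z) has_field_derivative 0) (at z)" by simp
  qed
  have "((\<lambda>t. F (Complex 0 t) - G (Complex 0 t)) \<longlongrightarrow> 0 - 0) at_top"
    by (intro tendsto_diff is_primD(2)[OF assms(1)] is_primD(2)[OF assms(2)])
  moreover have "eventually (\<lambda>t. F (Complex 0 t) - G (Complex 0 t) = F z - G z) at_top"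
    using eventually_gt_at_top[of 0] by eventually_elim (rule c, simp)
  ultimately have "((\<lambda>t::real. F z - G z) \<longlongrightarrow> 0) at_top"
    by (simp add: tendsto_cong)
  thus ?thesis by (simp add: tendsto_const_iff)
qed

lemma prim_sum:
  assumes "Im z > 0"
  shows "prim (\<Sum>i\<in>A. smult (c i) (p i)) z = (\<Sum>i\<in>A. c i * prim (p i) z)"
proof (rule is_prim_unique[OF is_prim_prim _ assms])
  note P = is_primD[OF is_prim_prim]
  have "((\<lambda>z. \<Sum>i\<in>A. c i * prim (p i) z) has_field_derivative E z * poly (\<Sum>i\<in>A. smult (c i) (p i)) z) (at z)"
    if "Im z > 0" for z
    by (auto intro!: derivative_eq_intros DERIV_sum P that simp: poly_sum sum_distrib_left mult_ac)
  moreover have "((\<lambda>t. \<Sum>i\<in>A. c i * prim (p i) (Complex b t)) \<longlongrightarrow> (\<Sum>i\<in>A. c i * 0)) at_top" for b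
    by (intro tendsto_sum tendsto_mult tendsto_const P)
  ultimately show "is_prim (\<Sum>i\<in>A. smult (c i) (p i)) (\<lambda>z. \<Sum>i\<in>A. c i * prim (p i) z)"
    by (simp add: is_prim_def)
qed

end


text \<open>The exponential bound makes \<open>f\<close> Lebesgue integrable on the open half-line;
  there the fundamental theorem with limits at both ends holds, and the Lebesgue integral agrees
  with \<open>integral\<close>.\<close>

lemma integral_halfline_FTC:
  fixes F f :: "real \<Rightarrow> complex"
  assumes F: "\<And>t. t > 0 \<Longrightarrow> (F has_vector_derivative f t) (at t)"
    and cont: "continuous_on {0<..} f" and bound: "\<And>t. t > 0 \<Longrightarrow> norm (f t) \<le> C * exp (- t)"
    and A: "(F \<longlongrightarrow> A) (at_right 0)" and B: "(F \<longlongrightarrow> B) at_top"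
  shows "integral {0<..} f = B - A"
proof -
  have "set_integrable lborel (einterval (ereal 0) \<infinity>) (\<lambda>t. exp (- t))"
  proof (rule interval_integral_FTC_nonneg[where F = "\<lambda>t. - exp (- t)" and A = "- 1" and B = 0])
    show "DERIV (\<lambda>t. - exp (- t)) x :> exp (- x)" for x :: real
      by (auto intro!: derivative_eq_intros)
    show "(((\<lambda>t. - exp (- t)) \<circ> real_of_ereal) \<longlongrightarrow> - 1) (at_right (ereal 0))"
      unfolding ereal_tendsto_simps by real_asymp
    show "(((\<lambda>t. - exp (- t)) \<circ> real_of_ereal) \<longlongrightarrow> 0) (at_left \<infinity>)"
      unfolding ereal_tendsto_simps by real_asymp
  qed (auto intro!: continuous_intros)
  hence "set_integrable lborel {0<..} (\<lambda>t. exp (- t :: real))" by simp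
  hence dom: "set_integrable lborel {0<..} (\<lambda>t. C * exp (- t))" by simp
  have int: "set_integrable lborel {0<..} f"
  proof (rule set_integrable_bound[OF dom])
    show "set_borel_measurable lborel {0<..} f"
      using borel_measurable_continuous_on_indicator[OF _ cont]
      by (simp add: set_borel_measurable_def)
    show "AE t in lborel. t \<in> {0<..} \<longrightarrow> norm (f t) \<le> norm (C * exp (- t))"
      by (rule AE_I2) (use bound in \<open>auto intro: order_trans[OF _ abs_ge_self]\<close>)
  qed
  have "(LBINT t=ereal 0..\<infinity>. f t) = B - A"
  proof (rule interval_integral_FTC_integrable[where F = F])
    show "isCont f x" if "ereal 0 < ereal x" for x
      using cont that by (simp add: continuous_on_eq_continuous_at)
    show "set_integrable lborel (einterval (ereal 0) \<infinity>) f" using int by simp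
    show "((F \<circ> real_of_ereal) \<longlongrightarrow> A) (at_right (ereal 0))"
      unfolding ereal_tendsto_simps by (rule A)
    show "((F \<circ> real_of_ereal) \<longlongrightarrow> B) (at_left \<infinity>)"
      unfolding ereal_tendsto_simps by (rule B)
  qed (use F in auto)
  thus ?thesis
    using set_borel_integral_eq_integral[OF int] by (simp add: interval_integral_to_infinity_eq)
qed

section \<open>Periods and their cocycle relation\<close>

fun mob :: "mat2 \<Rightarrow> complex \<Rightarrow> complex" where
  "mob (a, b, c, d) z = (of_int a * z + of_int b) / (of_int c * z + of_int d)"

locale modular_cuspidal_form = cuspidal_form +
  fixes \<Gamma> :: "mat2 set"
  assumes det: "(a, b, c, d) \<in> \<Gamma> \<Longrightarrow> a * d - b * c = 1"
    and modular: "(a, b, c, d) \<in> \<Gamma> \<Longrightarrow> Im z > 0 \<Longrightarrow>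
      E (mob (a, b, c, d) z) = (of_int c * z + of_int d) ^ k * E z"
begin

text \<open>Linear forms are kept as coefficient rows \<open>(u, v)\<close>, on which matrices act
  from the right.\<close>

definition lin :: "complex \<Rightarrow> complex \<Rightarrow> complex poly" where
  "lin u v = [:v, u:] ^ (k - 2)"

lemma poly_lin: "poly (lin u v) z = (u * z + v) ^ (k - 2)"
  by (simp add: lin_def mult.commute add.commute)

text \<open>\<open>E\<close> contributes \<open>j ^ k\<close> and the derivative of
  \<open>mob\<close> contributes \<open>1 / (j * j)\<close>; the remaining
  \<open>j ^ (k - 2)\<close> clears the denominators of the linear form and leaves the row times the
  matrix.\<close>

lemma prim_lin_moebius_deriv:
  assumes \<gamma>: "(a, b, c, d) \<in> \<Gamma>" and w: "Im w > 0"
  shows "((\<lambda>w. prim (lin u v) (mob (a, b, c, d) w)) has_field_derivative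
    E w * poly (lin (u * of_int a + v * of_int c) (u * of_int b + v * of_int d)) w) (at w)"
proof -
  define j m where "j = of_int c * w + of_int d" "m = mob (a, b, c, d) w"
  note D = det[OF \<gamma>]
  have j: "j \<noteq> 0" using moebius_denom_nonzero[OF D w] by (simp add: j_m_def)
  have m: "Im m > 0" using Im_moebius_pos[OF D w] by (simp add: j_m_def)
  have "(mob (a, b, c, d) has_field_derivative
      (of_int a * j - (of_int a * w + of_int b) * of_int c) / (j * j)) (at w)"
    using j unfolding mob.simps[abs_def] j_m_def by (auto intro!: derivative_eq_intros)
  also have "of_int a * j - (of_int a * w + of_int b) * of_int c = (of_int (a * d - b * c) :: complex)"
    by (simp add: j_m_def algebra_simps)
  finally have dm: "(mob (a, b, c, d) has_field_derivative 1 / (j * j)) (at w)" by (simp only: D of_int_1)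
  have "((\<lambda>w. prim (lin u v) (mob (a, b, c, d) w)) has_field_derivative
     E m * poly (lin u v) m * (1 / (j * j))) (at w)"
    using DERIV_chain2[OF is_primD(1)[OF is_prim_prim] dm, of "lin u v"] m by (simp add: j_m_def)
  also have "E m = j ^ (k - 2) * (j * j) * E w"
  proof -
    have "j ^ (k - 2) * (j * j) = j ^ k"
      using k by (metis le_add_diff_inverse2 power_add power2_eq_square)
    thus ?thesis using modular[OF \<gamma> w] by (simp add: j_m_def)
  qed
  also have "j ^ (k - 2) * (j * j) * E w * poly (lin u v) m * (1 / (j * j)) = E w * (j * (u * m + v)) ^ (k - 2)"
    using j by (simp add: poly_lin power_mult_distrib)
  also have "j * (u * m + v) = (u * of_int a + v * of_int c) * w + (u * of_int b + v * of_int d)"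
    using j by (simp add: j_m_def field_simps)
  finally show ?thesis by (simp add: poly_lin)
qed

text \<open>The integral from infinity to the image of infinity, cut at the image of
  \<open>\<i>\<close>: the second term is the leg from the image of infinity to the image of
  \<open>\<i>\<close>, pulled back by the matrix.\<close>

fun period :: "mat2 \<Rightarrow> complex \<Rightarrow> complex \<Rightarrow> complex" where
  "period (a, b, c, d) u v = prim (lin u v) (mob (a, b, c, d) \<i>) -
     prim (lin (u * of_int a + v * of_int c) (u * of_int b + v * of_int d)) \<i>"

text \<open>The difference of the two primitives has derivative 0, so its value at
  \<open>\<i>\<close>, the period, is its value on the whole half-plane.\<close>

lemma prim_lin_moebius:
  assumes \<gamma>: "(a, b, c, d) \<in> \<Gamma>" and w: "Im w > 0"
  shows "prim (lin u v) (mob (a, b, c, d) w) =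
    prim (lin (u * of_int a + v * of_int c) (u * of_int b + v * of_int d)) w + period (a, b, c, d) u v"
proof -
  have "prim (lin u v) (mob (a, b, c, d) w) - prim (lin (u * of_int a + v * of_int c) (u * of_int b + v * of_int d)) w =
    prim (lin u v) (mob (a, b, c, d) \<i>) - prim (lin (u * of_int a + v * of_int c) (u * of_int b + v * of_int d)) \<i>"
  proof (rule constant_on_upper_half_plane[where F = "\<lambda>w. prim (lin u v) (mob (a, b, c, d) w) -
     prim (lin (u * of_int a + v * of_int c) (u * of_int b + v * of_int d)) w"])
    fix z :: complex assume z: "Im z > 0"
    from DERIV_diff[OF prim_lin_moebius_deriv[OF \<gamma> z, of u v]
      is_primD(1)[OF is_prim_prim[of "lin (u * of_int a + v * of_int c) (u * of_int b + v * of_int d)"] z]]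
    show "((\<lambda>w. prim (lin u v) (mob (a, b, c, d) w) -
      prim (lin (u * of_int a + v * of_int c) (u * of_int b + v * of_int d)) w) has_field_derivative 0) (at z)"
      by simp
  qed (use w in auto)
  thus ?thesis unfolding period.simps by (simp only: diff_eq_eq add.commute)
qed

text \<open>The primitive at the image of \<open>\<i>\<close> under the product is transformed once
  by the product and once factor by factor; the constants are compared.\<close>

lemma period_mult:
  assumes "(a, b, c, d) \<in> \<Gamma>" "(a', b', c', d') \<in> \<Gamma>" "mat_mult (a, b, c, d) (a', b', c', d') \<in> \<Gamma>"
  shows "period (mat_mult (a, b, c, d) (a', b', c', d')) u v =
    period (a', b', c', d') (u * of_int a + v * of_int c) (u * of_int b + v * of_int d) + period (a, b, c, d) u v"
proof -
  define m where "m = mob (a', b', c', d') \<i>"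
  define j where "j = of_int c' * \<i> + of_int d'"
  have j: "j \<noteq> 0" using moebius_denom_nonzero[OF det[OF assms(2)], of \<i>] by (simp add: j_def)
  have m: "Im m > 0" using Im_moebius_pos[OF det[OF assms(2)], of \<i>] by (simp add: m_def)
  have "mob (mat_mult (a, b, c, d) (a', b', c', d')) \<i> = mob (a, b, c, d) m"
  proof -
    have mj: "m = (of_int a' * \<i> + of_int b') / j" by (simp add: m_def j_def)
    have "of_int a * m + of_int b = (of_int a * (of_int a' * \<i> + of_int b') + of_int b * j) / j"
         "of_int c * m + of_int d = (of_int c * (of_int a' * \<i> + of_int b') + of_int d * j) / j"
      using j by (simp_all add: mj field_simps)
    thus ?thesis using j by (simp add: mat_mult_def) (simp add: j_def algebra_simps)
  qed
  moreover have "prim (lin u v) (mob (mat_mult (a, b, c, d) (a', b', c', d')) \<i>) =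
     prim (lin (u * of_int (a * a' + b * c') + v * of_int (c * a' + d * c'))
       (u * of_int (a * b' + b * d') + v * of_int (c * b' + d * d'))) \<i> +
     period (mat_mult (a, b, c, d) (a', b', c', d')) u v"
    using prim_lin_moebius[of "a * a' + b * c'" "a * b' + b * d'" "c * a' + d * c'" "c * b' + d * d'" \<i> u v] assms(3)
    by (simp add: mat_mult_def)
  moreover have "prim (lin u v) (mob (a, b, c, d) m) =
      prim (lin (u * of_int a + v * of_int c) (u * of_int b + v * of_int d)) m + period (a, b, c, d) u v"
    by (rule prim_lin_moebius[OF assms(1) m])
  moreover have "prim (lin (u * of_int a + v * of_int c) (u * of_int b + v * of_int d)) m =
     prim (lin ((u * of_int a + v * of_int c) * of_int a' + (u * of_int b + v * of_int d) * of_int c')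
       ((u * of_int a + v * of_int c) * of_int b' + (u * of_int b + v * of_int d) * of_int d')) \<i> +
     period (a', b', c', d') (u * of_int a + v * of_int c) (u * of_int b + v * of_int d)"
    unfolding m_def by (rule prim_lin_moebius[OF assms(2)]) simp
  ultimately show ?thesis by (simp add: algebra_simps del: period.simps mob.simps)
qed

lemma period_one: "period (1, 0, 0, 1) u v = 0"
  by simp

text \<open>Both linear forms expand binomially and \<open>prim\<close> is linear, so the period is
  homogeneous of degree \<open>k - 2\<close> in \<open>(u, v)\<close>, with coefficients that depend
  only on the matrix.\<close>

lemma period_expansion:
  assumes "(a, b, c, d) \<in> \<Gamma>"
  obtains \<rho> where "\<And>u v. period (a, b, c, d) u v = (\<Sum>n\<le>k - 2. of_nat (k - 2 choose n) * u ^ n * v ^ (k - 2 - n) * \<rho> n)"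
proof
  define P where "P = (\<lambda>n. [:of_int b, of_int a:] ^ n * [:of_int d, of_int c :: complex:] ^ (k - 2 - n))"
  define Q where "Q = (\<lambda>n. [:0, 1 :: complex:] ^ n)"
  fix u v
  have I: "Im (mob (a, b, c, d) \<i>) > 0" using Im_moebius_pos[OF det[OF assms], of \<i>] by simp
  have 1: "lin u v = (\<Sum>n\<le>k - 2. smult (of_nat (k - 2 choose n) * u ^ n * v ^ (k - 2 - n)) (Q n))"
  proof -
    have "[:v, u:] = smult u [:0, 1:] + [:v:]" by simp
    hence "lin u v = (smult u [:0, 1:] + [:v:]) ^ (k - 2)" by (simp only: lin_def)
    also have "\<dots> = (\<Sum>n\<le>k - 2. of_nat (k - 2 choose n) * (smult u [:0, 1:]) ^ n * [:v:] ^ (k - 2 - n))"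
      by (rule binomial_ring)
    also have "\<dots> = (\<Sum>n\<le>k - 2. smult (of_nat (k - 2 choose n) * u ^ n * v ^ (k - 2 - n)) (Q n))"
      unfolding Q_def smult_power poly_const_pow of_nat_poly by (intro sum.cong) (simp_all add: mult_ac)
    finally show ?thesis .
  qed
  have 2: "lin (u * of_int a + v * of_int c) (u * of_int b + v * of_int d) =
     (\<Sum>n\<le>k - 2. smult (of_nat (k - 2 choose n) * u ^ n * v ^ (k - 2 - n)) (P n))"
  proof -
    have "[:u * of_int b + v * of_int d, u * of_int a + v * of_int c:] =
       smult u [:of_int b, of_int a:] + smult v [:of_int d, of_int c:]" by simp
    hence "lin (u * of_int a + v * of_int c) (u * of_int b + v * of_int d) =
       (smult u [:of_int b, of_int a:] + smult v [:of_int d, of_int c:]) ^ (k - 2)" by (simp only: lin_def)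
    also have "\<dots> = (\<Sum>n\<le>k - 2. of_nat (k - 2 choose n) * (smult u [:of_int b, of_int a:]) ^ n *
        (smult v [:of_int d, of_int c:]) ^ (k - 2 - n))"
      by (rule binomial_ring)
    also have "\<dots> = (\<Sum>n\<le>k - 2. smult (of_nat (k - 2 choose n) * u ^ n * v ^ (k - 2 - n)) (P n))"
      unfolding P_def smult_power of_nat_poly by (intro sum.cong) (simp_all add: mult_ac)
    finally show ?thesis .
  qed
  show "period (a, b, c, d) u v = (\<Sum>n\<le>k - 2. of_nat (k - 2 choose n) * u ^ n * v ^ (k - 2 - n) *
      (prim (Q n) (mob (a, b, c, d) \<i>) - prim (P n) \<i>))"
    unfolding period.simps 1 2 prim_sum[OF I] by (subst prim_sum) (simp_all add: right_diff_distrib sum_subtractf)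
qed

end


section \<open>Periods as integrals along vertical lines\<close>

context modular_cuspidal_form
begin

text \<open>This turns the approach to the cusp \<open>a / c\<close> into the approach to infinity
  on the line over \<open>- d / c\<close>, where decay is known.\<close>

lemma moebius_vertical:
  assumes "(a, b, c, d) \<in> \<Gamma>" "c \<noteq> 0" "t > 0"
  shows "of_int c * Complex (- of_int d / of_int c) (1 / ((of_int c)\<^sup>2 * t)) + of_int d = \<i> / of_real (of_int c * t)"
    and "mob (a, b, c, d) (Complex (- of_int d / of_int c) (1 / ((of_int c)\<^sup>2 * t))) = Complex (of_int a / of_int c) t"
proof -
  define C where "C = real_of_int c"
  have C: "C \<noteq> 0" using assms(2) by (simp add: C_def)
  have ad: "real_of_int a * real_of_int d = 1 + real_of_int b * C"
    using arg_cong[OF det[OF assms(1)], of real_of_int] by (simp add: C_def)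
  show 1: "of_int c * Complex (- of_int d / of_int c) (1 / ((of_int c)\<^sup>2 * t)) + of_int d = \<i> / of_real (of_int c * t)"
    using C assms(3) by (simp add: complex_eq_iff Im_divide_of_real power2_eq_square flip: C_def)
  have 2: "of_int a * Complex (- of_int d / of_int c) (1 / ((of_int c)\<^sup>2 * t)) + of_int b =
     Complex (of_int a / of_int c) t * (\<i> / of_real (of_int c * t))"
    using C assms(3) ad
    by (simp add: complex_eq_iff Im_divide_of_real Re_divide_of_real power2_eq_square field_simps flip: C_def)
  have "\<i> / of_real (of_int c * t) \<noteq> 0" using C assms(3) by (simp flip: C_def)
  thus "mob (a, b, c, d) (Complex (- of_int d / of_int c) (1 / ((of_int c)\<^sup>2 * t))) = Complex (of_int a / of_int c) t"
    unfolding mob.simps 1 2 by (rule nonzero_mult_div_cancel_right)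
qed

lemma continuous_on_vertical_integrand:
  "continuous_on {0<..} (\<lambda>t. E (Complex x t) * poly p (Complex x t))"
proof -
  have v: "continuous_on {0<..} (\<lambda>t. Complex x t)"
    unfolding Complex_eq by (intro continuous_intros)
  have "continuous_on {0<..} (\<lambda>t. E (Complex x t))"
    by (rule continuous_on_compose2[OF holomorphic_on_imp_continuous_on[OF holo] v]) auto
  moreover have "continuous_on {0<..} (\<lambda>t. poly p (Complex x t))"
    by (rule continuous_on_compose2[OF _ v, of UNIV]) (auto intro: continuous_intros)
  ultimately show ?thesis by (rule continuous_on_mult)
qed

text \<open>Three ranges: for \<open>t \<ge> 1\<close> decay at infinity, for
  \<open>t \<le> 1 / s\<close> modularity moves the point to height
  \<open>1 / (s * t) \<ge> 1\<close>, and in between compactness.\<close>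

lemma vertical_integrand_bound:
  assumes \<gamma>: "(a, b, c, d) \<in> \<Gamma>" and c: "c \<noteq> 0"
  obtains C where "\<And>t. t > 0 \<Longrightarrow>
    norm (E (Complex (of_int a / of_int c) t) * poly (lin 1 (- of_real (of_int a / of_int c))) (Complex (of_int a / of_int c) t)) \<le> C * exp (- t)"
proof -
  define x s where "x = real_of_int a / real_of_int c" "s = (real_of_int c)\<^sup>2"
  define f where "f = (\<lambda>t. E (Complex x t) * poly (lin 1 (- of_real x)) (Complex x t))"
  have s: "s > 0" using c by (simp add: x_s_def)
  have "1 \<le> \<bar>real_of_int c\<bar>" using c by simp
  have ck: "1 \<le> \<bar>real_of_int c\<bar> ^ k" using \<open>1 \<le> \<bar>real_of_int c\<bar>\<close> by (rule one_le_power)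
  obtain K where K: "\<And>z. \<bar>Re z\<bar> \<le> \<bar>x\<bar> \<Longrightarrow> Im z \<ge> 1 \<Longrightarrow>
      norm (E z * poly (lin 1 (- of_real x)) z) \<le> K * exp (- Im z)"
    using integrand_decay by blast
  obtain M where M: "\<And>z. Im z \<ge> 1 \<Longrightarrow> norm (E z) \<le> M * exp (- 2 * pi * Im z)"
    using decay by blast
  have large: "norm (f t) \<le> K * exp (- t)" if "t \<ge> 1" for t
    unfolding f_def using K[of "Complex x t"] that by simp
  have small: "norm (f t) \<le> 4 * \<bar>M\<bar> * s\<^sup>2" if t: "t > 0" "t \<le> 1 / s" for t
  proof -
    define w y where "w = Complex (- of_int d / of_int c) (1 / (s * t))" "y = 1 / (s * t)"
    have y: "y \<ge> 1" "Im w = y" using s t by (auto simp: w_y_def field_simps)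
    have fE: "E (Complex x t) = (\<i> / of_real (of_int c * t)) ^ k * E w"
    proof -
      have "of_int c * w + of_int d = \<i> / of_real (of_int c * t)" "mob (a, b, c, d) w = Complex x t"
        unfolding w_y_def x_s_def by (rule moebius_vertical[OF \<gamma> c t(1)])+
      moreover have "Im w > 0" using y by simp
      ultimately show ?thesis using modular[OF \<gamma>, of w] by (simp only:)
    qed
    have p: "norm (poly (lin 1 (- of_real x)) (Complex x t)) = t ^ (k - 2)"
    proof -
      have "Complex x t - of_real x = of_real t * \<i>" by (simp add: complex_eq_iff)
      thus ?thesis using t by (simp add: poly_lin norm_power norm_mult)
    qed
    have "norm (E w) \<le> M * exp (- 2 * pi * y)" using M[of w] y by simp
    also have "\<dots> \<le> \<bar>M\<bar> * exp (- y)" using y pi_gt3 by (intro mult_mono) auto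
    \<comment> \<open>Quadratic decay is enough: it yields the square of \<open>t\<close>, which
      with \<open>t ^ (k - 2)\<close> from the polynomial cancels the \<open>1 / t ^ k\<close> of
      modularity. The 4 is \<open>2 ^ 2\<close> from \<open>power_le_exp\<close>.\<close>
    also have "exp (- y) \<le> 4 / y\<^sup>2"
      using power_le_exp[of y 2] y by (simp add: exp_minus field_simps)
    hence "\<bar>M\<bar> * exp (- y) \<le> \<bar>M\<bar> * (4 / y\<^sup>2)" by (intro mult_left_mono) auto
    also have "\<bar>M\<bar> * (4 / y\<^sup>2) = 4 * \<bar>M\<bar> * s\<^sup>2 * t\<^sup>2"
      by (simp add: w_y_def power_divide power_mult_distrib)
    finally have E: "norm (E w) \<le> 4 * \<bar>M\<bar> * s\<^sup>2 * t\<^sup>2" .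
    have "norm (f t) = 1 / (\<bar>real_of_int c\<bar> ^ k * t ^ k) * norm (E w) * t ^ (k - 2)"
      using t by (simp add: f_def fE p norm_mult norm_power norm_divide abs_mult power_divide power_mult_distrib)
    also have "\<dots> \<le> 1 / (1 * t ^ k) * (4 * \<bar>M\<bar> * s\<^sup>2 * t\<^sup>2) * t ^ (k - 2)"
      using t ck by (intro mult_mono frac_le E) auto
    also have "\<dots> = 4 * \<bar>M\<bar> * s\<^sup>2 * (t ^ (k - 2) * t\<^sup>2 / t ^ k)" by simp
    also have "t ^ (k - 2) * t\<^sup>2 = t ^ k" using k by (metis le_add_diff_inverse2 power_add)
    finally show ?thesis using t by simp
  qed
  have cont: "continuous_on {0<..} f"
    unfolding f_def by (rule continuous_on_vertical_integrand)
  have "bounded (f ` {1/s..1})"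
    using s by (intro compact_imp_bounded compact_continuous_image continuous_on_subset[OF cont]) (auto intro: less_le_trans[of 0 "1/s"])
  then obtain B where B: "\<And>t. 1/s \<le> t \<Longrightarrow> t \<le> 1 \<Longrightarrow> norm (f t) \<le> B"
    unfolding bounded_iff by (metis atLeastAtMost_iff imageI)
  define B' where "B' = \<bar>B\<bar> + 4 * \<bar>M\<bar> * s\<^sup>2"
  have B': "B' \<ge> 0" by (simp add: B'_def)
  hence B'_exp: "B' * exp 1 \<ge> 0" by simp
  have "norm (f t) \<le> (\<bar>K\<bar> + B' * exp 1) * exp (- t)" if t: "t > 0" for t
  proof (cases "t \<ge> 1")
    case True
    have "norm (f t) \<le> K * exp (- t)" by (rule large[OF True])
    also have "\<dots> \<le> (\<bar>K\<bar> + B' * exp 1) * exp (- t)"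
      using B'_exp abs_ge_self[of K] by (intro mult_right_mono) auto
    finally show ?thesis .
  next
    case False
    have "norm (f t) \<le> B'"
      using small[OF t] B[of t] False by (cases "t \<le> 1/s") (auto simp: B'_def intro: order_trans[OF _ abs_ge_self] add_increasing2)
    \<comment> \<open>For \<open>t < 1\<close> the factor \<open>exp 1 * exp (- t)\<close> is at
      least 1, so a constant fits under the exponential.\<close>
    also have "B' * 1 \<le> B' * (exp 1 * exp (- t))"
      using False B' by (intro mult_left_mono) (auto simp flip: exp_add)
    hence "B' \<le> B' * exp 1 * exp (- t)" by (simp add: mult.assoc)
    also have "\<dots> \<le> (\<bar>K\<bar> + B' * exp 1) * exp (- t)" by (intro mult_right_mono) auto
    finally show ?thesis .
  qed
  thus ?thesis using that unfolding f_def x_s_def by blast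
qed

text \<open>Fundamental theorem for \<open>prim\<close>: it tends to 0 at the top, and near 0 the
  transformation law writes it as a value at a point escaping to infinity plus the period. The minus
  sign in \<open>int_inf_to\<close> restores the orientation.\<close>

theorem vertical_integral_eq_period:
  assumes \<gamma>: "(a, b, c, d) \<in> \<Gamma>" and c: "c \<noteq> 0"
  shows "int_inf_to (\<lambda>z. E z * (z - of_real (of_int a / of_int c)) ^ (k - 2)) (of_int a / of_int c) =
    period (a, b, c, d) 1 (- of_real (of_int a / of_int c))"
proof -
  define x s where "x = real_of_int a / real_of_int c" "s = (real_of_int c)\<^sup>2"
  have s: "s > 0" using c by (simp add: x_s_def)
  define P where "P = lin 1 (- of_real x)"
  define f where "f = (\<lambda>t. E (Complex x t) * poly P (Complex x t) * \<i>)"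
  obtain C where C: "\<And>t. t > 0 \<Longrightarrow> norm (E (Complex x t) * poly P (Complex x t)) \<le> C * exp (- t)"
    unfolding x_s_def P_def using vertical_integrand_bound[OF \<gamma> c] by blast
  have "integral {0<..} f = 0 - period (a, b, c, d) 1 (- of_real x)"
  proof (rule integral_halfline_FTC)
    show "((\<lambda>t. prim P (Complex x t)) has_vector_derivative f t) (at t)" if "t > 0" for t
      unfolding f_def by (rule has_vector_derivative_vertical, rule is_primD(1)[OF is_prim_prim]) (use that in simp)
    show "continuous_on {0<..} f"
      unfolding f_def by (intro continuous_on_mult_right continuous_on_vertical_integrand)
    show "norm (f t) \<le> C * exp (- t)" if "t > 0" for t
      using C[OF that] by (simp add: f_def norm_mult)
    show "((\<lambda>t. prim P (Complex x t)) \<longlongrightarrow> 0) at_top" by (rule is_primD(2)[OF is_prim_prim])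
    define P' where "P' = lin (1 * of_int a + - of_real x * of_int c) (1 * of_int b + - of_real x * of_int d)"
    have "((\<lambda>t. prim P' (Complex (- of_int d / of_int c) t)) \<longlongrightarrow> 0) at_top"
      by (rule is_primD(2)[OF is_prim_prim])
    moreover have "filterlim (\<lambda>t. 1 / (s * t)) at_top (at_right 0)" using s by real_asymp
    ultimately have "((\<lambda>t. prim P' (Complex (- of_int d / of_int c) (1 / (s * t)))) \<longlongrightarrow> 0) (at_right 0)"
      by (rule filterlim_compose)
    hence "((\<lambda>t. prim P' (Complex (- of_int d / of_int c) (1 / (s * t))) + period (a, b, c, d) 1 (- of_real x)) \<longlongrightarrow>
      0 + period (a, b, c, d) 1 (- of_real x)) (at_right 0)"
      by (intro tendsto_add tendsto_const)
    moreover have "eventually (\<lambda>t. prim P' (Complex (- of_int d / of_int c) (1 / (s * t))) + period (a, b, c, d) 1 (- of_real x) =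
       prim P (Complex x t)) (at_right 0)"
    proof -
      have "prim P' (Complex (- of_int d / of_int c) (1 / (s * t))) + period (a, b, c, d) 1 (- of_real x) =
         prim P (Complex x t)" if "t > 0" for t
        using prim_lin_moebius[OF \<gamma>, of "Complex (- of_int d / of_int c) (1 / (s * t))" 1 "- of_real x"]
          moebius_vertical(2)[OF \<gamma> c that] that s
        by (simp add: P'_def P_def x_s_def del: mob.simps period.simps)
      thus ?thesis by (auto simp: eventually_at_filter)
    qed
    ultimately show "((\<lambda>t. prim P (Complex x t)) \<longlongrightarrow> period (a, b, c, d) 1 (- of_real x)) (at_right 0)"
      by (simp add: tendsto_cong del: period.simps)
  qed
  moreover have "(\<lambda>t::real. E (of_real x + \<i> * of_real t) * (of_real x + \<i> * of_real t - of_real x) ^ (k - 2) * \<i>) = f"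
    by (simp add: f_def P_def poly_lin Complex_eq)
  ultimately show ?thesis unfolding int_inf_to_def x_s_def(1)[symmetric] by simp
qed

end

section \<open>Rational periods and the main theorem\<close>


lemma holomorphic_on_eisen:
  assumes "\<And>n. norm (chi1 n) \<le> 1" "\<And>n. norm (chi2 n) \<le> 1" "k \<ge> 1"
  shows "eisen chi1 chi2 k holomorphic_on {z. Im z > 0}"
proof -
  obtain a where a: "\<And>n. norm (a n) \<le> real n ^ k"
    "\<And>z. Im z > 0 \<Longrightarrow> eisen chi1 chi2 k z = 2 * (\<Sum>n. a n * ee z ^ n)"
    using eisen_q_series[of chi1 chi2 k] assms by metis
  have "(\<lambda>z. \<Sum>n. a n * ee z ^ n) holomorphic_on {z. Im z > 0}"
    unfolding holomorphic_on_def field_differentiable_def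
    using has_field_derivative_q_series[of a k, OF a(1)] has_field_derivative_at_within by blast
  hence "(\<lambda>z. 2 * (\<Sum>n. a n * ee z ^ n)) holomorphic_on {z. Im z > 0}"
    by (intro holomorphic_on_mult holomorphic_on_const)
  thus ?thesis by (rule holomorphic_transform) (simp add: a(2))
qed

text \<open>Without a constant term one factor \<open>ee z\<close> splits off; the remaining series
  is dominated by its majorant at \<open>Im z = 1\<close>, where \<open>norm (ee z)\<close> equals
  \<open>r\<close>.\<close>

lemma eisen_decay:
  assumes "\<And>n. norm (chi1 n) \<le> 1" "\<And>n. norm (chi2 n) \<le> 1" "k \<ge> 1"
  shows "\<exists>M. \<forall>z. Im z \<ge> 1 \<longrightarrow> norm (eisen chi1 chi2 k z) \<le> M * exp (- 2 * pi * Im z)"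
proof -
  obtain a where a: "\<And>n. norm (a n) \<le> real n ^ k"
    "\<And>z. Im z > 0 \<Longrightarrow> eisen chi1 chi2 k z = 2 * (\<Sum>n. a n * ee z ^ n)"
    using eisen_q_series[of chi1 chi2 k] assms by metis
  define r where "r = exp (- 2 * pi)"
  have r: "0 < r" "r < 1" by (auto simp: r_def)
  have "summable (\<lambda>n. real n ^ k * r ^ n)" using summable_power_times_power[of r k] r by simp
  hence "summable (\<lambda>n. real (Suc n) ^ k * r ^ Suc n)" by (subst summable_Suc_iff)
  hence "summable (\<lambda>n. real (Suc n) ^ k * r ^ n)"
    using summable_mult[of "\<lambda>n. real (Suc n) ^ k * r ^ Suc n" "1 / r"] r by (simp add: mult_ac)
  note sm = this
  have "norm (eisen chi1 chi2 k z) \<le> 2 * (\<Sum>n. real (Suc n) ^ k * r ^ n) * exp (- 2 * pi * Im z)"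
    if z: "Im z \<ge> 1" for z
  proof -
    define e where "e = exp (- 2 * pi * Im z)"
    have e: "0 \<le> e" "e \<le> r" using z by (auto simp: e_def r_def)
    have s: "summable (\<lambda>n. norm (a n * ee z ^ n))"
      by (rule summable_norm_poly_bound[OF a(1) norm_ee_less_1]) (use z in auto)
    have "norm (a 0) \<le> 0" using a(1)[of 0] assms(3) by (simp add: power_0_left)
    hence "(\<Sum>n. a n * ee z ^ n) = (\<Sum>n. a (Suc n) * ee z ^ Suc n)"
      by (subst suminf_split_head[OF summable_norm_cancel[OF s]]) simp
    also have "norm \<dots> \<le> (\<Sum>n. norm (a (Suc n) * ee z ^ Suc n))"
      by (rule summable_norm) (use s in \<open>simp only: summable_Suc_iff[of "\<lambda>n. norm (a n * ee z ^ n)"]\<close>)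
    also have "\<dots> \<le> (\<Sum>n. real (Suc n) ^ k * r ^ n * e)"
    proof (rule suminf_le)
      fix n
      have "norm (a (Suc n)) * (e ^ n * e) \<le> real (Suc n) ^ k * (r ^ n * e)"
        by (intro mult_mono a(1) mult_right_mono power_mono e) (use e in auto)
      thus "norm (a (Suc n) * ee z ^ Suc n) \<le> real (Suc n) ^ k * r ^ n * e"
        by (simp add: norm_mult norm_power norm_ee e_def mult_ac)
    next
      show "summable (\<lambda>n. norm (a (Suc n) * ee z ^ Suc n))"
        using s by (simp only: summable_Suc_iff[of "\<lambda>n. norm (a n * ee z ^ n)"])
      show "summable (\<lambda>n. real (Suc n) ^ k * r ^ n * e)" by (rule summable_mult2[OF sm])
    qed
    also have "\<dots> = (\<Sum>n. real (Suc n) ^ k * r ^ n) * e" by (rule suminf_mult2[OF sm, symmetric])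
    finally show ?thesis using z by (simp add: a(2) norm_mult e_def)
  qed
  thus ?thesis by blast
qed

section \<open>The period cocycle on \<open>Gamma1\<close>\<close>

lemma Gamma1_mult:
  assumes "g \<in> Gamma1 N" "h \<in> Gamma1 N"
  shows "mat_mult g h \<in> Gamma1 N"
proof -
  obtain a b c d a' b' c' d' where gh: "g = (a, b, c, d)" "h = (a', b', c', d')" by (cases g, cases h)
  note G = Gamma1D[OF assms(1)[unfolded gh]] and H = Gamma1D[OF assms(2)[unfolded gh]]
  have "(a * a' + b * c') * (c * b' + d * d') - (a * b' + b * d') * (c * a' + d * c') =
      (a * d - b * c) * (a' * d' - b' * c')" by (simp add: algebra_simps)
  moreover have "[a * a' + b * c' = 1 * 1 + 0] (mod N)"
    by (rule cong_add[OF cong_mult[OF G(3) H(3)]]) (use H(2) in \<open>simp add: cong_0_iff\<close>)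
  moreover have "[c * b' + d * d' = 0 + 1 * 1] (mod N)"
    by (rule cong_add[OF _ cong_mult[OF G(4) H(4)]]) (use G(2) in \<open>simp add: cong_0_iff\<close>)
  ultimately show ?thesis using G H by (simp add: gh mat_mult_def Gamma1_def)
qed

lemma Gamma1_inv: "g \<in> Gamma1 N \<Longrightarrow> mat_inv g \<in> Gamma1 N"
  by (cases g) (auto simp: mat_inv_def Gamma1_def algebra_simps)

lemma mat_inv_inv: "mat_inv (mat_inv g) = g"
  by (cases g) (simp add: mat_inv_def)

lemma mat_mult_inv:
  assumes "g \<in> Gamma1 N"
  shows "mat_mult g (mat_inv g) = (1, 0, 0, 1)" "mat_mult (mat_inv g) g = (1, 0, 0, 1)"
  using assms by (cases g; auto simp: mat_inv_def mat_mult_def Gamma1_def algebra_simps)+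

locale gamma1_cuspidal_form = modular_cuspidal_form k E "Gamma1 N"
  for k :: nat and E :: "complex \<Rightarrow> complex" and N :: int +
  assumes N: "N > 0"
begin

declare period.simps [simp del] mob.simps [simp del]

lemma period_scale:
  assumes "g \<in> Gamma1 N"
  shows "period g (r * u) (r * v) = r ^ (k - 2) * period g u v"
proof -
  obtain a b c d where g: "g = (a, b, c, d)" by (cases g)
  obtain \<rho> where \<rho>: "\<And>u v. period (a, b, c, d) u v = (\<Sum>n\<le>k - 2. of_nat (k - 2 choose n) * u ^ n * v ^ (k - 2 - n) * \<rho> n)"
    using period_expansion[OF assms[unfolded g]] by blast
  have *: "of_nat (k - 2 choose n) * (r * u) ^ n * (r * v) ^ (k - 2 - n) * \<rho> n =
     r ^ (k - 2) * (of_nat (k - 2 choose n) * u ^ n * v ^ (k - 2 - n) * \<rho> n)" if "n \<le> k - 2" for n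
  proof -
    have "r ^ (k - 2) = r ^ n * r ^ (k - 2 - n)" using that by (metis le_add_diff_inverse power_add)
    thus ?thesis by (simp add: power_mult_distrib mult_ac)
  qed
  show ?thesis unfolding g \<rho> sum_distrib_left by (rule sum.cong) (use * in auto)
qed

text \<open>Cocycle relation for a matrix times its inverse: the product is the identity, with
  period 0.\<close>

lemma period_inv:
  assumes "(a, b, c, d) \<in> Gamma1 N"
  shows "period (mat_inv (a, b, c, d)) (u * of_int a + v * of_int c) (u * of_int b + v * of_int d) =
    - period (a, b, c, d) u v"
proof -
  have "(1, 0, 0, 1) \<in> Gamma1 N" by (simp add: Gamma1_def)
  moreover have "(d, - b, - c, a) \<in> Gamma1 N" using Gamma1_inv[OF assms] by (simp add: mat_inv_def)
  ultimately have "period (1, 0, 0, 1) u v =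
     period (d, - b, - c, a) (u * of_int a + v * of_int c) (u * of_int b + v * of_int d) + period (a, b, c, d) u v"
    using period_mult[OF assms, of d "- b" "- c" a u v] mat_mult_inv(1)[OF assms] by (simp add: mat_inv_def)
  thus ?thesis by (simp add: mat_inv_def period_one add_eq_0_iff)
qed

text \<open>\<open>Shat\<close> without its constant factor.\<close>

definition cusp_integral :: "real \<Rightarrow> complex" where
  "cusp_integral x = int_inf_to (\<lambda>z. E z * (z - of_real x) ^ (k - 2)) x"

lemma cusp_integral_eq_period:
  assumes "(a, b, c, d) \<in> Gamma1 N" "c \<noteq> 0"
  shows "cusp_integral (of_int a / of_int c) = period (a, b, c, d) 1 (- of_real (of_int a / of_int c))"
  unfolding cusp_integral_def by (rule vertical_integral_eq_period[OF assms])

text \<open>The cusp \<open>x = n + 1 / N\<close> is the image of infinity under a matrix \<delta>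
  of \<open>Gamma1\<close>, where modularity is known. The two integrals are periods of \<delta> and
  of \<gamma> times \<delta>; the cocycle relation at the row \<open>(j, - e)\<close>, which
  \<gamma> maps to \<open>(1, - x)\<close>, leaves only the period of \<gamma>.\<close>

lemma cusp_integral_cocycle:
  fixes n :: int
  assumes \<gamma>: "(a, b, c, d) \<in> Gamma1 N" and x: "x = (1 + of_int n * of_int N) / of_int N"
    and j: "j = of_int c * x + of_int d" "j \<noteq> 0"
  shows "cusp_integral x - of_real j ^ (k - 2) * cusp_integral ((of_int a * x + of_int b) / j) =
    period (mat_inv (a, b, c, d)) 1 (- of_real x)"
proof -
  define e where "e = of_int a * x + of_int b"
  have \<delta>: "(1 + n * N, n, N, 1) \<in> Gamma1 N" by (simp add: Gamma1_def cong_def)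
  note \<gamma>\<delta> = Gamma1_mult[OF \<gamma> \<delta>]
  have det: "real_of_int a * of_int d = 1 + of_int b * of_int c"
    using arg_cong[OF det[OF \<gamma>], of real_of_int] by simp
  have Nx: "of_int N * x = 1 + of_int n * of_int N" using N by (simp add: x)
  have "of_int N * e = of_int a * (of_int N * x) + of_int b * of_int N"
    "of_int N * j = of_int c * (of_int N * x) + of_int d * of_int N"
    by (simp_all add: e_def j algebra_simps)
  hence eN: "of_int N * e = of_int (a * (1 + n * N) + b * N)" and jN: "of_int N * j = of_int (c * (1 + n * N) + d * N)"
    by (simp_all add: Nx)
  have "of_int (c * (1 + n * N) + d * N) \<noteq> (0 :: real)" using jN j(2) N by (metis mult_eq_0_iff of_int_0_less_iff order_less_irrefl)
  hence c': "c * (1 + n * N) + d * N \<noteq> 0" by (metis of_int_0)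
  have "e / j = (of_int N * e) / (of_int N * j)" using N by simp
  hence ej: "e / j = of_int (a * (1 + n * N) + b * N) / of_int (c * (1 + n * N) + d * N)"
    by (simp only: eN jN)
  have "cusp_integral x = period (1 + n * N, n, N, 1) 1 (- of_real x)"
    using cusp_integral_eq_period[OF \<delta>] N by (simp add: x)
  \<comment> \<open>Homogeneity absorbs the power of \<open>j\<close> and turns the row
    \<open>(1, - e / j)\<close> into \<open>(j, - e)\<close>.\<close>
  moreover have "of_real j ^ (k - 2) * cusp_integral (e / j) =
      period (mat_mult (a, b, c, d) (1 + n * N, n, N, 1)) (of_real j) (- of_real e)"
  proof -
    have "cusp_integral (e / j) = period (mat_mult (a, b, c, d) (1 + n * N, n, N, 1)) 1 (- of_real (e / j))"
      using \<gamma>\<delta> c' unfolding ej mat_mult_def by (simp only: prod.case) (rule cusp_integral_eq_period)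
    hence "of_real j ^ (k - 2) * cusp_integral (e / j) =
      period (mat_mult (a, b, c, d) (1 + n * N, n, N, 1)) (of_real j * 1) (of_real j * - of_real (e / j))"
      by (simp only: period_scale[OF \<gamma>\<delta>])
    thus ?thesis using j(2) by simp
  qed
  moreover have u: "of_real j * of_int a + - of_real e * of_int c = (1 :: complex)"
    "of_real j * of_int b + - of_real e * of_int d = (- of_real x :: complex)"
  proof -
    have "j * of_int a - e * of_int c = 1" "j * of_int b - e * of_int d = - x"
      using det by (simp_all add: j e_def algebra_simps)
    from arg_cong[OF this(1), of complex_of_real] arg_cong[OF this(2), of complex_of_real]
    show "of_real j * of_int a + - of_real e * of_int c = (1 :: complex)"
      "of_real j * of_int b + - of_real e * of_int d = (- of_real x :: complex)" by simp_all
  qed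
  ultimately have "cusp_integral x - of_real j ^ (k - 2) * cusp_integral (e / j) =
     - period (a, b, c, d) (of_real j) (- of_real e)"
    by (simp only: period_mult[OF \<gamma> \<delta> \<gamma>\<delta>] u) simp
  also have "\<dots> = period (mat_inv (a, b, c, d)) 1 (- of_real x)"
    using period_inv[OF \<gamma>, of "of_real j" "- of_real e"] by (simp only: u)
  finally show ?thesis by (simp add: e_def)
qed

end


lemma poly_map_of_real: "poly (map_poly complex_of_real p) (of_real x) = of_real (poly p x)"
  by (induction p) (auto simp: map_poly_pCons)

context gamma1_cuspidal_form
begin

text \<open>The period polynomial of \<open>g\<close> takes values in the given lattice on the integral linear forms in
  \<open>q w\<close> and \<open>1\<close>; for \<open>q\<close> dividing the level, \<open>\<Gamma>\<^sub>1\<close> permutes these forms.\<close>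
definition integral_period :: "complex \<Rightarrow> nat \<Rightarrow> real \<Rightarrow> mat2 \<Rightarrow> bool" where
  "integral_period C q m g \<longleftrightarrow> (\<forall>u v. \<exists>z::int.
     of_nat q * C * period g (of_int u * of_nat q) (of_int v) = of_real (m * of_int z))"

lemma integral_period_one: "integral_period C q m (1, 0, 0, 1)"
  by (auto simp: integral_period_def period_one intro: exI[of _ 0])

text \<open>As \<open>c = q * t\<close>, the row \<open>(u * q, v)\<close> times \<open>g\<close>
  again has integers \<open>u'\<close>, \<open>v'\<close> with \<open>(u' * q, v')\<close>, so both
  terms of the cocycle relation lie in the lattice.\<close>

lemma integral_period_mult:
  assumes q: "int q dvd N" and g: "g \<in> Gamma1 N" "integral_period C q m g"
    and h: "h \<in> Gamma1 N" "integral_period C q m h"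
  shows "integral_period C q m (mat_mult g h)"
  unfolding integral_period_def
proof (intro allI)
  fix u v
  obtain a b c d a' b' c' d' where gh: "g = (a, b, c, d)" "h = (a', b', c', d')" by (cases g, cases h)
  obtain t where t: "c = int q * t" using q Gamma1D(2)[OF g(1)[unfolded gh]] by (meson dvd_def dvd_trans)
  obtain z1 where z1: "of_nat q * C * period g (of_int u * of_nat q) (of_int v) = of_real (m * of_int z1)"
    using g(2) unfolding integral_period_def by blast
  obtain z2 where z2: "of_nat q * C * period h (of_int (u * a + v * t) * of_nat q) (of_int (u * int q * b + v * d)) =
      of_real (m * of_int z2)"
    using h(2) unfolding integral_period_def by blast
  have "period (mat_mult g h) (of_int u * of_nat q) (of_int v) =
     period h (of_int (u * a + v * t) * of_nat q) (of_int (u * int q * b + v * d)) + period g (of_int u * of_nat q) (of_int v)"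
    using period_mult[OF g(1)[unfolded gh] h(1)[unfolded gh] Gamma1_mult[OF g(1) h(1), unfolded gh],
        of "of_int u * of_nat q" "of_int v"]
    by (simp add: gh t algebra_simps)
  hence "of_nat q * C * period (mat_mult g h) (of_int u * of_nat q) (of_int v) = of_real (m * of_int (z2 + z1))"
    using z1 z2 by (simp add: distrib_left)
  thus "\<exists>z::int. of_nat q * C * period (mat_mult g h) (of_int u * of_nat q) (of_int v) = of_real (m * of_int z)" ..
qed

text \<open>\<open>period_inv\<close> at the row \<open>(u * q, v)\<close> times the inverse matrix,
  which keeps the same shape because \<open>q\<close> divides \<open>c\<close>.\<close>

lemma integral_period_inv:
  assumes q: "int q dvd N" and g: "g \<in> Gamma1 N" "integral_period C q m g"
  shows "integral_period C q m (mat_inv g)"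
  unfolding integral_period_def
proof (intro allI)
  fix u v
  obtain a b c d where gg: "g = (a, b, c, d)" by (cases g)
  note g' = g(1)[unfolded gg]
  obtain t where t: "c = int q * t" using q Gamma1D(2)[OF g'] by (meson dvd_def dvd_trans)
  obtain z where z: "of_nat q * C * period g (of_int (u * d - v * t) * of_nat q) (of_int (v * a - u * int q * b)) =
      of_real (m * of_int z)"
    using g(2) unfolding integral_period_def by blast
  have "of_int (u * d - v * t) * of_nat q * of_int a + of_int (v * a - u * int q * b) * of_int c =
      (of_int (u * int q * (a * d - b * c)) :: complex)"
    "of_int (u * d - v * t) * of_nat q * of_int b + of_int (v * a - u * int q * b) * of_int d =
      (of_int (v * (a * d - b * c)) :: complex)"
    by (simp_all add: t algebra_simps)
  hence "period (mat_inv g) (of_int u * of_nat q) (of_int v) =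
      - period g (of_int (u * d - v * t) * of_nat q) (of_int (v * a - u * int q * b))"
    using period_inv[OF g', of "of_int (u * d - v * t) * of_nat q" "of_int (v * a - u * int q * b)"]
    by (simp add: gg Gamma1D(1)[OF g'])
  hence "of_nat q * C * period (mat_inv g) (of_int u * of_nat q) (of_int v) = of_real (m * of_int (- z))"
    using z by simp
  thus "\<exists>z::int. of_nat q * C * period (mat_inv g) (of_int u * of_nat q) (of_int v) = of_real (m * of_int z)" ..
qed

text \<open>Test points for an identity of polynomials: at most one of the points
  \<open>n + 1 / N\<close> is a zero of the denominator.\<close>

lemma infinite_cusps:
  fixes c d :: int
  assumes "(c, d) \<noteq> (0, 0)"
  shows "infinite {x. \<exists>n::nat. x = (1 + real n * of_int N) / of_int N \<and> of_int c * x + of_int d \<noteq> 0}"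
proof -
  define X where "X = range (\<lambda>n::nat. (1 + real n * of_int N) / of_int N)"
  have "infinite X"
    unfolding X_def using N by (intro range_inj_infinite) (auto simp: inj_def)
  moreover have "finite {x::real. of_int c * x + of_int d = 0}"
  proof (cases "c = 0")
    case False
    hence "{x::real. of_int c * x + of_int d = 0} \<subseteq> {- of_int d / of_int c}"
      by (auto simp: field_simps eq_neg_iff_add_eq_0)
    thus ?thesis by (rule finite_subset) simp
  qed (use assms in simp)
  ultimately have "infinite (X - {x. of_int c * x + of_int d = 0})" by (rule Diff_infinite_finite[rotated])
  moreover have "X - {x. of_int c * x + of_int d = 0} =
      {x. \<exists>n::nat. x = (1 + real n * of_int N) / of_int N \<and> of_int c * x + of_int d \<noteq> 0}"
    by (auto simp: X_def)
  ultimately show ?thesis by simp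
qed

text \<open>The given polynomial and \<open>C\<close> times the period at \<open>(1, - x)\<close>
  agree at infinitely many cusps, hence in every coefficient. The weight \<open>q ^ (n + 1)\<close>
  in \<open>Pset\<close> fits the coefficient of \<open>x ^ (K - n)\<close>: \<open>q ^ n\<close>
  comes from the entry \<open>u * q\<close>, one more \<open>q\<close> from
  \<open>integral_period\<close>.\<close>

lemma integral_period_of_cocycle_poly:
  assumes g: "(a, b, c, d) \<in> Gamma1 N" and p: "p \<in> Pset k m q"
    and eq: "\<And>n::nat. \<And>x. x = (1 + real n * of_int N) / of_int N \<Longrightarrow> of_int c * x + of_int d \<noteq> 0 \<Longrightarrow>
      C * (cusp_integral x - of_real (of_int c * x + of_int d) ^ (k - 2) *
        cusp_integral ((of_int a * x + of_int b) / (of_int c * x + of_int d))) =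
      of_real (poly (map_poly real_of_rat p) x)"
  shows "integral_period C q m (mat_inv (a, b, c, d))"
proof -
  define K where "K = k - 2"
  define P where "P = map_poly complex_of_real (map_poly real_of_rat p)"
  have coeff_P: "coeff P n = of_real (real_of_rat (coeff p n))" for n
    by (simp add: P_def coeff_map_poly)
  have poly_P: "poly P (of_real x) = of_real (poly (map_poly real_of_rat p) x)" for x
    unfolding P_def by (rule poly_map_of_real)
  note ginv = Gamma1_inv[OF g]
  obtain \<rho> where \<rho>: "\<And>u v. period (mat_inv (a, b, c, d)) u v = (\<Sum>n\<le>K. of_nat (K choose n) * u ^ n * v ^ (K - n) * \<rho> n)"
    using period_expansion[OF ginv[unfolded mat_inv_def prod.case]] unfolding mat_inv_def prod.case K_def by blast
  \<comment> \<open>\<open>C\<close> times the period at \<open>(1, - x)\<close> as a polynomial in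
    \<open>x\<close>; the entry \<open>- x\<close> causes the signs and the exponent
    \<open>K - n\<close>.\<close>
  define Q where "Q = (\<Sum>n\<le>K. monom (C * of_nat (K choose n) * (-1) ^ (K - n) * \<rho> n) (K - n))"
  have poly_Q: "poly Q x = C * period (mat_inv (a, b, c, d)) 1 (- x)" for x
    by (simp add: Q_def \<rho> poly_sum poly_monom sum_distrib_left power_minus[of x] mult_ac)
  have coeff_Q: "coeff Q (K - n) = C * of_nat (K choose n) * (-1) ^ (K - n) * \<rho> n" if "n \<le> K" for n
  proof -
    have "coeff Q (K - n) = (\<Sum>i\<le>K. if i = n then C * of_nat (K choose i) * (-1) ^ (K - i) * \<rho> i else 0)"
      unfolding Q_def coeff_sum using that by (intro sum.cong) auto
    thus ?thesis using that by simp
  qed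
  have "P = Q"
  proof (rule ccontr)
    assume "P \<noteq> Q"
    hence "finite {z. poly (P - Q) z = 0}" by (intro poly_roots_finite) simp
    moreover have cd: "(c, d) \<noteq> (0, 0)" using Gamma1D(1)[OF g] by auto
    have "complex_of_real ` {x. \<exists>n::nat. x = (1 + real n * of_int N) / of_int N \<and> of_int c * x + of_int d \<noteq> 0} \<subseteq>
        {z. poly (P - Q) z = 0}"
    proof (safe, goal_cases)
      case (1 _ x n)
      let ?x = "(1 + real n * of_int N) / of_int N"
      have "cusp_integral ?x - of_real (of_int c * ?x + of_int d) ^ (k - 2) *
        cusp_integral ((of_int a * ?x + of_int b) / (of_int c * ?x + of_int d)) = period (mat_inv (a, b, c, d)) 1 (- of_real ?x)"
        by (rule cusp_integral_cocycle[OF g _ refl, of _ "int n"]) (use 1 in simp_all)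
      hence "C * period (mat_inv (a, b, c, d)) 1 (- of_real ?x) = poly P (of_real ?x)"
        using eq[OF refl 1(1)] by (simp only: poly_P)
      thus ?case by (simp only: poly_diff poly_Q) simp
    qed
    ultimately have "finite (complex_of_real ` {x. \<exists>n::nat. x = (1 + real n * of_int N) / of_int N \<and> of_int c * x + of_int d \<noteq> 0})"
      using finite_subset by blast
    thus False using infinite_cusps[OF cd] by (auto dest!: finite_imageD simp: inj_on_def)
  qed
  have "\<exists>z::int. real_of_rat (of_nat q ^ (n + 1) * coeff p (K - n)) = m * of_int z" if "n \<le> K" for n
  proof -
    have "k - n - 2 = K - n" by (simp add: K_def)
    thus ?thesis using p that by (fastforce simp: Pset_def K_def)
  qed
  then obtain z :: "nat \<Rightarrow> int" where z: "\<And>n. n \<le> K \<Longrightarrow> real_of_rat (of_nat q ^ (n + 1) * coeff p (K - n)) = m * of_int (z n)"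
    by metis
  \<comment> \<open>The binomial coefficient stays with \<open>\<rho> n\<close>, as in the expansion
    of the period, so no division occurs; the sign moves into the integer.\<close>
  have \<rho>z: "of_nat q ^ (n + 1) * (C * of_nat (K choose n) * \<rho> n) = of_real (m * of_int ((-1) ^ (K - n) * z n))" if "n \<le> K" for n
  proof -
    have "of_real (real_of_rat (coeff p (K - n))) = C * of_nat (K choose n) * (-1) ^ (K - n) * \<rho> n"
      using coeff_Q[OF that] coeff_P[of "K - n"] \<open>P = Q\<close> by simp
    hence "of_real (m * of_int (z n)) = of_nat q ^ (n + 1) * (C * of_nat (K choose n) * (-1) ^ (K - n) * \<rho> n)"
      unfolding z[OF that, symmetric] by (simp add: of_rat_mult of_rat_power)
    thus ?thesis by (cases "even (K - n)") (auto simp: mult_ac)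
  qed
  show ?thesis
    unfolding integral_period_def
  proof (intro allI)
    fix u v
    have "of_nat q * C * period (mat_inv (a, b, c, d)) (of_int u * of_nat q) (of_int v) =
       (\<Sum>n\<le>K. of_int (u ^ n * v ^ (K - n)) * (of_nat q ^ (n + 1) * (C * of_nat (K choose n) * \<rho> n)))"
      by (simp add: \<rho> sum_distrib_left power_mult_distrib mult_ac)
    also have "\<dots> = (\<Sum>n\<le>K. of_int (u ^ n * v ^ (K - n)) * of_real (m * of_int ((-1) ^ (K - n) * z n)))"
      by (intro sum.cong) (simp_all only: \<rho>z atMost_iff)
    also have "\<dots> = of_real (m * of_int (\<Sum>n\<le>K. u ^ n * v ^ (K - n) * ((-1) ^ (K - n) * z n)))"
      by (simp add: sum_distrib_left mult_ac)
    finally show "\<exists>z::int. of_nat q * C * period (mat_inv (a, b, c, d)) (of_int u * of_nat q) (of_int v) = of_real (m * of_int z)" ..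
  qed
qed

end

lemma primitive_quadratic_char_facts:
  assumes "primitive_char q chi" "quadratic_char chi"
  shows "q > 0" "\<And>n. norm (chi n) \<le> 1" "\<And>n. cnj (chi n) = chi n" "chi 0 = 0"
    "\<And>n. chi (- n) = chi (- 1) * chi n" "\<And>n. chi (n + int q) = chi n"
proof -
  have D: "q > 0" "\<And>n. chi (n + int q) = chi n" "\<And>m n. chi (m * n) = chi m * chi n" "chi 1 = 1"
    "\<And>n. chi n = 0 \<longleftrightarrow> \<not> coprime n (int q)"
    using assms(1) by (auto simp: primitive_char_def dirichlet_char_def)
  have Q: "chi n \<in> {-1, 0, 1}" for n using assms(2) by (auto simp: quadratic_char_def)
  show "q > 0" "chi (n + int q) = chi n" for n by (fact D)+
  show "norm (chi n) \<le> 1" "cnj (chi n) = chi n" for n using Q[of n] by auto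
  show "chi (- n) = chi (- 1) * chi n" for n using D(3)[of "- 1" n] by simp
  show "chi 0 = 0"
  proof (rule ccontr)
    assume "chi 0 \<noteq> 0"
    \<comment> \<open>0 is coprime to \<open>q\<close> only for \<open>q = 1\<close>, where
      \<open>chi\<close> is constantly 1; the value -1 of a quadratic character excludes
      this.\<close>
    hence "q = 1" using D(5)[of 0] by simp
    hence "chi n = chi 1" for n by (intro periodic_cong[where f = chi, OF D(2)]) simp
    moreover obtain n where "chi n = -1" using assms(2) by (auto simp: quadratic_char_def)
    ultimately show False using D(4) by (metis one_neq_neg_one)
  qed
qed

theorem theorem1p17:
  fixes k q1 q2 :: nat and chi1 chi2 :: "int \<Rightarrow> complex" and m :: real and G :: "mat2 set"
  assumes "k \<ge> 2"
    and "primitive_char q1 chi1" and "quadratic_char chi1"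
    and "primitive_char q2 chi2" and "quadratic_char chi2"
    and "chi1 (-1) * chi2 (-1) = (-1) ^ k"
    and "finite G" and "G \<subseteq> Gamma1 (int (q1 * q2))"
    and "gen_group G = Gamma1 (int (q1 * q2))"
    and "\<forall>\<gamma>\<in>G. \<exists>p \<in> Pset k m q1. \<forall>x \<in> finite_cusps0 (int (q1 * q2)).
            h_fun chi1 chi2 q1 k \<gamma> x = of_real (poly (map_poly real_of_rat p) x)"
  shows "\<forall>\<gamma> \<in> Gamma1 (int (q1 * q2)). fst (snd (snd \<gamma>)) \<noteq> 0 \<longrightarrow>
           Stilde chi1 chi2 q1 k \<gamma> \<in> {of_real (m * of_int n / of_nat q1) | n::int. True}"
proof -
  note c1 = primitive_quadratic_char_facts[OF assms(2,3)]
  note c2 = primitive_quadratic_char_facts[OF assms(4,5)]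
  define N where "N = int (q1 * q2)"
  have N: "N > 0" using c1(1) c2(1) by (simp add: N_def)
  \<comment> \<open>The parity signs are \<open>chi1 (- 1)\<close> and \<open>chi2 (- 1)\<close>;
    conjugation does not affect \<open>chi2\<close>, whose values are real.\<close>
  interpret F: gamma1_cuspidal_form k "eisen chi1 chi2 k" N
  proof unfold_locales
    fix a b c d z assume g: "(a, b, c, d) \<in> Gamma1 N"
    show "a * d - b * c = 1" using Gamma1D(1)[OF g] .
    assume z: "Im z > 0"
    have "cnj (chi2 (- n)) = chi2 (- 1) * cnj (chi2 n)" for n
      by (simp only: c2(3)) (rule c2(5))
    thus "eisen chi1 chi2 k (mob (a, b, c, d) z) = (of_int c * z + of_int d) ^ k * eisen chi1 chi2 k z"
      unfolding mob.simps
      by (rule eisen_modular[where ?chi1.0 = chi1 and ?chi2.0 = chi2,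
          OF g[unfolded N_def] assms(1) c2(1) z c1(2,4,5,6) c2(2,4) _ c2(6) assms(6)])
  next
    show "eisen chi1 chi2 k holomorphic_on {z. Im z > 0}"
      by (rule holomorphic_on_eisen) (use assms(1) c1(2) c2(2) in auto)
    show "\<exists>M. \<forall>z. 1 \<le> Im z \<longrightarrow> norm (eisen chi1 chi2 k z) \<le> M * exp (- 2 * pi * Im z)"
      by (rule eisen_decay) (use assms(1) c1(2) c2(2) in auto)
  qed (use assms(1) N in auto)
  define C where "C = (-1) ^ k * gauss_sum q1 (\<lambda>n. cnj (chi1 n)) * of_nat (k - 1)"
  have Shat: "Shat chi1 chi2 q1 k x = C * F.cusp_integral x" for x
    by (simp add: Shat_def C_def F.cusp_integral_def)
  have qN: "int q1 dvd N" by (simp add: N_def)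
  have gens: "F.integral_period C q1 m g" if "g \<in> G" for g
  proof -
    have g: "g \<in> Gamma1 N" using that assms(8) by (auto simp: N_def)
    obtain a b c d where gg: "g = (a, b, c, d)" by (cases g)
    obtain p where p: "p \<in> Pset k m q1" and hp: "\<forall>x\<in>finite_cusps0 N.
        h_fun chi1 chi2 q1 k g x = of_real (poly (map_poly real_of_rat p) x)"
      using bspec[OF assms(10) \<open>g \<in> G\<close>] unfolding N_def by (rule bexE)
    \<comment> \<open>The hypothesis on \<open>h_fun\<close> controls the period of the inverse
      matrix; inverting once more returns to the generator.\<close>
    have "F.integral_period C q1 m (mat_inv (a, b, c, d))"
    proof (rule F.integral_period_of_cocycle_poly[OF g[unfolded gg] p])
      fix n :: nat and x :: real
      assume x: "x = (1 + real n * of_int N) / of_int N" and j: "of_int c * x + of_int d \<noteq> 0"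
      \<comment> \<open>This matrix sends infinity to \<open>x\<close>, so the hypothesis on
        \<open>h_fun\<close> is available there.\<close>
      have "(1 + int n * N, int n, N, 1) \<in> Gamma0 N" by (simp add: Gamma0_def)
      moreover have "x = of_int (1 + int n * N) / of_int N" by (simp add: x)
      ultimately have "x \<in> finite_cusps0 N" using N unfolding finite_cusps0_def by blast
      \<comment> \<open>For a nonzero denominator the default value 0 at infinity in
        \<open>h_fun\<close> does not occur.\<close>
      from bspec[OF hp this] show "C * (F.cusp_integral x - of_real (of_int c * x + of_int d) ^ (k - 2) *
        F.cusp_integral ((of_int a * x + of_int b) / (of_int c * x + of_int d))) =
        of_real (poly (map_poly real_of_rat p) x)"
        using j by (simp add: h_fun_def gg Let_def Shat algebra_simps)
    qed
    hence "F.integral_period C q1 m (mat_inv (mat_inv (a, b, c, d)))"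
      by (rule F.integral_period_inv[OF qN Gamma1_inv[OF g[unfolded gg]]])
    thus ?thesis by (simp add: mat_inv_inv gg)
  qed
  have all: "F.integral_period C q1 m g" if "g \<in> gen_group G" for g
    using that
  proof (induction rule: gen_group.induct)
    case gen_one
    show ?case by (rule F.integral_period_one)
  next
    case (gen_base g)
    thus ?case by (rule gens)
  next
    case (gen_mult x y)
    thus ?case using assms(9) by (intro F.integral_period_mult[OF qN]) (auto simp: N_def)
  next
    case (gen_inv x)
    thus ?case using assms(9) by (intro F.integral_period_inv[OF qN]) (auto simp: N_def)
  qed
  show ?thesis
  proof (intro ballI impI)
    fix g assume g: "g \<in> Gamma1 (int (q1 * q2))" and c0: "fst (snd (snd g)) \<noteq> 0"
    obtain a b c d where gg: "g = (a, b, c, d)" by (cases g)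
    have c: "c \<noteq> 0" using c0 by (simp add: gg)
    have g': "(a, b, c, d) \<in> Gamma1 N" using g by (simp add: gg N_def)
    obtain t where t: "c = int q1 * t" using qN Gamma1D(2)[OF g'] by (meson dvd_def dvd_trans)
    \<comment> \<open>With \<open>u = t\<close> and \<open>v = - a\<close> the integral row is
      \<open>(c, - a)\<close>, since \<open>c = q1 * t\<close>.\<close>
    obtain z :: int where z: "of_nat q1 * C * F.period (a, b, c, d) (of_int t * of_nat q1) (of_int (- a)) = of_real (m * of_int z)"
      using all[of "(a, b, c, d)"] assms(9) g unfolding F.integral_period_def gg by blast
    have "Stilde chi1 chi2 q1 k g = C * (of_int c ^ (k - 2) * F.period (a, b, c, d) 1 (- of_real (of_int a / of_int c)))"
      using F.cusp_integral_eq_period[OF g' c] by (simp add: Stilde_def S_fun_def gg Shat)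
    \<comment> \<open>Homogeneity clears the denominator: \<open>c\<close> times the row
      \<open>(1, - a / c)\<close> is \<open>(c, - a)\<close>.\<close>
    also have "of_int c ^ (k - 2) * F.period (a, b, c, d) 1 (- of_real (of_int a / of_int c)) =
        F.period (a, b, c, d) (of_int t * of_nat q1) (of_int (- a))"
      using F.period_scale[OF g', of "of_int c" 1 "- of_real (of_int a / of_int c)"] c
      by (simp add: t mult.commute)
    finally have "of_nat q1 * Stilde chi1 chi2 q1 k g = of_real (m * of_int z)"
      using z by (simp add: mult_ac)
    hence "Stilde chi1 chi2 q1 k g = of_real (m * of_int z / of_nat q1)"
      using c1(1) by (simp add: field_simps)
    thus "Stilde chi1 chi2 q1 k g \<in> {of_real (m * of_int n / of_nat q1) | n::int. True}" by blast
  qed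
qed

end
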